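(* Let $m\ge2$ and $T>0$ be real. Then for any $u\in C([0,T],C^m_{\mathrm{ap}}(\mathbb{R}^n,\mathbb{R}^n))$ there exists a unique solution $\varphi\in C^1([0,T],\mathrm{Diff}^m_{\mathrm{ap}}(\mathbb{R}^n))$ of $$\dot\varphi=u\circ\varphi,\qquad\varphi|_{t=0}=\mathrm{id}.$$
   Context: For real $m\ge0$, $C^m_b(\mathbb{R}^n,\mathbb{R})$ is the standard Hölder space: for integer $m$, $C^m$ functions with bounded continuous derivatives of order $\le m$, norm $\max_{|\beta|\le m}\sup|\partial^\beta f|$; for $m=k+\gamma$ ($0<\gamma<1$), functions in $C^k_b$ with $\gamma$-Hölder order-$k$ derivatives, norm $|f|_k$ plus the $\gamma$-Hölder seminorm of the order-$k$ derivatives. $C^m_{\mathrm{ap}}=\{f\in C^m_b:\{f(\cdot+c)\}_{c\in\mathbb{R}^n}\text{ precompact in }C^m_b\}$; vector-valued versions componentwise. $\mathrm{Diff}^m_{\mathrm{ap}}(\mathbb{R}^n)$ ($m\ge1$) is the set of maps $\varphi=\mathrm{id}+f$ with $f\in C^m_{\mathrm{ap}}(\mathbb{R}^n,\mathbb{R}^n)$ and $\det(I+[d_xf])>\varepsilon$ for all $x$ and some $\varepsilon>0$, a Banach manifold via $\varphi\mapsto\varphi-\mathrm{id}$ (open subset of $C^m_{\mathrm{ap}}(\mathbb{R}^n,\mathbb{R}^n)$). *)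

theory Defs
  imports "HOL-Analysis.Analysis"
begin

text \<open>R^n is modelled as real^'n ('n finite, n = CARD('n) \<ge> 1).
Vector-valued functions are handled with the Euclidean norm on values,
which is equivalent to the componentwise convention (same topology).\<close>

definition partial_dir :: "'n::finite \<Rightarrow> (real^'n \<Rightarrow> real^'m) \<Rightarrow> real^'n \<Rightarrow> real^'m" where
  "partial_dir i f x = vector_derivative (\<lambda>t. f (x + t *\<^sub>R axis i 1)) (at 0)"

fun dpart :: "'n::finite list \<Rightarrow> (real^'n \<Rightarrow> real^'m) \<Rightarrow> real^'n \<Rightarrow> real^'m" where
  "dpart [] f = f"
| "dpart (i # is) f = partial_dir i (dpart is f)"

definition holder_int :: "real \<Rightarrow> nat" where "holder_int m = nat \<lfloor>m\<rfloor>"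
definition holder_frac :: "real \<Rightarrow> real" where "holder_frac m = m - of_int \<lfloor>m\<rfloor>"

definition Cmb :: "real \<Rightarrow> (real^'n::finite \<Rightarrow> real^'m) \<Rightarrow> bool" where
  "Cmb m f \<longleftrightarrow>
     (\<forall>is i x. length is < holder_int m \<longrightarrow>
        (\<lambda>t. dpart is f (x + t *\<^sub>R axis i 1)) differentiable (at 0)) \<and>
     (\<forall>is. length is \<le> holder_int m \<longrightarrow>
        continuous_on UNIV (dpart is f) \<and> bounded (range (dpart is f))) \<and>
     (holder_frac m > 0 \<longrightarrow>
        bdd_above {norm (dpart is f x - dpart is f y) / norm (x - y) powr holder_frac m
                   | is x y. length is = holder_int m \<and> x \<noteq> y})"

definition cm_norm :: "real \<Rightarrow> (real^'n::finite \<Rightarrow> real^'m) \<Rightarrow> real" where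
  "cm_norm m f =
     Sup {norm (dpart is f x) | is x. length is \<le> holder_int m} +
     (if holder_frac m > 0 then
        Sup {norm (dpart is f x - dpart is f y) / norm (x - y) powr holder_frac m
             | is x y. length is = holder_int m \<and> x \<noteq> y}
      else 0)"

text \<open>C^m_ap: translates form a precompact subset of C^m_b, i.e. every sequence of
translates has a subsequence converging in C^m_b.\<close>
definition Cap :: "real \<Rightarrow> (real^'n::finite \<Rightarrow> real^'m) \<Rightarrow> bool" where
  "Cap m f \<longleftrightarrow> Cmb m f \<and>
     (\<forall>c :: nat \<Rightarrow> real^'n. \<exists>r g. strict_mono r \<and> Cmb m g \<and>
        (\<lambda>j. cm_norm m (\<lambda>x. f (x + c (r j)) - g x)) \<longlonglongrightarrow> 0)"

definition Diff_ap :: "real \<Rightarrow> (real^'n::finite \<Rightarrow> real^'n) \<Rightarrow> bool" where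
  "Diff_ap m \<phi> \<longleftrightarrow> Cap m (\<lambda>x. \<phi> x - x) \<and>
     (\<exists>\<epsilon>>0. \<forall>x. det (mat 1 + jacobian (\<lambda>y. \<phi> y - y) (at x)) > \<epsilon>)"

definition cm_continuous_on :: "real \<Rightarrow> real set \<Rightarrow> (real \<Rightarrow> real^'n::finite \<Rightarrow> real^'m) \<Rightarrow> bool" where
  "cm_continuous_on m S u \<longleftrightarrow>
     (\<forall>t\<in>S. \<forall>e>0. \<exists>d>0. \<forall>s\<in>S. \<bar>s - t\<bar> < d \<longrightarrow> cm_norm m (\<lambda>x. u s x - u t x) < e)"

definition cm_has_derivative_on :: "real \<Rightarrow> real set \<Rightarrow> (real \<Rightarrow> real^'n::finite \<Rightarrow> real^'m)
      \<Rightarrow> (real \<Rightarrow> real^'n \<Rightarrow> real^'m) \<Rightarrow> bool" where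
  "cm_has_derivative_on m S u v \<longleftrightarrow>
     (\<forall>t\<in>S. \<forall>e>0. \<exists>d>0. \<forall>s\<in>S. s \<noteq> t \<and> \<bar>s - t\<bar> < d \<longrightarrow>
        cm_norm m (\<lambda>x. (u s x - u t x) /\<^sub>R (s - t) - v t x) < e)"

text \<open>phi \<in> C^1([0,T], Diff^m_ap) solving phi' = u \<circ> phi, phi(0) = id.
The chart is phi \<mapsto> phi - id, so C^1 is measured on phi - id; its derivative equals that of phi.\<close>
definition is_flow_solution :: "real \<Rightarrow> real \<Rightarrow> (real \<Rightarrow> real^'n::finite \<Rightarrow> real^'n)
      \<Rightarrow> (real \<Rightarrow> real^'n \<Rightarrow> real^'n) \<Rightarrow> bool" where
  "is_flow_solution m T u \<phi> \<longleftrightarrow>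
     (\<forall>t\<in>{0..T}. Diff_ap m (\<phi> t)) \<and>
     (\<exists>v. (\<forall>t\<in>{0..T}. Cap m (v t)) \<and>
          cm_has_derivative_on m {0..T} (\<lambda>t x. \<phi> t x - x) v \<and>
          cm_continuous_on m {0..T} v \<and>
          (\<forall>t\<in>{0..T}. \<forall>x. v t x = u t (\<phi> t x))) \<and>
     \<phi> 0 = id"

end

theory Submission
  imports Defs "HOL-Library.Diagonal_Subsequence"
begin

text \<open>Write m = k + \<gamma> with k the integer part. A function lies in C^m_ap iff its partial derivatives up to
order k have, in the sup norm, precompact sets of translates and those of order k satisfy the little
\<gamma>-Hoelder condition. Both properties pass uniformly to continuous curves over [0,T], and in this form
they are stable under products, under composition with id + \<psi> for a Lipschitz \<psi>, and (by Gronwall)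
under solving linear differential equations.

The flow id + \<psi> of u is first solved pointwise by Picard iteration; Gronwall gives almost periodicity
and the Lipschitz bound of \<psi>. The partial derivatives of \<psi> solve the linear variational equation whose
coefficients are the partial derivatives of u composed with the flow, so the regularity of \<psi> is raised
one order at a time until order k. The Jacobian determinant is bounded below because the flow is
expanding by at least exp (-LT) and its Jacobian matrices range in a compact set of invertible ones.\<close>

section \<open>Almost periodic little Hoelder curves\<close>

text \<open>Picard iteration cannot simply be run in Diff^m_ap: the map
  \<open>\<phi> \<mapsto> u \<circ> \<phi>\<close> need not be Lipschitz in the C^m norm, since a
  Lipschitz bound would cost one derivative more than \<open>u\<close> has. Only the values are
  therefore found by iteration, where the Lipschitz bound of \<open>u\<close> suffices, and every
  derivative comes from a linear equation. The other obstacle is the Hoelder seminorm: on all of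
  C^m_b, translations and compositions are not norm continuous. Precompactness of the translates
  removes it by forcing the little Hoelder condition. That condition controls pairs of nearby points
  and the sup norm controls distant pairs, so for a family with a common little Hoelder modulus,
  uniform convergence of all derivatives up to order k is already convergence in C^m. This is why
  the time clause of the class below is stated in the sup norm alone.\<close>

text \<open>Precompactness of the translates is stated without limits: for every \<open>e\<close>, each sequence of translates
has a subsequence of diameter at most \<open>e\<close>. In this form it is uniform in t and needs no completeness. For
\<open>\<gamma> = 0\<close> the Hoelder clause is uniform continuity.\<close>

definition ap_base :: "real \<Rightarrow> real \<Rightarrow> (real \<Rightarrow> real^'n::finite \<Rightarrow> 'b::real_normed_vector) \<Rightarrow> bool" where
  "ap_base \<gamma> T f \<longleftrightarrow>
     (\<exists>M. \<forall>t\<in>{0..T}. \<forall>x. norm (f t x) \<le> M) \<and>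
     (\<forall>e>0. \<exists>d>0. \<forall>s\<in>{0..T}. \<forall>t\<in>{0..T}. \<forall>x. \<bar>s - t\<bar> < d \<longrightarrow> norm (f s x - f t x) \<le> e) \<and>
     (\<forall>e>0. \<exists>d>0. \<forall>t\<in>{0..T}. \<forall>x y. x \<noteq> y \<and> norm (x - y) < d \<longrightarrow>
        norm (f t x - f t y) \<le> e * norm (x - y) powr \<gamma>) \<and>
     (\<forall>e>0. \<forall>c. \<exists>r. strict_mono (r :: nat \<Rightarrow> nat) \<and> (\<forall>i j. \<forall>t\<in>{0..T}. \<forall>x.
        norm (f t (x + c (r i)) - f t (x + c (r j))) \<le> e))"

lemma ap_base_bounded:
  fixes f :: "real \<Rightarrow> real^'n::finite \<Rightarrow> 'b::real_normed_vector"
  assumes "ap_base \<gamma> T f"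
  obtains M where "M \<ge> 0" "\<And>t x. t \<in> {0..T} \<Longrightarrow> norm (f t x) \<le> M"
proof -
  obtain M where "\<forall>t\<in>{0..T}. \<forall>x. norm (f t x) \<le> M" using assms unfolding ap_base_def by blast
  then show ?thesis using that[of "max M 0"] by (meson max.cobounded2 max.coboundedI1)
qed

lemma ap_base_time:
  fixes f :: "real \<Rightarrow> real^'n::finite \<Rightarrow> 'b::real_normed_vector"
  assumes "ap_base \<gamma> T f" "e > 0"
  obtains d where "d > 0"
    "\<And>s t x. s \<in> {0..T} \<Longrightarrow> t \<in> {0..T} \<Longrightarrow> \<bar>s - t\<bar> < d \<Longrightarrow> norm (f s x - f t x) \<le> e"
proof -
  note * = assms(1)[unfolded ap_base_def, THEN conjunct2, THEN conjunct1, rule_format, OF assms(2)]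
  show ?thesis using * by (elim exE conjE) (rule that, assumption, blast)
qed

lemma ap_base_holder:
  fixes f :: "real \<Rightarrow> real^'n::finite \<Rightarrow> 'b::real_normed_vector"
  assumes "ap_base \<gamma> T f" "e > 0"
  obtains d where "d > 0"
    "\<And>t x y. t \<in> {0..T} \<Longrightarrow> x \<noteq> y \<Longrightarrow> norm (x - y) < d \<Longrightarrow> norm (f t x - f t y) \<le> e * norm (x - y) powr \<gamma>"
proof -
  note * = assms(1)[unfolded ap_base_def, THEN conjunct2, THEN conjunct2, THEN conjunct1, rule_format, OF assms(2)]
  show ?thesis using * by (elim exE conjE) (rule that, assumption, blast)
qed

lemma ap_base_translates:
  fixes f :: "real \<Rightarrow> real^'n::finite \<Rightarrow> 'b::real_normed_vector"
  assumes "ap_base \<gamma> T f" "e > 0"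
  obtains r :: "nat \<Rightarrow> nat" where "strict_mono r"
    "\<And>i j t x. t \<in> {0..T} \<Longrightarrow> norm (f t (x + c (r i)) - f t (x + c (r j))) \<le> e"
proof -
  note * = assms(1)[unfolded ap_base_def, THEN conjunct2, THEN conjunct2, THEN conjunct2, rule_format, OF assms(2)]
  show ?thesis using *[of c] by (elim exE conjE) (rule that, assumption, blast)
qed

lemma ap_baseI:
  fixes f :: "real \<Rightarrow> real^'n::finite \<Rightarrow> 'b::real_normed_vector"
  assumes "\<And>t x. t \<in> {0..T} \<Longrightarrow> norm (f t x) \<le> M"
    and "\<And>e. e > 0 \<Longrightarrow> \<exists>d>0. \<forall>s\<in>{0..T}. \<forall>t\<in>{0..T}. \<forall>x. \<bar>s - t\<bar> < d \<longrightarrow> norm (f s x - f t x) \<le> e"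
    and "\<And>e. e > 0 \<Longrightarrow> \<exists>d>0. \<forall>t\<in>{0..T}. \<forall>x y. x \<noteq> y \<and> norm (x - y) < d \<longrightarrow>
        norm (f t x - f t y) \<le> e * norm (x - y) powr \<gamma>"
    and "\<And>e c. e > 0 \<Longrightarrow> \<exists>r. strict_mono (r :: nat \<Rightarrow> nat) \<and> (\<forall>i j. \<forall>t\<in>{0..T}. \<forall>x.
        norm (f t (x + c (r i)) - f t (x + c (r j))) \<le> e)"
  shows "ap_base \<gamma> T f"
  unfolding ap_base_def using assms by blast

text \<open>Below distance 1 the factor \<open>norm (x - y) powr \<gamma>\<close> is at most 1, so
  the little Hoelder modulus is also a modulus of uniform continuity.\<close>

lemma ap_base_uniform:
  fixes f :: "real \<Rightarrow> real^'n::finite \<Rightarrow> 'b::real_normed_vector"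
  assumes "ap_base \<gamma> T f" "e > 0" "\<gamma> \<ge> 0"
  obtains d where "d > 0" "\<And>t x y. t \<in> {0..T} \<Longrightarrow> norm (x - y) < d \<Longrightarrow> norm (f t x - f t y) \<le> e"
proof -
  obtain d where d: "d > 0"
    "\<And>t x y. t \<in> {0..T} \<Longrightarrow> x \<noteq> y \<Longrightarrow> norm (x - y) < d \<Longrightarrow> norm (f t x - f t y) \<le> e * norm (x - y) powr \<gamma>"
    using ap_base_holder[OF assms(1,2)] by blast
  show ?thesis
  proof (rule that[of "min d 1"])
    fix t and x y :: "real^'n" assume *: "t \<in> {0..T}" "norm (x - y) < min d 1"
    show "norm (f t x - f t y) \<le> e"
    proof (cases "x = y")
      case False
      have "norm (f t x - f t y) \<le> e * norm (x - y) powr \<gamma>" using d * False by auto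
      also have "\<dots> \<le> e * 1" using * assms
        by (intro mult_left_mono) (auto intro!: powr_le1)
      finally show ?thesis by simp
    qed (use assms in auto)
  qed (use d in auto)
qed

section \<open>Closure of the base class under domination, Lipschitz images, products and
  composition\<close>

lemma ap_base_cong:
  fixes f g :: "real \<Rightarrow> real^'n::finite \<Rightarrow> 'b::real_normed_vector"
  assumes "\<And>t x. t \<in> {0..T} \<Longrightarrow> f t x = g t x"
  shows "ap_base \<gamma> T f = ap_base \<gamma> T g"
  unfolding ap_base_def using assms by auto

text \<open>The Hoelder and translate clauses only compare two points at one time, so they pass from
  \<open>f\<close> to \<open>h\<close> with the same radius and the same subsequence. The increment
  of \<open>f\<close> is controlled at all times \<open>s\<close>, not only at \<open>t\<close>,
  because the solution of a differential equation at time \<open>t\<close> depends on its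
  coefficients at other times.\<close>

lemma ap_base_dominated:
  fixes f :: "real \<Rightarrow> real^'n::finite \<Rightarrow> 'b::real_normed_vector"
    and h :: "real \<Rightarrow> real^'n \<Rightarrow> 'c::real_normed_vector"
  assumes f: "ap_base \<gamma> T f"
    and bd: "\<And>t x. t \<in> {0..T} \<Longrightarrow> norm (h t x) \<le> M"
    and time: "\<And>e. e > 0 \<Longrightarrow> \<exists>d>0. \<forall>s\<in>{0..T}. \<forall>t\<in>{0..T}. \<forall>x. \<bar>s - t\<bar> < d \<longrightarrow> norm (h s x - h t x) \<le> e"
    and dom: "\<And>t x y \<delta>. t \<in> {0..T} \<Longrightarrow> \<delta> \<ge> 0 \<Longrightarrow> (\<And>s. s \<in> {0..T} \<Longrightarrow> norm (f s x - f s y) \<le> \<delta>) \<Longrightarrow>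
      norm (h t x - h t y) \<le> K * \<delta>"
  shows "ap_base \<gamma> T h"
proof (rule ap_baseI[OF bd time])
  \<comment> \<open>\<open>K\<close> may be zero or negative; the tolerance is divided by a positive
    constant instead.\<close>
  define K' where "K' = max K 1"
  have K': "K' > 0" unfolding K'_def by auto
  have imp: "norm (h t x - h t y) \<le> e"
    if "t \<in> {0..T}" "e \<ge> 0" "\<And>s. s \<in> {0..T} \<Longrightarrow> norm (f s x - f s y) \<le> e / K'" for t x y e
  proof -
    have "norm (h t x - h t y) \<le> K * (e / K')" using that K' by (intro dom) auto
    also have "\<dots> \<le> K' * (e / K')" using that K' unfolding K'_def by (intro mult_right_mono) auto
    finally show ?thesis using K' by simp
  qed
  fix e :: real assume e: "e > 0"
  then have e': "e / K' > 0" using K' by simp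
  obtain d where d: "d > 0"
    "\<And>t x y. t \<in> {0..T} \<Longrightarrow> x \<noteq> y \<Longrightarrow> norm (x - y) < d \<Longrightarrow> norm (f t x - f t y) \<le> e / K' * norm (x - y) powr \<gamma>"
    using ap_base_holder[OF f e'] by blast
  have "norm (h t x - h t y) \<le> e * norm (x - y) powr \<gamma>"
    if "t \<in> {0..T}" "x \<noteq> y" "norm (x - y) < d" for t x y
    by (rule imp) (use d(2)[OF _ that(2,3)] that e in auto)
  then show "\<exists>d>0. \<forall>t\<in>{0..T}. \<forall>x y. x \<noteq> y \<and> norm (x - y) < d \<longrightarrow>
        norm (h t x - h t y) \<le> e * norm (x - y) powr \<gamma>"
    using d(1) by (intro exI[of _ d]) auto
  fix c :: "nat \<Rightarrow> real^'n"
  obtain r :: "nat \<Rightarrow> nat" where r: "strict_mono r"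
    "\<And>i j t x. t \<in> {0..T} \<Longrightarrow> norm (f t (x + c (r i)) - f t (x + c (r j))) \<le> e / K'"
    using ap_base_translates[OF f e'] by blast
  show "\<exists>r. strict_mono (r :: nat \<Rightarrow> nat) \<and> (\<forall>i j. \<forall>t\<in>{0..T}. \<forall>x.
        norm (h t (x + c (r i)) - h t (x + c (r j))) \<le> e)"
    by (intro exI[of _ r] conjI allI ballI imp r(1) r(2)) (use e in auto)
qed auto

text \<open>The hypothesis compares arbitrary pairs of times and points, so one inequality yields
  all four clauses; boundedness follows by comparison with the single value
  \<open>h 0 0\<close>.\<close>

lemma ap_base_Lipschitz_image:
  assumes f: "ap_base \<gamma> T f"
    and dom: "\<And>s t x y. s \<in> {0..T} \<Longrightarrow> t \<in> {0..T} \<Longrightarrow> norm (h s x - h t y) \<le> K * norm (f s x - f t y)"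
  shows "ap_base \<gamma> T h"
proof -
  obtain M where M: "M \<ge> 0" "\<And>t x. t \<in> {0..T} \<Longrightarrow> norm (f t x) \<le> M"
    using ap_base_bounded[OF f] by blast
  have bd: "norm (h t x) \<le> norm (h 0 0) + \<bar>K\<bar> * (2 * M)" if "t \<in> {0..T}" for t x
  proof -
    have 0: "0 \<in> {0..T}" using that by auto
    have "norm (f t x - f 0 0) \<le> 2 * M" using M(2)[OF that, of x] M(2)[OF 0, of 0]
      by (smt (verit) norm_triangle_ineq4)
    then have "K * norm (f t x - f 0 0) \<le> \<bar>K\<bar> * (2 * M)" by (intro mult_mono) auto
    then show ?thesis using dom[OF that 0, of x 0] norm_triangle_sub[of "h t x" "h 0 0"] by linarith
  qed
  define K' where "K' = max K 1"
  have K': "K' > 0" unfolding K'_def by auto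
  have dom': "norm (h s x - h t y) \<le> K' * norm (f s x - f t y)" if "s \<in> {0..T}" "t \<in> {0..T}" for s t x y
    using dom[OF that, of x y] unfolding K'_def
    by (smt (verit) max.cobounded1 mult_right_mono norm_ge_zero)
  show ?thesis
  proof (rule ap_base_dominated[OF f bd])
    fix e :: real assume "e > 0"
    then have e': "e / K' > 0" using K' by simp
    obtain d where d: "d > 0"
      "\<And>s t x. s \<in> {0..T} \<Longrightarrow> t \<in> {0..T} \<Longrightarrow> \<bar>s - t\<bar> < d \<Longrightarrow> norm (f s x - f t x) \<le> e / K'"
      using ap_base_time[OF f e'] by blast
    have "norm (h s x - h t x) \<le> e" if "s \<in> {0..T}" "t \<in> {0..T}" "\<bar>s - t\<bar> < d" for s t x
    proof -
      have "norm (h s x - h t x) \<le> K' * (e / K')"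
        using dom'[OF that(1,2), of x x] d(2)[OF that, of x] K'
        by (meson mult_left_mono less_imp_le order_trans)
      then show ?thesis using K' by simp
    qed
    then show "\<exists>d>0. \<forall>s\<in>{0..T}. \<forall>t\<in>{0..T}. \<forall>x. \<bar>s - t\<bar> < d \<longrightarrow> norm (h s x - h t x) \<le> e"
      using d(1) by blast
  next
    fix t x y and \<delta> :: real
    assume *: "t \<in> {0..T}" "\<delta> \<ge> 0" "\<And>s. s \<in> {0..T} \<Longrightarrow> norm (f s x - f s y) \<le> \<delta>"
    have "norm (h t x - h t y) \<le> K' * norm (f t x - f t y)" by (rule dom'[OF *(1) *(1)])
    also have "\<dots> \<le> K' * \<delta>" using K' by (intro mult_left_mono *(3) *(1)) auto
    finally show "norm (h t x - h t y) \<le> K' * \<delta>" .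
  qed
qed

text \<open>Pairing turns sums and products of two curves into Lipschitz images of one curve, so
  that common subsequences have to be extracted only here.\<close>

lemma ap_base_Pair:
  fixes f :: "real \<Rightarrow> real^'n::finite \<Rightarrow> 'b::real_normed_vector"
    and g :: "real \<Rightarrow> real^'n::finite \<Rightarrow> 'c::real_normed_vector"
  assumes f: "ap_base \<gamma> T f" and g: "ap_base \<gamma> T g"
  shows "ap_base \<gamma> T (\<lambda>t x. (f t x, g t x))"
proof -
  have le: "norm ((a, b) - (a', b')) \<le> norm (a - a') + norm (b - b')" for a a' :: 'b and b b' :: 'c
    by (simp only: diff_Pair norm_Pair_le)
  obtain M where M: "M \<ge> 0" "\<And>t x. t \<in> {0..T} \<Longrightarrow> norm (f t x) \<le> M" using ap_base_bounded[OF f] by blast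
  obtain N where N: "N \<ge> 0" "\<And>t x. t \<in> {0..T} \<Longrightarrow> norm (g t x) \<le> N" using ap_base_bounded[OF g] by blast
  show ?thesis
  proof (rule ap_baseI[where M = "M + N"])
    show "norm (f t x, g t x) \<le> M + N" if "t \<in> {0..T}" for t x
      using M(2)[OF that, of x] N(2)[OF that, of x] norm_Pair_le[of "f t x" "g t x"] by linarith
  next
    fix e :: real assume "e > 0"
    then have e: "e / 2 > 0" by simp
    obtain d1 where d1: "d1 > 0"
      "\<And>s t x. s \<in> {0..T} \<Longrightarrow> t \<in> {0..T} \<Longrightarrow> \<bar>s - t\<bar> < d1 \<Longrightarrow> norm (f s x - f t x) \<le> e / 2"
      using ap_base_time[OF f e] by blast
    obtain d2 where d2: "d2 > 0"
      "\<And>s t x. s \<in> {0..T} \<Longrightarrow> t \<in> {0..T} \<Longrightarrow> \<bar>s - t\<bar> < d2 \<Longrightarrow> norm (g s x - g t x) \<le> e / 2"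
      using ap_base_time[OF g e] by blast
    have *: "norm ((f s x, g s x) - (f t x, g t x)) \<le> e"
      if "s \<in> {0..T}" "t \<in> {0..T}" "\<bar>s - t\<bar> < min d1 d2" for s t x
      using d1(2)[of s t x] d2(2)[of s t x] that le[of "f s x" "g s x" "f t x" "g t x"] by linarith
    show "\<exists>d>0. \<forall>s\<in>{0..T}. \<forall>t\<in>{0..T}. \<forall>x. \<bar>s - t\<bar> < d \<longrightarrow>
        norm ((f s x, g s x) - (f t x, g t x)) \<le> e"
      by (intro exI[of _ "min d1 d2"] conjI ballI allI impI *) (use d1(1) d2(1) in auto)
    obtain d1 where d1: "d1 > 0" "\<And>t x y. t \<in> {0..T} \<Longrightarrow> x \<noteq> y \<Longrightarrow> norm (x - y) < d1 \<Longrightarrow>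
      norm (f t x - f t y) \<le> e / 2 * norm (x - y) powr \<gamma>"
      using ap_base_holder[OF f e] by blast
    obtain d2 where d2: "d2 > 0" "\<And>t x y. t \<in> {0..T} \<Longrightarrow> x \<noteq> y \<Longrightarrow> norm (x - y) < d2 \<Longrightarrow>
      norm (g t x - g t y) \<le> e / 2 * norm (x - y) powr \<gamma>"
      using ap_base_holder[OF g e] by blast
    have *: "norm ((f t x, g t x) - (f t y, g t y)) \<le> e * norm (x - y) powr \<gamma>"
      if "t \<in> {0..T}" "x \<noteq> y" "norm (x - y) < min d1 d2" for t x y
      using d1(2)[of t x y] d2(2)[of t x y] that le[of "f t x" "g t x" "f t y" "g t y"] by linarith
    show "\<exists>d>0. \<forall>t\<in>{0..T}. \<forall>x y. x \<noteq> y \<and> norm (x - y) < d \<longrightarrow>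
        norm ((f t x, g t x) - (f t y, g t y)) \<le> e * norm (x - y) powr \<gamma>"
      by (intro exI[of _ "min d1 d2"] conjI ballI allI impI *) (use d1(1) d2(1) in auto)
    fix c :: "nat \<Rightarrow> real^'n"
    obtain r1 :: "nat \<Rightarrow> nat" where r1: "strict_mono r1"
      "\<And>i j t x. t \<in> {0..T} \<Longrightarrow> norm (f t (x + c (r1 i)) - f t (x + c (r1 j))) \<le> e / 2"
      using ap_base_translates[OF f e] by blast
    \<comment> \<open>The second extraction is made along the first, so the estimate for
      \<open>f\<close> persists for the composed subsequence.\<close>
    obtain r2 :: "nat \<Rightarrow> nat" where r2: "strict_mono r2"
      "\<And>i j t x. t \<in> {0..T} \<Longrightarrow> norm (g t (x + (c \<circ> r1) (r2 i)) - g t (x + (c \<circ> r1) (r2 j))) \<le> e / 2"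
      using ap_base_translates[OF g e] by blast
    have *: "norm ((f t (x + c ((r1 \<circ> r2) i)), g t (x + c ((r1 \<circ> r2) i))) -
        (f t (x + c ((r1 \<circ> r2) j)), g t (x + c ((r1 \<circ> r2) j)))) \<le> e" if "t \<in> {0..T}" for t x i j
      using r1(2)[OF that, of x "r2 i" "r2 j"] r2(2)[OF that, of x i j] 
        le[of "f t (x + c ((r1 \<circ> r2) i))" "g t (x + c ((r1 \<circ> r2) i))"
          "f t (x + c ((r1 \<circ> r2) j))" "g t (x + c ((r1 \<circ> r2) j))"]
      unfolding o_def by linarith
    show "\<exists>r. strict_mono (r :: nat \<Rightarrow> nat) \<and> (\<forall>i j. \<forall>t\<in>{0..T}. \<forall>x.
        norm ((f t (x + c (r i)), g t (x + c (r i))) - (f t (x + c (r j)), g t (x + c (r j)))) \<le> e)"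
      by (intro exI[of _ "r1 \<circ> r2"] conjI strict_mono_o r1(1) r2(1) ballI allI *)
  qed
qed

lemma ap_base_bounded_linear:
  assumes "bounded_linear L" "ap_base \<gamma> T f"
  shows "ap_base \<gamma> T (\<lambda>t x. L (f t x))"
proof -
  interpret bounded_linear L by fact
  obtain K where K: "\<And>x. norm (L x) \<le> norm x * K" using bounded by blast
  show ?thesis
    by (rule ap_base_Lipschitz_image[OF assms(2), where K = K]) (metis K diff mult.commute)
qed

lemma ap_base_add:
  assumes "ap_base \<gamma> T f" "ap_base \<gamma> T g"
  shows "ap_base \<gamma> T (\<lambda>t x. f t x + g t x)"
  using ap_base_bounded_linear[OF bounded_linear_add[OF bounded_linear_fst bounded_linear_snd]
      ap_base_Pair[OF assms]] by simp

lemma ap_base_const: "ap_base \<gamma> T (\<lambda>t x. c)"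
proof (rule ap_baseI[where M = "norm c"])
  show "\<exists>r. strict_mono (r :: nat \<Rightarrow> nat) \<and> (\<forall>i j. \<forall>t\<in>{0..T}. \<forall>x. norm (c - c) \<le> e)"
    if "e > 0" for e :: real
    using that by (intro exI[of _ id]) (simp add: strict_mono_id)
qed (simp_all, (rule exI[of _ 1], simp)+)

lemma ap_base_sum:
  assumes "finite I" "\<And>i. i \<in> I \<Longrightarrow> ap_base \<gamma> T (f i)"
  shows "ap_base \<gamma> T (\<lambda>t x. \<Sum>i\<in>I. f i t x)"
  using assms by (induction I rule: finite_induct) (simp_all add: ap_base_const ap_base_add)

text \<open>A bilinear map is Lipschitz on bounded sets, and both factors are bounded; the bounds
  enter the constant \<open>(M + N) * K\<close>.\<close>

lemma ap_base_bilinear: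
  assumes "bounded_bilinear pr" and f: "ap_base \<gamma> T f" and g: "ap_base \<gamma> T g"
  shows "ap_base \<gamma> T (\<lambda>t x. pr (f t x) (g t x))"
proof -
  interpret bounded_bilinear pr by fact
  obtain K where K: "K \<ge> 0" "\<And>a b. norm (pr a b) \<le> norm a * norm b * K" using nonneg_bounded by blast
  obtain M where M: "M \<ge> 0" "\<And>t x. t \<in> {0..T} \<Longrightarrow> norm (f t x) \<le> M" using ap_base_bounded[OF f] by blast
  obtain N where N: "N \<ge> 0" "\<And>t x. t \<in> {0..T} \<Longrightarrow> norm (g t x) \<le> N" using ap_base_bounded[OF g] by blast
  show ?thesis
  proof (rule ap_base_Lipschitz_image[OF ap_base_Pair[OF f g], where K = "(M + N) * K"])
    fix s t x y assume st: "s \<in> {0..T}" "t \<in> {0..T}"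
    let ?D = "norm ((f s x, g s x) - (f t y, g t y))"
    have D: "norm (f s x - f t y) \<le> ?D" "norm (g s x - g t y) \<le> ?D"
      using norm_fst_le norm_snd_le by (metis diff_Pair)+
    have "pr (f s x) (g s x) - pr (f t y) (g t y) = pr (f s x) (g s x - g t y) + pr (f s x - f t y) (g t y)"
      by (simp add: diff_left diff_right)
    also have "norm \<dots> \<le> norm (f s x) * norm (g s x - g t y) * K + norm (f s x - f t y) * norm (g t y) * K"
      by (intro norm_triangle_le add_mono K)
    also have "\<dots> \<le> M * ?D * K + ?D * N * K"
      using K M N st D by (intro add_mono mult_right_mono mult_mono) auto
    finally show "norm (pr (f s x) (g s x) - pr (f t y) (g t y)) \<le> (M + N) * K * ?D"
      by (simp add: algebra_simps)
  qed
qed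

text \<open>The Lipschitz bound of \<open>\<psi>\<close> preserves the exponent:
  \<open>id + \<psi>\<close> stretches distances by at most \<open>1 + L\<close>, so Hoelder
  quotients grow by at most \<open>(1 + L) powr \<gamma>\<close>. A merely Hoelder continuous
  \<open>\<psi>\<close> would lower the exponent.\<close>

lemma ap_base_compose:
  fixes f :: "real \<Rightarrow> real^'n::finite \<Rightarrow> 'b::real_normed_vector" and \<psi> :: "real \<Rightarrow> real^'n \<Rightarrow> real^'n"
  assumes "\<gamma> \<ge> 0" and f: "ap_base \<gamma> T f" and p: "ap_base \<gamma> T \<psi>"
    and L: "L \<ge> 0" "\<And>t x y. t \<in> {0..T} \<Longrightarrow> norm (\<psi> t x - \<psi> t y) \<le> L * norm (x - y)"
  shows "ap_base \<gamma> T (\<lambda>t x. f t (x + \<psi> t x))"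
proof -
  obtain M where M: "M \<ge> 0" "\<And>t x. t \<in> {0..T} \<Longrightarrow> norm (f t x) \<le> M" using ap_base_bounded[OF f] by blast
  show ?thesis
  proof (rule ap_baseI[where M = M])
    fix e :: real assume "e > 0"
    then have e: "e / 2 > 0" by simp
    obtain d where d: "d > 0" "\<And>t x y. t \<in> {0..T} \<Longrightarrow> norm (x - y) < d \<Longrightarrow> norm (f t x - f t y) \<le> e / 2"
      using ap_base_uniform[OF f e \<open>\<gamma> \<ge> 0\<close>] by blast
    obtain d1 where d1: "d1 > 0"
      "\<And>s t x. s \<in> {0..T} \<Longrightarrow> t \<in> {0..T} \<Longrightarrow> \<bar>s - t\<bar> < d1 \<Longrightarrow> norm (f s x - f t x) \<le> e / 2"
      using ap_base_time[OF f e] by blast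
    have d': "d / 2 > 0" using d by simp
    obtain d2 where d2: "d2 > 0"
      "\<And>s t x. s \<in> {0..T} \<Longrightarrow> t \<in> {0..T} \<Longrightarrow> \<bar>s - t\<bar> < d2 \<Longrightarrow> norm (\<psi> s x - \<psi> t x) \<le> d / 2"
      using ap_base_time[OF p d'] by blast
    have "norm (f s (x + \<psi> s x) - f t (x + \<psi> t x)) \<le> e"
      if st: "s \<in> {0..T}" "t \<in> {0..T}" "\<bar>s - t\<bar> < min d1 d2" for s t x
    proof -
      have "norm (f s (x + \<psi> s x) - f t (x + \<psi> s x)) \<le> e / 2" using d1 st by auto
      moreover have "norm (\<psi> s x - \<psi> t x) < d" using d2(2)[of s t x] st d(1) by auto
      then have "norm (f t (x + \<psi> s x) - f t (x + \<psi> t x)) \<le> e / 2" using st by (intro d(2)) auto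
      ultimately show ?thesis
        by (rule norm_diff_triangle_le[THEN order_trans]) simp
    qed
    then show "\<exists>d>0. \<forall>s\<in>{0..T}. \<forall>t\<in>{0..T}. \<forall>x. \<bar>s - t\<bar> < d \<longrightarrow>
        norm (f s (x + \<psi> s x) - f t (x + \<psi> t x)) \<le> e"
      using d1(1) d2(1) by (intro exI[of _ "min d1 d2"]) auto
    define C where "C = (1 + L) powr \<gamma>"
    have C: "C > 0" unfolding C_def using L by simp
    then have "e / C > 0" using \<open>e > 0\<close> by simp
    then obtain d where d: "d > 0" "\<And>t x y. t \<in> {0..T} \<Longrightarrow> x \<noteq> y \<Longrightarrow> norm (x - y) < d \<Longrightarrow>
      norm (f t x - f t y) \<le> e / C * norm (x - y) powr \<gamma>"
      using ap_base_holder[OF f] by blast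
    have "norm (f t (x + \<psi> t x) - f t (y + \<psi> t y)) \<le> e * norm (x - y) powr \<gamma>"
      if t: "t \<in> {0..T}" "x \<noteq> y" "norm (x - y) < d / (1 + L)" for t x y
    \<comment> \<open>The Hoelder clause for \<open>f\<close> asks for distinct points; if the
      images coincide, the difference is zero.\<close>
    proof (cases "x + \<psi> t x = y + \<psi> t y")
      case False
      have "norm (x + \<psi> t x - (y + \<psi> t y)) \<le> norm (x - y) + norm (\<psi> t x - \<psi> t y)"
        using norm_triangle_ineq[of "x - y" "\<psi> t x - \<psi> t y"] by (simp add: algebra_simps)
      also have "\<dots> \<le> (1 + L) * norm (x - y)" using L(2)[OF t(1), of x y] by (simp add: algebra_simps)
      finally have 1: "norm (x + \<psi> t x - (y + \<psi> t y)) \<le> (1 + L) * norm (x - y)" .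
      also have "\<dots> < d" using t L by (simp add: field_simps)
      finally have "norm (f t (x + \<psi> t x) - f t (y + \<psi> t y)) \<le> e / C * norm (x + \<psi> t x - (y + \<psi> t y)) powr \<gamma>"
        by (rule d(2)[OF t(1) False])
      also have "\<dots> \<le> e / C * ((1 + L) * norm (x - y)) powr \<gamma>"
        using 1 \<open>\<gamma> \<ge> 0\<close> C \<open>e > 0\<close> by (intro mult_left_mono powr_mono2) auto
      also have "\<dots> = e / C * (C * norm (x - y) powr \<gamma>)"
        unfolding C_def using L by (simp add: powr_mult)
      finally show ?thesis using C by simp
    qed (use \<open>e > 0\<close> in auto)
    then show "\<exists>d>0. \<forall>t\<in>{0..T}. \<forall>x y. x \<noteq> y \<and> norm (x - y) < d \<longrightarrow>
        norm (f t (x + \<psi> t x) - f t (y + \<psi> t y)) \<le> e * norm (x - y) powr \<gamma>"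
      using d(1) L by (intro exI[of _ "d / (1 + L)"]) auto
    fix c :: "nat \<Rightarrow> real^'n"
    obtain d where d: "d > 0" "\<And>t x y. t \<in> {0..T} \<Longrightarrow> norm (x - y) < d \<Longrightarrow> norm (f t x - f t y) \<le> e / 2"
      using ap_base_uniform[OF f e \<open>\<gamma> \<ge> 0\<close>] by blast
    obtain r1 :: "nat \<Rightarrow> nat" where r1: "strict_mono r1"
      "\<And>i j t x. t \<in> {0..T} \<Longrightarrow> norm (f t (x + c (r1 i)) - f t (x + c (r1 j))) \<le> e / 2"
      using ap_base_translates[OF f e] by blast
    have "d / 2 > 0" using d by simp
    then obtain r2 :: "nat \<Rightarrow> nat" where r2: "strict_mono r2"
      "\<And>i j t x. t \<in> {0..T} \<Longrightarrow> norm (\<psi> t (x + (c \<circ> r1) (r2 i)) - \<psi> t (x + (c \<circ> r1) (r2 j))) \<le> d / 2"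
      using ap_base_translates[OF p] by blast
    have "norm (f t (x + c ((r1 \<circ> r2) i) + \<psi> t (x + c ((r1 \<circ> r2) i))) -
        f t (x + c ((r1 \<circ> r2) j) + \<psi> t (x + c ((r1 \<circ> r2) j)))) \<le> e" if "t \<in> {0..T}" for t x i j
    proof -
      \<comment> \<open>The shift is changed in two moves. Replacing \<open>?ci\<close> by
        \<open>?cj\<close> in the argument of \<open>f\<close> with base point
        \<open>x + \<psi> t (x + ?ci)\<close> kept fixed is a pure translation, and the estimate for
        \<open>f\<close> holds at every base point. The change of \<open>\<psi>\<close> is then
        absorbed by uniform continuity of \<open>f\<close>.\<close>
      let ?ci = "c (r1 (r2 i))" and ?cj = "c (r1 (r2 j))"
      have "norm (f t ((x + \<psi> t (x + ?ci)) + ?ci) - f t ((x + \<psi> t (x + ?ci)) + ?cj)) \<le> e / 2"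
        using r1(2)[OF that] .
      moreover have "norm (\<psi> t (x + ?ci) - \<psi> t (x + ?cj)) < d"
        using r2(2)[OF that, of x i j] d(1) by simp
      then have "norm (f t ((x + \<psi> t (x + ?ci)) + ?cj) - f t ((x + \<psi> t (x + ?cj)) + ?cj)) \<le> e / 2"
        using that by (intro d(2)) auto
      ultimately have "norm (f t ((x + \<psi> t (x + ?ci)) + ?ci) - f t ((x + \<psi> t (x + ?cj)) + ?cj)) \<le> e"
        by (rule norm_diff_triangle_le[THEN order_trans]) simp
      then show ?thesis by (simp add: ac_simps)
    qed
    then show "\<exists>r. strict_mono (r :: nat \<Rightarrow> nat) \<and> (\<forall>i j. \<forall>t\<in>{0..T}. \<forall>x.
        norm (f t (x + c (r i) + \<psi> t (x + c (r i))) - f t (x + c (r j) + \<psi> t (x + c (r j)))) \<le> e)"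
      using strict_mono_o[OF r1(1) r2(1)] by blast
  qed (use M in auto)
qed

text \<open>The partial derivatives are existential witnesses rather than values of
  \<open>dpart\<close>: the codomain can then be any normed space, and nothing is asked at times
  outside [0,T]. A total derivative is required, which makes the chain rule immediate.\<close>

fun ap_class :: "real \<Rightarrow> real \<Rightarrow> nat \<Rightarrow> (real \<Rightarrow> real^'n::finite \<Rightarrow> 'b::real_normed_vector) \<Rightarrow> bool" where
  "ap_class \<gamma> T 0 f = ap_base \<gamma> T f"
| "ap_class \<gamma> T (Suc k) f = (ap_base \<gamma> T f \<and>
     (\<exists>g. (\<forall>t\<in>{0..T}. \<forall>x. (f t has_derivative (\<lambda>h. \<Sum>i\<in>UNIV. h $ i *\<^sub>R g i t x)) (at x)) \<and>
          (\<forall>i. ap_class \<gamma> T k (g i))))"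

lemma ap_class_base: "ap_class \<gamma> T k f \<Longrightarrow> ap_base \<gamma> T f"
  by (cases k) auto

lemma ap_class_SucE:
  assumes "ap_class \<gamma> T (Suc k) f"
  obtains g where "\<And>t x. t \<in> {0..T} \<Longrightarrow> (f t has_derivative (\<lambda>h. \<Sum>i\<in>UNIV. h $ i *\<^sub>R g i t x)) (at x)"
    "\<And>i. ap_class \<gamma> T k (g i)"
  using assms unfolding ap_class.simps by blast

lemma ap_class_SucI:
  assumes "ap_base \<gamma> T f"
    and "\<And>t x. t \<in> {0..T} \<Longrightarrow> (f t has_derivative (\<lambda>h. \<Sum>i\<in>UNIV. h $ i *\<^sub>R g i t x)) (at x)"
    and "\<And>i. ap_class \<gamma> T k (g i)"
  shows "ap_class \<gamma> T (Suc k) f"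
  unfolding ap_class.simps using assms by blast

lemma ap_class_SucD: "ap_class \<gamma> T (Suc k) f \<Longrightarrow> ap_class \<gamma> T k f"
proof (induction k arbitrary: f)
  case 0
  then show ?case by (simp only: ap_class.simps)
next
  case (Suc k)
  show ?case
    by (rule ap_class_SucE[OF Suc.prems], rule ap_class_SucI[OF ap_class_base[OF Suc.prems]])
      (assumption, rule Suc.IH)
qed

lemma ap_class_mono: "ap_class \<gamma> T k f \<Longrightarrow> j \<le> k \<Longrightarrow> ap_class \<gamma> T j f"
proof (induction k)
  case (Suc k)
  show ?case
  proof (cases "j = Suc k")
    case False
    then show ?thesis using Suc.IH ap_class_SucD[OF Suc.prems(1)] Suc.prems(2) by simp
  qed (use Suc.prems in simp)
qed simp

declare ap_class.simps(2) [simp del]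

lemma ap_class_bounded_linear:
  assumes "bounded_linear L" "ap_class \<gamma> T k f"
  shows "ap_class \<gamma> T k (\<lambda>t x. L (f t x))"
  using assms(2)
proof (induction k arbitrary: f)
  case (Suc k)
  interpret bounded_linear L by fact
  obtain g where g: "\<And>t x. t \<in> {0..T} \<Longrightarrow> (f t has_derivative (\<lambda>h. \<Sum>i\<in>UNIV. h $ i *\<^sub>R g i t x)) (at x)"
    "\<And>i. ap_class \<gamma> T k (g i)" by (rule ap_class_SucE[OF Suc.prems]) (rule that)
  show ?case
  proof (rule ap_class_SucI[OF ap_base_bounded_linear[OF assms(1) ap_class_base[OF Suc.prems]]])
    fix t x assume "t \<in> {0..T}"
    from has_derivative[OF g(1)[OF this, of x]]
    show "((\<lambda>x. L (f t x)) has_derivative (\<lambda>h. \<Sum>i\<in>UNIV. h $ i *\<^sub>R L (g i t x))) (at x)"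
      by (simp add: sum scaleR)
  qed (rule Suc.IH[OF g(2)])
qed (simp add: ap_base_bounded_linear[OF assms(1)])

lemma ap_class_add:
  assumes "ap_class \<gamma> T k f" "ap_class \<gamma> T k g"
  shows "ap_class \<gamma> T k (\<lambda>t x. f t x + g t x)"
  using assms
proof (induction k arbitrary: f g)
  case (Suc k)
  obtain f' where f': "\<And>t x. t \<in> {0..T} \<Longrightarrow> (f t has_derivative (\<lambda>h. \<Sum>i\<in>UNIV. h $ i *\<^sub>R f' i t x)) (at x)"
    "\<And>i. ap_class \<gamma> T k (f' i)" by (rule ap_class_SucE[OF Suc.prems(1)]) (rule that)
  obtain g' where g': "\<And>t x. t \<in> {0..T} \<Longrightarrow> (g t has_derivative (\<lambda>h. \<Sum>i\<in>UNIV. h $ i *\<^sub>R g' i t x)) (at x)"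
    "\<And>i. ap_class \<gamma> T k (g' i)" by (rule ap_class_SucE[OF Suc.prems(2)]) (rule that)
  show ?case
  proof (rule ap_class_SucI[OF ap_base_add[OF Suc.prems[THEN ap_class_base]]])
    fix t x assume t: "t \<in> {0..T}"
    show "((\<lambda>x. f t x + g t x) has_derivative (\<lambda>h. \<Sum>i\<in>UNIV. h $ i *\<^sub>R (f' i t x + g' i t x))) (at x)"
      using has_derivative_add[OF f'(1)[OF t] g'(1)[OF t]] by (simp add: sum.distrib scaleR_add_right)
  qed (rule Suc.IH[OF f'(2) g'(2)])
qed (simp add: ap_base_add)

lemma ap_class_const: "ap_class \<gamma> T k (\<lambda>t x. c)"
proof (induction k arbitrary: c)
  case (Suc k)
  show ?case by (rule ap_class_SucI[OF ap_base_const, where g = "\<lambda>i t x. 0"]) (simp_all add: Suc)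
qed (simp add: ap_base_const)

lemma ap_class_sum:
  assumes "finite I" "\<And>i. i \<in> I \<Longrightarrow> ap_class \<gamma> T k (f i)"
  shows "ap_class \<gamma> T k (\<lambda>t x. \<Sum>i\<in>I. f i t x)"
  using assms by (induction I rule: finite_induct) (simp_all add: ap_class_const ap_class_add)

text \<open>Leibniz rule: both summands of a partial derivative are products of a function with a
  derivative, and the undifferentiated factor is demoted to class \<open>k\<close> before the
  induction hypothesis applies.\<close>

lemma ap_class_bilinear:
  assumes "bounded_bilinear pr" "ap_class \<gamma> T k f" "ap_class \<gamma> T k g"
  shows "ap_class \<gamma> T k (\<lambda>t x. pr (f t x) (g t x))"
  using assms(2,3)
proof (induction k arbitrary: f g)
  case (Suc k)
  interpret bounded_bilinear pr by (rule assms(1))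
  obtain f' where f': "\<And>t x. t \<in> {0..T} \<Longrightarrow> (f t has_derivative (\<lambda>h. \<Sum>i\<in>UNIV. h $ i *\<^sub>R f' i t x)) (at x)"
    "\<And>i. ap_class \<gamma> T k (f' i)" by (rule ap_class_SucE[OF Suc.prems(1)]) (rule that)
  obtain g' where g': "\<And>t x. t \<in> {0..T} \<Longrightarrow> (g t has_derivative (\<lambda>h. \<Sum>i\<in>UNIV. h $ i *\<^sub>R g' i t x)) (at x)"
    "\<And>i. ap_class \<gamma> T k (g' i)" by (rule ap_class_SucE[OF Suc.prems(2)]) (rule that)
  show ?case
  proof (rule ap_class_SucI[OF ap_base_bilinear[OF assms(1) Suc.prems[THEN ap_class_base]]])
    fix t x assume t: "t \<in> {0..T}"
    show "((\<lambda>x. pr (f t x) (g t x)) has_derivative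
        (\<lambda>h. \<Sum>i\<in>UNIV. h $ i *\<^sub>R (pr (f t x) (g' i t x) + pr (f' i t x) (g t x)))) (at x)"
      using FDERIV[OF f'(1)[OF t, of x] g'(1)[OF t, of x]]
      by (simp add: sum.distrib scaleR_add_right sum_left sum_right scaleR_left scaleR_right)
  next
    fix i
    show "ap_class \<gamma> T k (\<lambda>t x. pr (f t x) (g' i t x) + pr (f' i t x) (g t x))"
      using Suc.prems[THEN ap_class_SucD] f'(2) g'(2) by (intro ap_class_add Suc.IH) auto
  qed
qed (simp add: ap_base_bilinear[OF assms(1)])

text \<open>By the chain rule the i-th partial derivative is \<open>f' i\<close> plus a combination
  of all \<open>f' j\<close> with coefficients from \<open>p' i\<close>, everything in
  \<open>f'\<close> being composed with the same inner map. The induction therefore varies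
  \<open>f\<close> and keeps \<open>\<psi>\<close> fixed.\<close>

lemma ap_class_compose:
  fixes f :: "real \<Rightarrow> real^'n::finite \<Rightarrow> 'b::real_normed_vector" and \<psi> :: "real \<Rightarrow> real^'n \<Rightarrow> real^'n"
  assumes "\<gamma> \<ge> 0" and f: "ap_class \<gamma> T k f" and p: "ap_class \<gamma> T k \<psi>"
    and L: "L \<ge> 0" "\<And>t x y. t \<in> {0..T} \<Longrightarrow> norm (\<psi> t x - \<psi> t y) \<le> L * norm (x - y)"
  shows "ap_class \<gamma> T k (\<lambda>t x. f t (x + \<psi> t x))"
  using f p
proof (induction k arbitrary: f)
  case 0
  then show ?case using ap_base_compose[OF assms(1) _ _ L] by simp
next
  case (Suc k)
  obtain f' where f': "\<And>t x. t \<in> {0..T} \<Longrightarrow> (f t has_derivative (\<lambda>h. \<Sum>i\<in>UNIV. h $ i *\<^sub>R f' i t x)) (at x)"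
    "\<And>i. ap_class \<gamma> T k (f' i)" by (rule ap_class_SucE[OF Suc.prems(1)]) (rule that)
  obtain p' where p': "\<And>t x. t \<in> {0..T} \<Longrightarrow> (\<psi> t has_derivative (\<lambda>h. \<Sum>i\<in>UNIV. h $ i *\<^sub>R p' i t x)) (at x)"
    "\<And>i. ap_class \<gamma> T k (p' i)" by (rule ap_class_SucE[OF Suc.prems(2)]) (rule that)
  have pk: "ap_class \<gamma> T k \<psi>" using Suc.prems(2) by (rule ap_class_SucD)
  show ?case
  proof (rule ap_class_SucI[OF ap_base_compose[OF assms(1) Suc.prems[THEN ap_class_base] L]])
    fix t x assume t: "t \<in> {0..T}"
    have "((\<lambda>x. x + \<psi> t x) has_derivative (\<lambda>h. h + (\<Sum>i\<in>UNIV. h $ i *\<^sub>R p' i t x))) (at x)"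
      using has_derivative_add[OF has_derivative_ident p'(1)[OF t]] .
    from has_derivative_compose[OF this f'(1)[OF t]]
    have "((\<lambda>x. f t (x + \<psi> t x)) has_derivative
      (\<lambda>h. \<Sum>j\<in>UNIV. (h + (\<Sum>i\<in>UNIV. h $ i *\<^sub>R p' i t x)) $ j *\<^sub>R f' j t (x + \<psi> t x))) (at x)" .
    moreover have "(\<Sum>j\<in>UNIV. (h + (\<Sum>i\<in>UNIV. h $ i *\<^sub>R p' i t x)) $ j *\<^sub>R f' j t (x + \<psi> t x)) =
      (\<Sum>i\<in>UNIV. h $ i *\<^sub>R (f' i t (x + \<psi> t x) + (\<Sum>j\<in>UNIV. (p' i t x $ j) *\<^sub>R f' j t (x + \<psi> t x))))" for h :: "real^'n"
    proof -
      have "(\<Sum>j\<in>UNIV. (\<Sum>i\<in>UNIV. h $ i * p' i t x $ j) *\<^sub>R f' j t (x + \<psi> t x)) =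
        (\<Sum>j\<in>UNIV. \<Sum>i\<in>UNIV. h $ i *\<^sub>R p' i t x $ j *\<^sub>R f' j t (x + \<psi> t x))"
        by (simp add: scaleR_sum_left)
      also have "\<dots> = (\<Sum>i\<in>UNIV. \<Sum>j\<in>UNIV. h $ i *\<^sub>R p' i t x $ j *\<^sub>R f' j t (x + \<psi> t x))"
        by (rule sum.swap)
      finally show ?thesis
        by (simp add: scaleR_add_left scaleR_add_right sum.distrib scaleR_sum_right)
    qed
    ultimately show "((\<lambda>x. f t (x + \<psi> t x)) has_derivative
      (\<lambda>h. \<Sum>i\<in>UNIV. h $ i *\<^sub>R (f' i t (x + \<psi> t x) + (\<Sum>j\<in>UNIV. (p' i t x $ j) *\<^sub>R f' j t (x + \<psi> t x))))) (at x)"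
      by simp
  next
    fix i
    show "ap_class \<gamma> T k (\<lambda>t x. f' i t (x + \<psi> t x) + (\<Sum>j\<in>UNIV. (p' i t x $ j) *\<^sub>R f' j t (x + \<psi> t x)))"
      by (intro ap_class_add ap_class_sum ap_class_bilinear[OF bounded_bilinear_scaleR] Suc.IH f'(2) pk
          ap_class_bounded_linear[OF bounded_linear_vec_nth] p'(2)) auto
  qed auto
qed

section \<open>Ordinary differential equations with parameters\<close>

lemma has_vector_derivative_nonpos_imp_le:
  fixes g :: "real \<Rightarrow> real"
  assumes "\<And>t. t \<in> {a..b} \<Longrightarrow> (g has_vector_derivative g' t) (at t within {a..b})"
    and "\<And>t. t \<in> {a..b} \<Longrightarrow> g' t \<le> 0" and "t \<in> {a..b}"
  shows "g t \<le> g a"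
proof (cases "t = a")
  case False
  then have "a < t" using assms(3) by auto
  have "\<exists>x\<in>{a<..<t}. g t - g a = (t - a) * g' x"
    using \<open>a < t\<close>
  proof (rule mvt_simple)
    fix x assume "a \<le> x" "x \<le> t"
    then have "(g has_vector_derivative g' x) (at x within {a..t})"
      using has_vector_derivative_within_subset[OF assms(1)] assms(3) by auto
    then show "(g has_derivative (\<lambda>h. h * g' x)) (at x within {a..t})"
      by (simp add: has_vector_derivative_def)
  qed
  then obtain x where x: "x \<in> {a<..<t}" "g t - g a = (t - a) * g' x" by blast
  have "(t - a) * g' x \<le> 0" using assms(2)[of x] assms(3) x(1) by (intro mult_nonneg_nonpos) auto
  then show ?thesis using x by simp
qed simp

text \<open>A crude constant. The factor \<open>1 + \<bar>T\<bar>\<close> absorbs the accumulated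
  error \<open>e\<^sup>2 * t\<close>, and the added 1 makes the constant at least 1, so that it can
  replace its own square root.\<close>

definition gronwall_const :: "real \<Rightarrow> real \<Rightarrow> real" where
  "gronwall_const L T = exp ((2 * L + 1) * T) * (1 + \<bar>T\<bar>) + 1"

lemma gronwall_const_pos: "gronwall_const L T > 0"
  unfolding gronwall_const_def by (simp add: add_pos_pos)

text \<open>Integrates the derivative of \<open>exp (- (2 * L + 1) * t) * (norm (w t))\<^sup>2 - e\<^sup>2 * t\<close>, since \<open>norm (w t)\<close> need not be differentiable.\<close>

lemma gronwall:
  fixes w :: "real \<Rightarrow> 'a::real_inner"
  assumes "L \<ge> 0"
    and w: "\<And>t. t \<in> {0..T} \<Longrightarrow> (w has_vector_derivative w' t) (at t within {0..T})"
    and le: "\<And>t. t \<in> {0..T} \<Longrightarrow> norm (w' t) \<le> L * norm (w t) + e" and e: "e \<ge> 0"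
  shows "\<forall>t\<in>{0..T}. norm (w t) \<le> gronwall_const L T * (norm (w 0) + e)"
proof -
  let ?K = "2 * L + 1"
  let ?C = "exp (?K * T) * (1 + \<bar>T\<bar>) + 1"
  show ?thesis unfolding gronwall_const_def
  proof
    fix t assume t: "t \<in> {0..T}"
    define g where "g s = exp (- ?K * s) * (w s \<bullet> w s) - e\<^sup>2 * s" for s
    define g' where "g' s = exp (- ?K * s) * (2 * (w s \<bullet> w' s)) + (- ?K * exp (- ?K * s)) * (w s \<bullet> w s) - e\<^sup>2" for s
    have d: "(g has_vector_derivative g' s) (at s within {0..T})" if "s \<in> {0..T}" for s
    proof -
      have "(w has_derivative (\<lambda>x. x *\<^sub>R w' s)) (at s within {0..T})"
        using w[OF that] by (simp add: has_vector_derivative_def)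
      from has_derivative_inner[OF this this]
      have "((\<lambda>s. w s \<bullet> w s) has_vector_derivative (2 * (w s \<bullet> w' s))) (at s within {0..T})"
        unfolding has_vector_derivative_def by (simp add: inner_commute algebra_simps)
      moreover have "((\<lambda>s. exp (- ?K * s)) has_vector_derivative (- ?K * exp (- ?K * s))) (at s within {0..T})"
        unfolding has_real_derivative_iff_has_vector_derivative[symmetric]
        by (auto intro!: derivative_eq_intros)
      ultimately have "((\<lambda>s. exp (- ?K * s) * (w s \<bullet> w s)) has_vector_derivative
        (exp (- ?K * s) * (2 * (w s \<bullet> w' s)) + (- ?K * exp (- ?K * s)) * (w s \<bullet> w s))) (at s within {0..T})"
        using has_vector_derivative_mult by blast
      moreover have "((\<lambda>s. e\<^sup>2 * s) has_vector_derivative e\<^sup>2) (at s within {0..T})"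
        unfolding has_real_derivative_iff_has_vector_derivative[symmetric]
        by (auto intro!: derivative_eq_intros)
      ultimately show ?thesis unfolding g_def g'_def by (rule has_vector_derivative_diff)
    qed
    have "g' s \<le> 0" if "s \<in> {0..T}" for s
    proof -
      have "2 * (w s \<bullet> w' s) \<le> 2 * (norm (w s) * norm (w' s))" using norm_cauchy_schwarz[of "w s" "w' s"] by simp
      also have "\<dots> \<le> 2 * (norm (w s) * (L * norm (w s) + e))"
        using le[OF that] by (intro mult_left_mono) auto
      \<comment> \<open>The mixed term is split by \<open>0 \<le> (norm (w s) - e)\<^sup>2\<close>;
        this costs one more multiple of the squared norm and explains the rate
        \<open>2 * L + 1\<close>.\<close>
      also have "\<dots> \<le> ?K * (w s \<bullet> w s) + e\<^sup>2"
        using sum_squares_ge_zero[of "norm (w s) - e" 0]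
        by (simp add: dot_square_norm power2_eq_square algebra_simps)
      finally have "2 * (w s \<bullet> w' s) - ?K * (w s \<bullet> w s) \<le> e\<^sup>2" by simp
      then have "exp (- ?K * s) * (2 * (w s \<bullet> w' s) - ?K * (w s \<bullet> w s)) \<le> exp (- ?K * s) * e\<^sup>2"
        by (intro mult_left_mono) auto
      \<comment> \<open>Dropping the weight here is what allows the plain linear correction
        \<open>e\<^sup>2 * s\<close> in \<open>g\<close>.\<close>
      also have "\<dots> \<le> 1 * e\<^sup>2"
      proof (rule mult_right_mono)
        have "0 \<le> ?K * s" using that assms by (intro mult_nonneg_nonneg) auto
        then show "exp (- ?K * s) \<le> 1" by (simp only: exp_le_one_iff mult_minus_left neg_le_0_iff_le)
      qed simp
      finally show ?thesis unfolding g'_def by (simp add: algebra_simps)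
    qed
    with has_vector_derivative_nonpos_imp_le[OF d] t have "g t \<le> g 0" by blast
    then have "exp (- ?K * t) * (w t \<bullet> w t) \<le> (norm (w 0))\<^sup>2 + e\<^sup>2 * t"
      unfolding g_def by (simp add: dot_square_norm)
    then have *: "exp (?K * t) * (exp (- ?K * t) * (w t \<bullet> w t)) \<le> exp (?K * t) * ((norm (w 0))\<^sup>2 + e\<^sup>2 * t)"
      by (intro mult_left_mono) auto
    have "(norm (w t))\<^sup>2 \<le> exp (?K * t) * ((norm (w 0))\<^sup>2 + e\<^sup>2 * t)"
    proof -
      have "exp (?K * t) * exp (- ?K * t) = 1" by (metis exp_minus_inverse mult_minus_left)
      then show ?thesis using * by (simp only: mult.assoc[symmetric] dot_square_norm mult_1)
    qed
    also have "\<dots> \<le> exp (?K * T) * ((1 + \<bar>T\<bar>) * (norm (w 0) + e)\<^sup>2)"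
    proof (intro mult_mono)
      have "(norm (w 0))\<^sup>2 + e\<^sup>2 * t \<le> (norm (w 0))\<^sup>2 + e\<^sup>2 * \<bar>T\<bar>"
        using t by (intro add_left_mono mult_left_mono) auto
      also have "\<dots> \<le> (norm (w 0) + e)\<^sup>2 + (norm (w 0) + e)\<^sup>2 * \<bar>T\<bar>"
        using e by (intro add_mono mult_right_mono power_mono) auto
      finally show "(norm (w 0))\<^sup>2 + e\<^sup>2 * t \<le> (1 + \<bar>T\<bar>) * (norm (w 0) + e)\<^sup>2"
        by (simp add: algebra_simps)
    qed (use t assms in \<open>auto intro!: mult_left_mono\<close>)
    also have "\<dots> \<le> ?C * (norm (w 0) + e)\<^sup>2"
      by (simp add: algebra_simps)
    \<comment> \<open>The constant is at least 1, so squaring only enlarges it; both sides are then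
      squares and the root can be taken.\<close>
    also have "\<dots> \<le> ?C\<^sup>2 * (norm (w 0) + e)\<^sup>2"
      by (intro mult_right_mono self_le_power) auto
    finally have "(norm (w t))\<^sup>2 \<le> (?C * (norm (w 0) + e))\<^sup>2" by (simp add: power_mult_distrib)
    then show "norm (w t) \<le> ?C * (norm (w 0) + e)"
      by (rule power2_le_imp_le) (use e in \<open>auto intro!: mult_nonneg_nonneg add_nonneg_nonneg\<close>)
  qed
qed

text \<open>The Picard map is a contraction globally in time for the sup norm weighted by \<open>exp (- K * t)\<close>.\<close>

lemma picard_lindeloef:
  fixes f :: "real \<Rightarrow> 'a::banach \<Rightarrow> 'a"
  assumes T: "T \<ge> 0" and L: "L \<ge> 0"
    and cont: "\<And>y. continuous_on {0..T} y \<Longrightarrow> continuous_on {0..T} (\<lambda>t. f t (y t))"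
    and lip: "\<And>t y z. t \<in> {0..T} \<Longrightarrow> norm (f t y - f t z) \<le> L * norm (y - z)"
  shows "\<exists>y. y 0 = y0 \<and> (\<forall>t\<in>{0..T}. (y has_vector_derivative f t (y t)) (at t within {0..T}))"
proof -
  \<comment> \<open>The contraction factor will be \<open>L / K\<close>; this rate makes it at most
    1/2, and the summand 1 keeps it positive when \<open>L = 0\<close>.\<close>
  define K where "K = 2 * L + 1"
  have K: "K > 0" "L / K \<le> 1 / 2" using L unfolding K_def by (auto simp: field_simps)
  \<comment> \<open>Bounded continuous functions are total on the real line. Clamping the time to
    [0,T] extends the Picard iterates constantly outside the interval, so they are continuous and,
    as images of a compact set, bounded.\<close>
  define c where "c t = max 0 (min T t)" for t
  have c: "c t \<in> {0..T}" "\<And>t. t \<in> {0..T} \<Longrightarrow> c t = t" for t using T unfolding c_def by auto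
  have cc: "continuous_on UNIV c" unfolding c_def by (intro continuous_intros)
  \<comment> \<open>The unknown is the rescaled \<open>z s = exp (- K * s) *\<^sub>R y s\<close>, so
    that the weighted norm of \<open>y\<close> becomes the plain sup norm of
    \<open>z\<close>.\<close>
  define G where "G z s = f s (exp (K * s) *\<^sub>R apply_bcontfun z s)" for z :: "real \<Rightarrow>\<^sub>C 'a" and s
  have G: "continuous_on {0..T} (G z)" for z unfolding G_def
    by (intro cont continuous_intros continuous_on_apply_bcontfun)
  define P where "P z t = exp (- K * c t) *\<^sub>R (y0 + integral {0..c t} (G z))" for z t
  have Pc: "continuous_on {0..T} (\<lambda>t. exp (- K * t) *\<^sub>R (y0 + integral {0..t} (G z)))" for z
    by (intro continuous_intros indefinite_integral_continuous_1 integrable_continuous_real G)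
  have P: "P z \<in> bcontfun" for z
  proof -
    have *: "P z = (\<lambda>t. exp (- K * t) *\<^sub>R (y0 + integral {0..t} (G z))) \<circ> c" by (auto simp: P_def)
    have "continuous_on UNIV (P z)" unfolding *
      by (rule continuous_on_compose[OF cc]) (rule continuous_on_subset[OF Pc], use c in auto)
    moreover have "bounded (range (P z))" unfolding *
    proof (rule bounded_subset[OF compact_imp_bounded[OF compact_continuous_image[OF Pc compact_Icc]]])
    qed (use c in auto)
    ultimately show ?thesis by (simp add: bcontfun_def)
  qed
  have "\<exists>!z. Bcontfun (P z) = z"
  proof (rule banach_fix_type[of "1/2"], simp_all, intro allI)
    fix z1 z2 :: "real \<Rightarrow>\<^sub>C 'a"
    show "dist (Bcontfun (P z1)) (Bcontfun (P z2)) * 2 \<le> dist z1 z2"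
    proof -
      have "dist (Bcontfun (P z1)) (Bcontfun (P z2)) \<le> dist z1 z2 / 2"
      proof (rule dist_bound)
        fix t
        let ?D = "dist z1 z2"
        have z: "norm (apply_bcontfun z1 s - apply_bcontfun z2 s) \<le> ?D" for s
          using dist_bounded[of z1 s z2] by (simp add: dist_norm)
        \<comment> \<open>Integrating the growing weight produces \<open>exp (K * c t) / K\<close>;
          the exponential cancels against the outer weight and \<open>L / K\<close> remains.\<close>
        have Kint: "((\<lambda>s. L * ?D * exp (K * s)) has_integral (L * ?D * (exp (K * c t) / K) - L * ?D * (exp (K * 0) / K))) {0..c t}"
        proof (rule fundamental_theorem_of_calculus)
          show "0 \<le> c t" using c by auto
          fix x assume "x \<in> {0..c t}"
          show "((\<lambda>s. L * ?D * (exp (K * s) / K)) has_vector_derivative L * ?D * exp (K * x)) (at x within {0..c t})"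
            unfolding has_real_derivative_iff_has_vector_derivative[symmetric]
            using K by (auto intro!: derivative_eq_intros)
        qed
        have sub: "{0..c t} \<subseteq> {0..T}" using c by auto
        have i: "G z integrable_on {0..c t}" for z
          by (intro integrable_continuous_real continuous_on_subset[OF G sub])
        have "norm (integral {0..c t} (G z1) - integral {0..c t} (G z2)) =
          norm (integral {0..c t} (\<lambda>s. G z1 s - G z2 s))"
          by (subst integral_diff) (auto intro: i)
        also have "\<dots> \<le> integral {0..c t} (\<lambda>s. L * ?D * exp (K * s))"
        proof (rule integral_norm_bound_integral)
          show "(\<lambda>s. G z1 s - G z2 s) integrable_on {0..c t}" by (intro integrable_diff i)
          show "(\<lambda>s. L * ?D * exp (K * s)) integrable_on {0..c t}" using Kint by blast
          fix s assume "s \<in> {0..c t}"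
          then have s: "s \<in> {0..T}" using sub by auto
          have "norm (G z1 s - G z2 s) \<le> L * norm (exp (K * s) *\<^sub>R apply_bcontfun z1 s - exp (K * s) *\<^sub>R apply_bcontfun z2 s)"
            unfolding G_def by (rule lip[OF s])
          also have "\<dots> = L * (exp (K * s) * norm (apply_bcontfun z1 s - apply_bcontfun z2 s))"
            by (simp add: scaleR_diff_right[symmetric])
          also have "\<dots> \<le> L * (exp (K * s) * ?D)" using L z by (intro mult_left_mono) auto
          finally show "norm (G z1 s - G z2 s) \<le> L * ?D * exp (K * s)" by (simp add: ac_simps)
        qed
        also have "\<dots> = L * ?D * (exp (K * c t) / K) - L * ?D * (exp (K * 0) / K)"
          using Kint by (rule integral_unique)
        also have "\<dots> \<le> L * ?D * (exp (K * c t) / K)" using L K by simp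
        finally have b: "norm (integral {0..c t} (G z1) - integral {0..c t} (G z2)) \<le> L * ?D * (exp (K * c t) / K)" .
        have "dist (P z1 t) (P z2 t) = exp (- K * c t) * norm (integral {0..c t} (G z1) - integral {0..c t} (G z2))"
          unfolding P_def dist_norm by (simp add: scaleR_diff_right[symmetric])
        also have "\<dots> \<le> exp (- K * c t) * (L * ?D * (exp (K * c t) / K))"
          using b by (intro mult_left_mono) auto
        also have "\<dots> = L / K * ?D" by (simp add: exp_minus field_simps)
        also have "\<dots> \<le> 1 / 2 * ?D" using K by (intro mult_right_mono) auto
        finally show "dist (apply_bcontfun (Bcontfun (P z1)) t) (apply_bcontfun (Bcontfun (P z2)) t) \<le> ?D / 2"
          by (simp add: Bcontfun_inverse[OF P])
      qed
      then show ?thesis by simp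
    qed
  qed
  then obtain z where "Bcontfun (P z) = z" by blast
  then have z: "apply_bcontfun z t = P z t" for t using Bcontfun_inverse[OF P, of z] by metis
  define y where "y t = y0 + integral {0..t} (G z)" for t
  have yz: "exp (K * t) *\<^sub>R apply_bcontfun z t = y t" if "t \<in> {0..T}" for t
    unfolding z P_def y_def by (simp add: c(2)[OF that] exp_add[symmetric])
  have "(y has_vector_derivative f t (y t)) (at t within {0..T})" if t: "t \<in> {0..T}" for t
  proof -
    have "(y has_vector_derivative (0 + G z t)) (at t within {0..T})" unfolding y_def
      by (intro has_vector_derivative_add has_vector_derivative_const integral_has_vector_derivative G t)
    then show ?thesis by (simp add: G_def yz[OF t])
  qed
  moreover have "y 0 = y0" by (simp add: y_def)
  ultimately show ?thesis by blast
qed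

section \<open>Uniform moduli, Lipschitz bounds and first-order expansions\<close>

lemma finite_common_radius:
  fixes P :: "'i \<Rightarrow> real \<Rightarrow> bool"
  assumes "finite I" "\<And>i. i \<in> I \<Longrightarrow> \<exists>d>0. P i d" and mono: "\<forall>i d d'. P i d \<longrightarrow> d' \<le> d \<longrightarrow> P i d'"
  shows "\<exists>d>0. \<forall>i\<in>I. P i d"
  using assms(1,2)
proof (induction I rule: finite_induct)
  case (insert i I)
  obtain d where d: "d > 0" "\<forall>i\<in>I. P i d" using insert.IH insert.prems by auto
  obtain d' where d': "d' > 0" "P i d'" using insert.prems by auto
  have "\<forall>j\<in>insert i I. P j (min d d')"
    using d d' mono by (metis insert_iff min.cobounded1 min.cobounded2)
  then show ?case using d d' by (intro exI[of _ "min d d'"]) simp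
qed (auto intro: exI[of _ 1])

lemma norm_sum_scaleR_le:
  fixes h :: "real^'n::finite"
  assumes "\<And>i. norm (a i) \<le> M i"
  shows "norm (\<Sum>i\<in>UNIV. h $ i *\<^sub>R a i) \<le> (\<Sum>i\<in>UNIV. M i) * norm h"
proof -
  have "norm (\<Sum>i\<in>UNIV. h $ i *\<^sub>R a i) \<le> (\<Sum>i\<in>UNIV. norm h * M i)"
    by (intro order_trans[OF norm_sum] sum_mono)
      (simp add: component_le_norm_cart mult_mono assms)
  then show ?thesis by (simp add: sum_distrib_left mult.commute)
qed

lemma ap_base_bounded_family:
  fixes f :: "'i \<Rightarrow> real \<Rightarrow> real^'n::finite \<Rightarrow> 'b::real_normed_vector"
  assumes "\<And>i. ap_base \<gamma> T (f i)"
  obtains M where "\<And>i. M i \<ge> 0" "\<And>i t x. t \<in> {0..T} \<Longrightarrow> norm (f i t x) \<le> M i"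
proof -
  have "\<forall>i. \<exists>M. M \<ge> 0 \<and> (\<forall>t\<in>{0..T}. \<forall>x. norm (f i t x) \<le> M)"
  proof
    fix i
    obtain M where "M \<ge> 0" "\<And>t x. t \<in> {0..T} \<Longrightarrow> norm (f i t x) \<le> M"
      using ap_base_bounded[OF assms] by blast
    then show "\<exists>M. M \<ge> 0 \<and> (\<forall>t\<in>{0..T}. \<forall>x. norm (f i t x) \<le> M)" by (intro exI[of _ M]) auto
  qed
  then obtain M where M: "\<forall>i. M i \<ge> 0 \<and> (\<forall>t\<in>{0..T}. \<forall>x. norm (f i t x) \<le> M i)"
    by (rule choice[THEN exE])
  show ?thesis by (rule that[of M]) (use M in auto)
qed

lemma ap_lipschitz:
  fixes f :: "real \<Rightarrow> real^'n::finite \<Rightarrow> 'b::real_normed_vector"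
  assumes f: "\<And>t x. t \<in> {0..T} \<Longrightarrow> (f t has_derivative (\<lambda>h. \<Sum>i\<in>UNIV. h $ i *\<^sub>R g i t x)) (at x)"
    and g: "\<And>i. ap_base \<gamma> T (g i)"
  obtains L where "L \<ge> 0" "\<And>t x y. t \<in> {0..T} \<Longrightarrow> norm (f t x - f t y) \<le> L * norm (x - y)"
proof -
  obtain M where M: "\<And>i. M i \<ge> 0" "\<And>i t x. t \<in> {0..T} \<Longrightarrow> norm (g i t x) \<le> M i"
    using ap_base_bounded_family[where f = g, OF g] by blast
  show ?thesis
  proof (rule that[of "\<Sum>i\<in>UNIV. M i"])
    show "(\<Sum>i\<in>UNIV. M i) \<ge> 0" by (intro sum_nonneg M)
    fix t x y assume t: "t \<in> {0..T}"
    show "norm (f t x - f t y) \<le> (\<Sum>i\<in>UNIV. M i) * norm (x - y)"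
    proof (rule differentiable_bound[OF convex_UNIV])
      show "(f t has_derivative (\<lambda>h. \<Sum>i\<in>UNIV. h $ i *\<^sub>R g i t z)) (at z within UNIV)" for z
        using f[OF t] by simp
      show "onorm (\<lambda>h. \<Sum>i\<in>UNIV. h $ i *\<^sub>R g i t z) \<le> (\<Sum>i\<in>UNIV. M i)" for z
        by (intro onorm_le norm_sum_scaleR_le M t)
    qed auto
  qed
qed

text \<open>The radius is independent of \<open>t\<close> and \<open>x\<close> because the partial
  derivatives share a modulus of continuity; the remainder is estimated by the mean value inequality
  on a ball around \<open>x\<close>.\<close>

lemma ap_taylor:
  fixes f :: "real \<Rightarrow> real^'n::finite \<Rightarrow> 'b::real_normed_vector"
  assumes f: "\<And>t x. t \<in> {0..T} \<Longrightarrow> (f t has_derivative (\<lambda>h. \<Sum>i\<in>UNIV. h $ i *\<^sub>R g i t x)) (at x)"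
    and g: "\<And>i. ap_base \<gamma> T (g i)" and "\<gamma> \<ge> 0" "e > 0"
  obtains d where "d > 0" "\<And>t x h. t \<in> {0..T} \<Longrightarrow> norm h < d \<Longrightarrow>
    norm (f t (x + h) - f t x - (\<Sum>i\<in>UNIV. h $ i *\<^sub>R g i t x)) \<le> e * norm h"
proof -
  \<comment> \<open>Each of the partial derivatives contributes one such share to the operator
    norm.\<close>
  define e' where "e' = e / real CARD('n)"
  have e': "e' > 0" using assms unfolding e'_def by simp
  have "\<forall>i. \<exists>d>0. \<forall>t\<in>{0..T}. \<forall>x y. norm (x - y) < d \<longrightarrow> norm (g i t x - g i t y) \<le> e'"
  proof
    fix i
    obtain d where "d > 0" "\<And>t x y. t \<in> {0..T} \<Longrightarrow> norm (x - y) < d \<Longrightarrow> norm (g i t x - g i t y) \<le> e'"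
      using ap_base_uniform[OF g e' \<open>\<gamma> \<ge> 0\<close>] by blast
    then show "\<exists>d>0. \<forall>t\<in>{0..T}. \<forall>x y. norm (x - y) < d \<longrightarrow> norm (g i t x - g i t y) \<le> e'"
      by (intro exI[of _ d]) auto
  qed
  then obtain d where d: "\<forall>i. d i > 0 \<and> (\<forall>t\<in>{0..T}. \<forall>x y. norm (x - y) < d i \<longrightarrow> norm (g i t x - g i t y) \<le> e')"
    by (rule choice[THEN exE])
  define D where "D = Min (range d)"
  have D: "D > 0" "\<And>i. D \<le> d i" using d unfolding D_def by auto
  show ?thesis
  proof (rule that[OF D(1)])
    fix t and x h :: "real^'n" assume t: "t \<in> {0..T}" and h: "norm h < D"
    have "norm (f t (x + h) - f t x - (\<Sum>i\<in>UNIV. (x + h - x) $ i *\<^sub>R g i t x)) \<le> norm (x + h - x) * e"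
    proof (rule differentiable_bound_linearization[where S = "ball x D" and f' = "\<lambda>z h. \<Sum>i\<in>UNIV. h $ i *\<^sub>R g i t z"])
      fix s :: real assume s: "s \<in> {0..1}"
      have "norm (s *\<^sub>R h) \<le> 1 * norm h" using s unfolding norm_scaleR by (intro mult_right_mono) auto
      then show "x + s *\<^sub>R (x + h - x) \<in> ball x D" using h by (simp add: dist_norm)
    next
      fix z assume z: "z \<in> ball x D"
      show "(f t has_derivative (\<lambda>h. \<Sum>i\<in>UNIV. h $ i *\<^sub>R g i t z)) (at z within ball x D)"
        using f[OF t] by (rule has_derivative_at_withinI)
      have *: "norm (g i t z - g i t x) \<le> e'" for i
        using d D(2)[of i] t z by (auto simp: dist_norm norm_minus_commute)
      have "onorm (\<lambda>h::real^'n. \<Sum>i\<in>UNIV. h $ i *\<^sub>R (g i t z - g i t x)) \<le> (\<Sum>i\<in>(UNIV::'n set). e')"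
        by (intro onorm_le norm_sum_scaleR_le *)
      then show "onorm ((\<lambda>h. \<Sum>i\<in>UNIV. h $ i *\<^sub>R g i t z) - (\<lambda>h. \<Sum>i\<in>UNIV. h $ i *\<^sub>R g i t x)) \<le> e"
        by (simp add: fun_diff_def sum_subtractf scaleR_diff_right e'_def)
    qed (use D in simp)
    then show "norm (f t (x + h) - f t x - (\<Sum>i\<in>UNIV. h $ i *\<^sub>R g i t x)) \<le> e * norm h"
      by (simp add: mult.commute)
  qed
qed

lemma ap_base_continuous_time:
  assumes "ap_base \<gamma> T f"
  shows "continuous_on {0..T} (\<lambda>t. f t x)"
  unfolding continuous_on_iff
proof (intro ballI allI impI)
  fix t e :: real assume t: "t \<in> {0..T}" and e: "0 < e"
  then have "e / 2 > 0" by simp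
  then obtain d where d: "d > 0" "\<And>s t x. s \<in> {0..T} \<Longrightarrow> t \<in> {0..T} \<Longrightarrow> \<bar>s - t\<bar> < d \<Longrightarrow> norm (f s x - f t x) \<le> e / 2"
    using ap_base_time[OF assms] by blast
  have "dist (f s x) (f t x) < e" if "s \<in> {0..T}" "dist s t < d" for s
    using d(2)[OF that(1) t, of x] that(2) e by (simp add: dist_norm)
  then show "\<exists>d>0. \<forall>s\<in>{0..T}. dist s t < d \<longrightarrow> dist (f s x) (f t x) < e" using d(1) by auto
qed

lemma vector_derivative_lipschitz:
  fixes y :: "real \<Rightarrow> 'b::real_normed_vector"
  assumes "\<And>t. t \<in> {0..T} \<Longrightarrow> (y has_vector_derivative y' t) (at t within {0..T})"
    and "\<And>t. t \<in> {0..T} \<Longrightarrow> norm (y' t) \<le> B" and "s \<in> {0..T}" "t \<in> {0..T}"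
  shows "norm (y s - y t) \<le> B * \<bar>s - t\<bar>"
proof -
  have "norm (y s - y t) \<le> B * norm (s - t)"
  proof (rule differentiable_bound[of "{0..T}" _ "\<lambda>t h. h *\<^sub>R y' t"])
    show "onorm (\<lambda>h. h *\<^sub>R y' t) \<le> B" if "t \<in> {0..T}" for t
      by (rule onorm_le) (simp add: mult.commute[of B] mult_left_mono assms(2)[OF that])
  qed (use assms in \<open>auto simp: has_vector_derivative_def\<close>)
  then show ?thesis by simp
qed

lemma ap_time_of_derivative:
  fixes Y :: "real \<Rightarrow> real^'n::finite \<Rightarrow> 'b::real_normed_vector"
  assumes Y: "\<And>t x. t \<in> {0..T} \<Longrightarrow> ((\<lambda>t. Y t x) has_vector_derivative R t x) (at t within {0..T})"
    and R: "\<And>t x. t \<in> {0..T} \<Longrightarrow> norm (R t x) \<le> B" and "e > 0"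
  shows "\<exists>d>0. \<forall>s\<in>{0..T}. \<forall>t\<in>{0..T}. \<forall>x. \<bar>s - t\<bar> < d \<longrightarrow> norm (Y s x - Y t x) \<le> e"
proof -
  define d where "d = e / (\<bar>B\<bar> + 1)"
  have d: "d > 0" unfolding d_def using assms by simp
  have "norm (Y s x - Y t x) \<le> e" if st: "s \<in> {0..T}" "t \<in> {0..T}" "\<bar>s - t\<bar> < d" for s t x
  proof -
    have "norm (Y s x - Y t x) \<le> B * \<bar>s - t\<bar>"
      by (rule vector_derivative_lipschitz[OF Y R st(1,2)])
    also have "\<dots> \<le> (\<bar>B\<bar> + 1) * d" using st(3) by (intro mult_mono) auto
    finally show ?thesis unfolding d_def by (simp add: add_nonneg_pos less_imp_neq)
  qed
  then show ?thesis using d by (intro exI[of _ d]) auto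
qed

text \<open>Since the exponent is below 1, \<open>norm (x - y)\<close> is
  \<open>norm (x - y) powr \<gamma>\<close> times a positive power of the distance, which is small
  for nearby points.\<close>

lemma ap_base_of_lipschitz:
  fixes f :: "real \<Rightarrow> real^'n::finite \<Rightarrow> 'b::real_normed_vector"
  assumes \<gamma>: "\<gamma> < 1"
    and bd: "\<And>t x. t \<in> {0..T} \<Longrightarrow> norm (f t x) \<le> M"
    and time: "\<And>e. e > 0 \<Longrightarrow> \<exists>d>0. \<forall>s\<in>{0..T}. \<forall>t\<in>{0..T}. \<forall>x. \<bar>s - t\<bar> < d \<longrightarrow> norm (f s x - f t x) \<le> e"
    and L: "\<And>t x y. t \<in> {0..T} \<Longrightarrow> norm (f t x - f t y) \<le> L * norm (x - y)"
    and ap: "\<And>e c. e > 0 \<Longrightarrow> \<exists>r. strict_mono (r :: nat \<Rightarrow> nat) \<and> (\<forall>i j. \<forall>t\<in>{0..T}. \<forall>x.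
        norm (f t (x + c (r i)) - f t (x + c (r j))) \<le> e)"
  shows "ap_base \<gamma> T f"
proof (rule ap_baseI[OF bd time _ ap])
  fix e :: real assume e: "e > 0"
  define L' where "L' = \<bar>L\<bar> + 1"
  have L': "L' > 0" "L \<le> L'" unfolding L'_def by auto
  \<comment> \<open>Solves \<open>L' * d powr (1 - \<gamma>) = e\<close>.\<close>
  define d where "d = (e / L') powr (1 / (1 - \<gamma>))"
  have d: "d > 0" unfolding d_def using e L' by simp
  have "norm (f t x - f t y) \<le> e * norm (x - y) powr \<gamma>"
    if t: "t \<in> {0..T}" and xy: "x \<noteq> y" "norm (x - y) < d" for t x y
  proof -
    have "norm (x - y) = norm (x - y) powr (1 - \<gamma>) * norm (x - y) powr \<gamma>"
      using xy by (simp add: powr_add[symmetric])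
    moreover have "norm (x - y) powr (1 - \<gamma>) \<le> d powr (1 - \<gamma>)"
      using xy \<gamma> by (intro powr_mono2) auto
    moreover have "d powr (1 - \<gamma>) = e / L'" unfolding d_def using \<gamma> e L' by (simp add: powr_powr)
    ultimately have "norm (x - y) \<le> e / L' * norm (x - y) powr \<gamma>"
      by (metis mult_right_mono powr_ge_zero)
    then have "L' * norm (x - y) \<le> L' * (e / L' * norm (x - y) powr \<gamma>)"
      using L' by (intro mult_left_mono) auto
    moreover have "L * norm (x - y) \<le> L' * norm (x - y)" using L' by (intro mult_right_mono) auto
    ultimately show ?thesis using L[OF t, of x y] L' by simp
  qed
  then show "\<exists>d>0. \<forall>t\<in>{0..T}. \<forall>x y. x \<noteq> y \<and> norm (x - y) < d \<longrightarrow>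
        norm (f t x - f t y) \<le> e * norm (x - y) powr \<gamma>"
    using d by (intro exI[of _ d]) auto
qed auto

section \<open>Linear equations with coefficients depending on the space variable\<close>

lemma ap_base_vec:
  fixes f :: "'i::finite \<Rightarrow> real \<Rightarrow> real^'n::finite \<Rightarrow> 'b::euclidean_space"
  assumes "\<And>i. ap_base \<gamma> T (f i)"
  shows "ap_base \<gamma> T (\<lambda>t x. \<chi> i. f i t x)"
proof -
  have eq: "(\<lambda>t x. \<chi> i. f i t x) = (\<lambda>t x. \<Sum>i\<in>UNIV. axis i (f i t x))"
  proof (intro ext)
    fix t x show "(\<chi> i. f i t x) = (\<Sum>i\<in>UNIV. axis i (f i t x))"
    by (rule vec_eq_iff[THEN iffD2]) (simp add: axis_def)
  qed
  have bl: "bounded_linear (axis i :: 'b \<Rightarrow> 'b^'i)" for i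
    unfolding linear_conv_bounded_linear[symmetric]
    by (rule linearI; rule vec_eq_iff[THEN iffD2]) (simp_all add: axis_def)
  show ?thesis unfolding eq
    by (rule ap_base_sum[OF finite], rule ap_base_bounded_linear[OF bl assms])
qed

text \<open>The difference of the solutions at \<open>x\<close> and \<open>y\<close> starts at zero
  and solves the linear equation at \<open>x\<close> with a source made of the differences of
  \<open>b\<close> and \<open>F\<close>. Gronwall bounds it by the largest such difference over
  time, the form of domination under which the base class is closed.\<close>

lemma ap_linear_ode_base:
  fixes b :: "'n::finite \<Rightarrow> real \<Rightarrow> real^'n \<Rightarrow> real^'n" and F Y :: "real \<Rightarrow> real^'n \<Rightarrow> real^'n"
  assumes b: "\<And>j. ap_base \<gamma> T (b j)" and F: "ap_base \<gamma> T F"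
    and Y: "\<And>t x. t \<in> {0..T} \<Longrightarrow>
      ((\<lambda>t. Y t x) has_vector_derivative ((\<Sum>j\<in>UNIV. Y t x $ j *\<^sub>R b j t x) + F t x)) (at t within {0..T})"
    and Y0: "\<And>x. Y 0 x = y0"
  shows "ap_base \<gamma> T Y"
proof -
  obtain M where M: "\<And>i. M i \<ge> 0" "\<And>i t x. t \<in> {0..T} \<Longrightarrow> norm (b i t x) \<le> M i"
    using ap_base_bounded_family[where f = b, OF b] by blast
  obtain N where N: "N \<ge> 0" "\<And>t x. t \<in> {0..T} \<Longrightarrow> norm (F t x) \<le> N" using ap_base_bounded[OF F] by blast
  define L where "L = (\<Sum>i\<in>UNIV. M i)"
  have L: "L \<ge> 0" unfolding L_def by (intro sum_nonneg M)
  have Lle: "norm (\<Sum>j\<in>UNIV. h $ j *\<^sub>R b j t x) \<le> L * norm h" if "t \<in> {0..T}" for t x h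
    unfolding L_def by (intro norm_sum_scaleR_le M that)
  define C where "C = gronwall_const L T"
  have C: "C > 0" unfolding C_def by (rule gronwall_const_pos)
  note gron = gronwall[where T = T, OF L, folded C_def]
  define B where "B = C * (norm y0 + N)"
  have B: "norm (Y t x) \<le> B" if t: "t \<in> {0..T}" for t x
  proof -
    have "\<forall>t\<in>{0..T}. norm (Y t x) \<le> C * (norm (Y 0 x) + N)"
    proof (rule gron[OF Y _ N(1)])
      fix t assume t: "t \<in> {0..T}"
      show "norm ((\<Sum>j\<in>UNIV. Y t x $ j *\<^sub>R b j t x) + F t x) \<le> L * norm (Y t x) + N"
        by (intro norm_triangle_le add_mono Lle N t)
    qed
    then show ?thesis using t unfolding B_def Y0 by blast
  qed
  have R: "norm ((\<Sum>j\<in>UNIV. Y t x $ j *\<^sub>R b j t x) + F t x) \<le> L * B + N" if t: "t \<in> {0..T}" for t x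
    by (intro norm_triangle_le add_mono N t order_trans[OF Lle[OF t]] mult_left_mono B L)
  have bF: "ap_base \<gamma> T (\<lambda>t x. ((\<chi> i. b i t x), F t x))"
    by (intro ap_base_Pair ap_base_vec b F)
  show ?thesis
  proof (rule ap_base_dominated[OF bF])
    show "\<exists>d>0. \<forall>s\<in>{0..T}. \<forall>t\<in>{0..T}. \<forall>x. \<bar>s - t\<bar> < d \<longrightarrow> norm (Y s x - Y t x) \<le> e"
      if "e > 0" for e
      using ap_time_of_derivative[where Y = Y, OF Y R that] .
    show "norm (Y t x) \<le> B" if "t \<in> {0..T}" for t x by (rule B[OF that])
    fix t x y and \<delta> :: real
    assume t: "t \<in> {0..T}" and d: "\<delta> \<ge> 0"
      and bF: "\<And>s. s \<in> {0..T} \<Longrightarrow> norm (((\<chi> i. b i s x), F s x) - ((\<chi> i. b i s y), F s y)) \<le> \<delta>"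
    have Fd: "norm (F s x - F s y) \<le> \<delta>" if "s \<in> {0..T}" for s
      using order_trans[OF norm_snd_le bF[OF that, unfolded diff_Pair]] .
    have bd: "norm (b i s x - b i s y) \<le> \<delta>" if "s \<in> {0..T}" for s i
    proof -
      have "norm (b i s x - b i s y) \<le> norm ((\<chi> i. b i s x) - (\<chi> i. b i s y))"
        using Finite_Cartesian_Product.norm_nth_le[of "(\<chi> i. b i s x) - (\<chi> i. b i s y)" i] by simp
      also have "\<dots> \<le> \<delta>" using order_trans[OF norm_fst_le bF[OF that, unfolded diff_Pair]] .
      finally show ?thesis .
    qed
    \<comment> \<open>Each coefficient field differs by at most \<open>\<delta>\<close> and is
      multiplied by a component of a solution bounded by \<open>B\<close>; the extra
      \<open>\<delta>\<close> comes from \<open>F\<close>.\<close>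
    let ?e = "(real CARD('n) * B + 1) * \<delta>"
    have B0: "B \<ge> 0" unfolding B_def using C N by simp
    have "\<forall>t\<in>{0..T}. norm (Y t x - Y t y) \<le> C * (norm (Y 0 x - Y 0 y) + ?e)"
    proof (rule gron[OF has_vector_derivative_diff[OF Y Y]])
      fix s assume s: "s \<in> {0..T}"
      have eq: "(\<Sum>j\<in>UNIV. Y s x $ j *\<^sub>R b j s x) + F s x - ((\<Sum>j\<in>UNIV. Y s y $ j *\<^sub>R b j s y) + F s y) =
        (\<Sum>j\<in>UNIV. (Y s x - Y s y) $ j *\<^sub>R b j s x) +
        ((\<Sum>j\<in>UNIV. Y s y $ j *\<^sub>R (b j s x - b j s y)) + (F s x - F s y))"
        by (simp add: algebra_simps sum.distrib sum_subtractf)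
      have "norm (\<Sum>j\<in>UNIV. Y s y $ j *\<^sub>R (b j s x - b j s y)) \<le> (\<Sum>j\<in>(UNIV::'n set). \<delta>) * norm (Y s y)"
        by (intro norm_sum_scaleR_le bd s)
      also have "\<dots> \<le> (\<Sum>j\<in>(UNIV::'n set). \<delta>) * B" using B[OF s] d by (intro mult_left_mono) auto
      finally have "norm (\<Sum>j\<in>UNIV. Y s y $ j *\<^sub>R (b j s x - b j s y)) + norm (F s x - F s y) \<le> ?e"
        using Fd[OF s] by (simp add: algebra_simps)
      then show "norm ((\<Sum>j\<in>UNIV. Y s x $ j *\<^sub>R b j s x) + F s x - ((\<Sum>j\<in>UNIV. Y s y $ j *\<^sub>R b j s y) + F s y))
        \<le> L * norm (Y s x - Y s y) + ?e"
        unfolding eq by (intro norm_triangle_le add_mono Lle s) (auto intro!: norm_triangle_le)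
    qed (use B0 d in auto)
    then show "norm (Y t x - Y t y) \<le> C * (real CARD('n) * B + 1) * \<delta>"
      using t unfolding Y0 by (simp add: mult.assoc)
  qed
qed

text \<open>The remainder \<open>Y (x + h) - Y x - \<Sum> h i Z i\<close> solves the equation
  linearised at \<open>x\<close> up to an error \<open>e / C * norm h\<close>, so Gronwall makes it
  at most \<open>e * norm h\<close>. Hypothesis \<open>lin\<close> contains the actual increment of
  \<open>Y\<close>, hence presupposes no differentiability of \<open>Y\<close>. The right-hand side
  \<open>R\<close> is left general so that both the nonlinear flow and its linear variational
  equations are covered.\<close>

lemma ap_ode_has_derivative:
  fixes b :: "'n::finite \<Rightarrow> real \<Rightarrow> real^'n \<Rightarrow> real^'n" and R Y :: "real \<Rightarrow> real^'n \<Rightarrow> real^'n"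
    and G Z :: "'n \<Rightarrow> real \<Rightarrow> real^'n \<Rightarrow> real^'n"
  assumes b: "\<And>j. ap_base \<gamma> T (b j)"
    and Y: "\<And>t x. t \<in> {0..T} \<Longrightarrow> ((\<lambda>t. Y t x) has_vector_derivative R t x) (at t within {0..T})"
    and Y0: "\<And>x. Y 0 x = y0"
    and Z: "\<And>i t x. t \<in> {0..T} \<Longrightarrow>
      ((\<lambda>t. Z i t x) has_vector_derivative ((\<Sum>j\<in>UNIV. Z i t x $ j *\<^sub>R b j t x) + G i t x)) (at t within {0..T})"
    and Z0: "\<And>i x. Z i 0 x = 0"
    and lin: "\<And>e. e > 0 \<Longrightarrow> \<exists>d>0. \<forall>t\<in>{0..T}. \<forall>h. norm h < d \<longrightarrow>
      norm (R t (x + h) - R t x - (\<Sum>j\<in>UNIV. (Y t (x + h) - Y t x) $ j *\<^sub>R b j t x)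
        - (\<Sum>i\<in>UNIV. h $ i *\<^sub>R G i t x)) \<le> e * norm h"
    and t: "t \<in> {0..T}"
  shows "(Y t has_derivative (\<lambda>h. \<Sum>i\<in>UNIV. h $ i *\<^sub>R Z i t x)) (at x)"
proof -
  obtain M where M: "\<And>i. M i \<ge> 0" "\<And>i t x. t \<in> {0..T} \<Longrightarrow> norm (b i t x) \<le> M i"
    using ap_base_bounded_family[where f = b, OF b] by blast
  define L where "L = (\<Sum>i\<in>UNIV. M i)"
  have L: "L \<ge> 0" unfolding L_def by (intro sum_nonneg M)
  have Lle: "norm (\<Sum>j\<in>UNIV. h $ j *\<^sub>R b j t x) \<le> L * norm h" if "t \<in> {0..T}" for t x h
    unfolding L_def by (intro norm_sum_scaleR_le M that)
  define C where "C = gronwall_const L T"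
  have C: "C > 0" unfolding C_def by (rule gronwall_const_pos)
  note gron = gronwall[where T = T, OF L, folded C_def]
  show ?thesis
    unfolding has_derivative_at_alt
  proof (intro conjI allI impI)
    show "bounded_linear (\<lambda>h. \<Sum>i\<in>UNIV. h $ i *\<^sub>R Z i t x)"
      by (intro bounded_linear_sum bounded_linear_compose[OF bounded_linear_scaleR_left bounded_linear_vec_nth])
    fix e :: real assume e: "e > 0"
    then have "e / C > 0" using C by simp
    from lin[OF this] obtain d where d: "d > 0" "\<forall>t\<in>{0..T}. \<forall>h. norm h < d \<longrightarrow>
      norm (R t (x + h) - R t x - (\<Sum>j\<in>UNIV. (Y t (x + h) - Y t x) $ j *\<^sub>R b j t x)
        - (\<Sum>i\<in>UNIV. h $ i *\<^sub>R G i t x)) \<le> e / C * norm h"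
      by (elim exE conjE)
    have main: "norm (Y t (x + h) - Y t x - (\<Sum>i\<in>UNIV. h $ i *\<^sub>R Z i t x)) \<le> e * norm h" if h: "norm h < d" for h
    proof -
      define w where "w s = Y s (x + h) - Y s x - (\<Sum>i\<in>UNIV. h $ i *\<^sub>R Z i s x)" for s
      define w' where "w' s = R s (x + h) - R s x - (\<Sum>i\<in>UNIV. h $ i *\<^sub>R ((\<Sum>j\<in>UNIV. Z i s x $ j *\<^sub>R b j s x) + G i s x))" for s
      have "\<forall>s\<in>{0..T}. norm (w s) \<le> C * (norm (w 0) + e / C * norm h)"
      proof (rule gron)
        fix s assume s: "s \<in> {0..T}"
        show "(w has_vector_derivative w' s) (at s within {0..T})"
          unfolding w_def w'_def
          by (intro has_vector_derivative_diff has_vector_derivative_sum Y[OF s]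
              bounded_linear.has_vector_derivative[OF bounded_linear_scaleR_right] Z[OF s])
        \<comment> \<open>The linear part acting on \<open>w\<close> is split off from
          \<open>w'\<close>; what remains is exactly the expression estimated by
          \<open>lin\<close>.\<close>
        have 1: "(\<Sum>j\<in>UNIV. w s $ j *\<^sub>R b j s x) = (\<Sum>j\<in>UNIV. (Y s (x + h) - Y s x) $ j *\<^sub>R b j s x)
            - (\<Sum>j\<in>UNIV. \<Sum>i\<in>UNIV. h $ i *\<^sub>R Z i s x $ j *\<^sub>R b j s x)"
          unfolding w_def by (simp add: scaleR_diff_left sum_subtractf scaleR_sum_left)
        have 2: "(\<Sum>j\<in>UNIV. \<Sum>i\<in>UNIV. h $ i *\<^sub>R Z i s x $ j *\<^sub>R b j s x) =
          (\<Sum>i\<in>UNIV. \<Sum>j\<in>UNIV. h $ i *\<^sub>R Z i s x $ j *\<^sub>R b j s x)"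
          by (rule sum.swap)
        have "w' s = (\<Sum>j\<in>UNIV. w s $ j *\<^sub>R b j s x) +
          (R s (x + h) - R s x - (\<Sum>j\<in>UNIV. (Y s (x + h) - Y s x) $ j *\<^sub>R b j s x)
            - (\<Sum>i\<in>UNIV. h $ i *\<^sub>R G i s x))"
          unfolding w'_def 1 2 by (simp add: scaleR_add_right sum.distrib scaleR_sum_right)
        then show "norm (w' s) \<le> L * norm (w s) + e / C * norm h"
          by (simp only:) (intro norm_triangle_le add_mono Lle d(2)[rule_format] s h)
      qed (use e C in auto)
      moreover have "w 0 = 0" unfolding w_def by (simp add: Y0 Z0)
      ultimately have "norm (w t) \<le> C * (e / C * norm h)" using t by auto
      then show ?thesis using C unfolding w_def by simp
    qed
    have "norm (Y t y - Y t x - (\<Sum>i\<in>UNIV. (y - x) $ i *\<^sub>R Z i t x)) \<le> e * norm (y - x)"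
      if "norm (y - x) < d" for y
      using main[OF that] by simp
    then show "\<exists>d>0. \<forall>y. norm (y - x) < d \<longrightarrow>
      norm (Y t y - Y t x - (\<Sum>i\<in>UNIV. (y - x) $ i *\<^sub>R Z i t x)) \<le> e * norm (y - x)"
      using d(1) by blast
  qed
qed

text \<open>Solved for each \<open>x\<close> separately, with no regularity in \<open>x\<close>
  claimed. These are the candidates for partial derivatives of solutions with constant initial
  value, which is why they start at zero.\<close>

lemma ap_linear_ode_exists:
  fixes b :: "'n::finite \<Rightarrow> real \<Rightarrow> real^'n \<Rightarrow> real^'n" and F :: "real \<Rightarrow> real^'n \<Rightarrow> real^'n"
  assumes "T \<ge> 0" and b: "\<And>j. ap_base \<gamma> T (b j)" and F: "ap_base \<gamma> T F"
  shows "\<exists>Y. (\<forall>x. Y 0 x = 0) \<and> (\<forall>t\<in>{0..T}. \<forall>x.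
    ((\<lambda>t. Y t x) has_vector_derivative ((\<Sum>j\<in>UNIV. Y t x $ j *\<^sub>R b j t x) + F t x)) (at t within {0..T}))"
proof -
  obtain M where M: "\<And>i. M i \<ge> 0" "\<And>i t x. t \<in> {0..T} \<Longrightarrow> norm (b i t x) \<le> M i"
    using ap_base_bounded_family[where f = b, OF b] by blast
  have "\<forall>x. \<exists>y. y 0 = 0 \<and> (\<forall>t\<in>{0..T}.
    (y has_vector_derivative ((\<Sum>j\<in>UNIV. y t $ j *\<^sub>R b j t x) + F t x)) (at t within {0..T}))"
  proof
    fix x
    show "\<exists>y. y 0 = 0 \<and> (\<forall>t\<in>{0..T}.
      (y has_vector_derivative ((\<Sum>j\<in>UNIV. y t $ j *\<^sub>R b j t x) + F t x)) (at t within {0..T}))"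
    proof (rule picard_lindeloef[where f = "\<lambda>t y. (\<Sum>j\<in>UNIV. y $ j *\<^sub>R b j t x) + F t x"])
      show "(\<Sum>i\<in>UNIV. M i) \<ge> 0" by (intro sum_nonneg M)
      show "continuous_on {0..T} (\<lambda>t. (\<Sum>j\<in>UNIV. y t $ j *\<^sub>R b j t x) + F t x)" if "continuous_on {0..T} y" for y
        by (intro continuous_intros that ap_base_continuous_time[OF b] ap_base_continuous_time[OF F])
      fix t and y z :: "real^'n" assume t: "t \<in> {0..T}"
      have "(\<Sum>j\<in>UNIV. y $ j *\<^sub>R b j t x) + F t x - ((\<Sum>j\<in>UNIV. z $ j *\<^sub>R b j t x) + F t x) =
        (\<Sum>j\<in>UNIV. (y - z) $ j *\<^sub>R b j t x)" by (simp add: scaleR_diff_left sum_subtractf)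
      then show "norm ((\<Sum>j\<in>UNIV. y $ j *\<^sub>R b j t x) + F t x - ((\<Sum>j\<in>UNIV. z $ j *\<^sub>R b j t x) + F t x))
        \<le> (\<Sum>i\<in>UNIV. M i) * norm (y - z)"
        by (simp only:) (intro norm_sum_scaleR_le M t)
    qed fact
  qed
  then obtain y where "\<forall>x. y x 0 = 0 \<and> (\<forall>t\<in>{0..T}.
    (y x has_vector_derivative ((\<Sum>j\<in>UNIV. y x t $ j *\<^sub>R b j t x) + F t x)) (at t within {0..T}))"
    by (rule choice[THEN exE])
  then show ?thesis by (intro exI[of _ "\<lambda>t x. y x t"]) auto
qed

text \<open>A partial derivative of the solution solves an equation with the same coefficients
  \<open>b\<close> and a new source \<open>G i\<close>. That source contains \<open>Y\<close>
  undifferentiated, so it is of class \<open>k\<close> once \<open>Y\<close> is. The induction thus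
  varies the source, the solution and the initial value.\<close>

lemma ap_class_linear_ode:
  fixes b :: "'n::finite \<Rightarrow> real \<Rightarrow> real^'n \<Rightarrow> real^'n" and F Y :: "real \<Rightarrow> real^'n \<Rightarrow> real^'n"
  assumes \<gamma>: "\<gamma> \<ge> 0" and T: "T \<ge> 0"
    and "\<And>j. ap_class \<gamma> T k (b j)" and "ap_class \<gamma> T k F"
    and "\<And>t x. t \<in> {0..T} \<Longrightarrow>
      ((\<lambda>t. Y t x) has_vector_derivative ((\<Sum>j\<in>UNIV. Y t x $ j *\<^sub>R b j t x) + F t x)) (at t within {0..T})"
    and "\<And>x. Y 0 x = y0"
  shows "ap_class \<gamma> T k Y"
  using assms(3-)
proof (induction k arbitrary: b F Y y0)
  case 0
  then show ?case using ap_linear_ode_base[of \<gamma> T b F Y y0] by simp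
next
  case (Suc k)
  note b = Suc.prems(1)[THEN ap_class_base] and F = Suc.prems(2)[THEN ap_class_base]
  have Yb: "ap_base \<gamma> T Y" by (rule ap_linear_ode_base[where b = b, OF b F Suc.prems(3,4)])
  \<comment> \<open>The induction hypothesis is first spent on \<open>Y\<close> itself, one order
    below the goal, to make the source of the differentiated equation admissible.\<close>
  have Yk: "ap_class \<gamma> T k Y"
    by (rule Suc.IH[where b = b, OF ap_class_SucD[OF Suc.prems(1)] ap_class_SucD[OF Suc.prems(2)] Suc.prems(3,4)])
  have "\<forall>j. \<exists>g. (\<forall>t\<in>{0..T}. \<forall>x. (b j t has_derivative (\<lambda>h. \<Sum>i\<in>UNIV. h $ i *\<^sub>R g i t x)) (at x)) \<and>
          (\<forall>i. ap_class \<gamma> T k (g i))"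
    using Suc.prems(1) unfolding ap_class.simps(2) by simp
  from choice[OF this] obtain b' where
    b': "\<forall>j. (\<forall>t\<in>{0..T}. \<forall>x. (b j t has_derivative (\<lambda>h. \<Sum>i\<in>UNIV. h $ i *\<^sub>R b' j i t x)) (at x)) \<and>
          (\<forall>i. ap_class \<gamma> T k (b' j i))" by (elim exE)
  then have b'd: "\<And>j t x. t \<in> {0..T} \<Longrightarrow> (b j t has_derivative (\<lambda>h. \<Sum>i\<in>UNIV. h $ i *\<^sub>R b' j i t x)) (at x)"
    and b'k: "\<And>j i. ap_class \<gamma> T k (b' j i)" by simp_all
  obtain F' where F'd: "\<And>t x. t \<in> {0..T} \<Longrightarrow> (F t has_derivative (\<lambda>h. \<Sum>i\<in>UNIV. h $ i *\<^sub>R F' i t x)) (at x)"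
    and F'k: "\<And>i. ap_class \<gamma> T k (F' i)" by (rule ap_class_SucE[OF Suc.prems(2)]) (rule that)
  define G where "G i t x = (\<Sum>j\<in>UNIV. Y t x $ j *\<^sub>R b' j i t x) + F' i t x" for i t x
  have Gk: "ap_class \<gamma> T k (G i)" for i
    unfolding G_def
    by (rule ap_class_add[OF ap_class_sum[OF finite ap_class_bilinear[OF bounded_bilinear_scaleR
          ap_class_bounded_linear[OF bounded_linear_vec_nth Yk] b'k]] F'k])
  have "\<forall>i. \<exists>Z. (\<forall>x. Z 0 x = 0) \<and> (\<forall>t\<in>{0..T}. \<forall>x.
    ((\<lambda>t. Z t x) has_vector_derivative ((\<Sum>j\<in>UNIV. Z t x $ j *\<^sub>R b j t x) + G i t x)) (at t within {0..T}))"
    by (intro allI ap_linear_ode_exists[where b = b, OF T b Gk[THEN ap_class_base]])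
  from choice[OF this] obtain Z where Z: "\<forall>i. (\<forall>x. Z i 0 x = 0) \<and> (\<forall>t\<in>{0..T}. \<forall>x.
    ((\<lambda>t. Z i t x) has_vector_derivative ((\<Sum>j\<in>UNIV. Z i t x $ j *\<^sub>R b j t x) + G i t x)) (at t within {0..T}))"
    by (elim exE)
  then have Z0: "\<And>i x. Z i 0 x = 0"
    and Zd: "\<And>i t x. t \<in> {0..T} \<Longrightarrow>
    ((\<lambda>t. Z i t x) has_vector_derivative ((\<Sum>j\<in>UNIV. Z i t x $ j *\<^sub>R b j t x) + G i t x)) (at t within {0..T})"
    by simp_all
  show ?case
  proof (rule ap_class_SucI[OF Yb])
    show "ap_class \<gamma> T k (Z i)" for i
      by (rule Suc.IH[where b = b, OF ap_class_SucD[OF Suc.prems(1)] Gk Zd Z0])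
    fix t x assume t: "t \<in> {0..T}"
    show "(Y t has_derivative (\<lambda>h. \<Sum>i\<in>UNIV. h $ i *\<^sub>R Z i t x)) (at x)"
    proof (rule ap_ode_has_derivative[where b = b and Z = Z, OF b Suc.prems(3,4) Zd Z0 _ t])
      fix e :: real assume e: "e > 0"
      obtain B where B: "B \<ge> 0" "\<And>t x. t \<in> {0..T} \<Longrightarrow> norm (Y t x) \<le> B" using ap_base_bounded[OF Yb] by blast
      have "\<forall>j. \<exists>L. L \<ge> 0 \<and> (\<forall>t\<in>{0..T}. \<forall>x y. norm (b j t x - b j t y) \<le> L * norm (x - y))"
      proof
        fix j
        obtain L where "L \<ge> 0" "\<And>t x y. t \<in> {0..T} \<Longrightarrow> norm (b j t x - b j t y) \<le> L * norm (x - y)"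
          using ap_lipschitz[where f = "b j", OF b'd b'k[THEN ap_class_base]] by blast
        then show "\<exists>L. L \<ge> 0 \<and> (\<forall>t\<in>{0..T}. \<forall>x y. norm (b j t x - b j t y) \<le> L * norm (x - y))"
          by (intro exI[of _ L]) auto
      qed
      from choice[OF this] obtain L where L: "\<forall>j. L j \<ge> 0 \<and> (\<forall>t\<in>{0..T}. \<forall>x y. norm (b j t x - b j t y) \<le> L j * norm (x - y))"
        by (elim exE)
      define SL where "SL = (\<Sum>j\<in>UNIV. L j)"
      have SL: "SL \<ge> 0" unfolding SL_def using L by (intro sum_nonneg) auto
      define n where "n = real CARD('n)"
      have n: "n > 0" unfolding n_def by simp
      \<comment> \<open>One third of the tolerance goes to each of three errors: increment of
        \<open>Y\<close> times increment of \<open>b\<close>, \<open>Y\<close> times the expansion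
        error of \<open>b\<close>, and the expansion error of \<open>F\<close>. The added 1 keeps
        denominators positive.\<close>
      have e1: "e / (3 * (SL + 1)) > 0" and e2: "e / (3 * n * (B + 1)) > 0" and e3: "e / 3 > 0"
        using e SL B n by (auto intro!: divide_pos_pos mult_pos_pos)
      obtain d1 where d1: "d1 > 0" "\<And>t x y. t \<in> {0..T} \<Longrightarrow> norm (x - y) < d1 \<Longrightarrow> norm (Y t x - Y t y) \<le> e / (3 * (SL + 1))"
        using ap_base_uniform[OF Yb e1 \<gamma>] by blast
      define P where "P j d \<longleftrightarrow> (\<forall>t\<in>{0..T}. \<forall>x h. norm h < d \<longrightarrow>
         norm (b j t (x + h) - b j t x - (\<Sum>i\<in>UNIV. h $ i *\<^sub>R b' j i t x)) \<le> e / (3 * n * (B + 1)) * norm h)" for j d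
      have Pex: "\<exists>d>0. P j d" for j
      proof -
        obtain d where d: "d > 0" "\<And>t x h. t \<in> {0..T} \<Longrightarrow> norm h < d \<Longrightarrow>
          norm (b j t (x + h) - b j t x - (\<Sum>i\<in>UNIV. h $ i *\<^sub>R b' j i t x)) \<le> e / (3 * n * (B + 1)) * norm h"
          using ap_taylor[where f = "b j", OF b'd b'k[THEN ap_class_base] \<gamma> e2] by blast
        then show ?thesis unfolding P_def by (intro exI[of _ d] conjI ballI allI impI)
      qed
      have Pmono: "\<forall>j d d'. P j d \<longrightarrow> d' \<le> d \<longrightarrow> P j d'"
        unfolding P_def by (meson order_less_le_trans)
      have "\<exists>d>0. \<forall>j\<in>UNIV. P j d" by (rule finite_common_radius[OF finite Pex Pmono])
      then obtain d2 where d2: "d2 > 0" "\<forall>j\<in>UNIV. P j d2" by (elim exE conjE)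
      note d2' = d2(2)[unfolded P_def, rule_format, OF UNIV_I]
      obtain d3 where d3: "d3 > 0" "\<And>t x h. t \<in> {0..T} \<Longrightarrow> norm h < d3 \<Longrightarrow>
        norm (F t (x + h) - F t x - (\<Sum>i\<in>UNIV. h $ i *\<^sub>R F' i t x)) \<le> e / 3 * norm h"
        using ap_taylor[where f = F, OF F'd F'k[THEN ap_class_base] \<gamma> e3] by blast
      have main: "norm ((\<Sum>j\<in>UNIV. Y t (x + h) $ j *\<^sub>R b j t (x + h)) + F t (x + h) -
          ((\<Sum>j\<in>UNIV. Y t x $ j *\<^sub>R b j t x) + F t x) - (\<Sum>j\<in>UNIV. (Y t (x + h) - Y t x) $ j *\<^sub>R b j t x)
          - (\<Sum>i\<in>UNIV. h $ i *\<^sub>R G i t x)) \<le> e * norm h"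
        if t: "t \<in> {0..T}" and h: "norm h < min d1 (min d2 d3)" for t h
      proof -
        \<comment> \<open>Here \<open>m\<close> is the inserted mixed term, \<open>Y\<close> at
          \<open>x\<close> against \<open>b\<close> at \<open>x + h\<close>; it separates the
          product of increments from the expansion error of \<open>b\<close>.\<close>
        have grp: "p + f - (q + g) - r - (s + k) = (p - m - r) + (m - q - s) + (f - g - k)"
          for p f q g r s k m :: "real^'n" by simp
        define A1 where "A1 = (\<Sum>j\<in>UNIV. (Y t (x + h) - Y t x) $ j *\<^sub>R (b j t (x + h) - b j t x))"
        define A2 where "A2 = (\<Sum>j\<in>UNIV. Y t x $ j *\<^sub>R (b j t (x + h) - b j t x - (\<Sum>i\<in>UNIV. h $ i *\<^sub>R b' j i t x)))"
        define A3 where "A3 = F t (x + h) - F t x - (\<Sum>i\<in>UNIV. h $ i *\<^sub>R F' i t x)"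
        have sw: "(\<Sum>j\<in>UNIV. \<Sum>i\<in>UNIV. Y t x $ j *\<^sub>R h $ i *\<^sub>R b' j i t x) =
            (\<Sum>i\<in>UNIV. \<Sum>j\<in>UNIV. h $ i *\<^sub>R Y t x $ j *\<^sub>R b' j i t x)"
          by (subst sum.swap) (simp add: mult.commute)
        have A2': "A2 = (\<Sum>j\<in>UNIV. Y t x $ j *\<^sub>R b j t (x + h)) - (\<Sum>j\<in>UNIV. Y t x $ j *\<^sub>R b j t x)
            - (\<Sum>j\<in>UNIV. \<Sum>i\<in>UNIV. Y t x $ j *\<^sub>R h $ i *\<^sub>R b' j i t x)"
          unfolding A2_def by (simp only: scaleR_diff_right sum_subtractf scaleR_sum_right)
        have A1': "A1 = (\<Sum>j\<in>UNIV. Y t (x + h) $ j *\<^sub>R b j t (x + h)) - (\<Sum>j\<in>UNIV. Y t x $ j *\<^sub>R b j t (x + h))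
            - (\<Sum>j\<in>UNIV. (Y t (x + h) - Y t x) $ j *\<^sub>R b j t x)"
          unfolding A1_def by (simp only: scaleR_diff_right sum_subtractf vector_minus_component scaleR_diff_left)
        have G': "(\<Sum>i\<in>UNIV. h $ i *\<^sub>R G i t x) =
          (\<Sum>i\<in>UNIV. \<Sum>j\<in>UNIV. h $ i *\<^sub>R Y t x $ j *\<^sub>R b' j i t x) + (\<Sum>i\<in>UNIV. h $ i *\<^sub>R F' i t x)"
          unfolding G_def by (simp only: scaleR_add_right sum.distrib scaleR_sum_right)
        have "norm A1 \<le> (\<Sum>j\<in>UNIV. L j * norm h) * norm (Y t (x + h) - Y t x)"
          unfolding A1_def
        proof (rule norm_sum_scaleR_le)
          show "norm (b j t (x + h) - b j t x) \<le> L j * norm h" for j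
            using L[rule_format, THEN conjunct2, rule_format, OF t, of j "x + h" x] by simp
        qed
        also have "\<dots> \<le> (SL * norm h) * (e / (3 * (SL + 1)))"
          unfolding sum_distrib_right[symmetric] SL_def[symmetric] using h SL
          by (intro mult_left_mono d1(2) t) auto
        also have "\<dots> = (SL / (SL + 1)) * (e / 3 * norm h)" by (simp add: mult.commute)
        also have "\<dots> \<le> 1 * (e / 3 * norm h)" using SL e by (intro mult_right_mono) auto
        finally have A1: "norm A1 \<le> e / 3 * norm h" by simp
        have "norm A2 \<le> (\<Sum>j\<in>(UNIV::'n set). e / (3 * n * (B + 1)) * norm h) * norm (Y t x)"
          unfolding A2_def
          by (rule norm_sum_scaleR_le) (use d2'[OF t] h in auto)
        also have "\<dots> \<le> (\<Sum>j\<in>(UNIV::'n set). e / (3 * n * (B + 1)) * norm h) * B"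
          using e2 by (intro mult_left_mono B t sum_nonneg mult_nonneg_nonneg) auto
        also have "\<dots> = (B / (B + 1)) * (e / 3 * norm h)" using n by (simp add: n_def mult.commute)
        also have "\<dots> \<le> 1 * (e / 3 * norm h)" using B e by (intro mult_right_mono) auto
        finally have A2: "norm A2 \<le> e / 3 * norm h" by simp
        have A3: "norm A3 \<le> e / 3 * norm h" unfolding A3_def using h by (intro d3(2) t) auto
        have "(\<Sum>j\<in>UNIV. Y t (x + h) $ j *\<^sub>R b j t (x + h)) + F t (x + h) -
          ((\<Sum>j\<in>UNIV. Y t x $ j *\<^sub>R b j t x) + F t x) - (\<Sum>j\<in>UNIV. (Y t (x + h) - Y t x) $ j *\<^sub>R b j t x)
          - (\<Sum>i\<in>UNIV. h $ i *\<^sub>R G i t x) = A1 + A2 + A3"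
          unfolding A1' A2' A3_def G' sw by (rule grp)
        moreover have "norm (A1 + A2 + A3) \<le> e * norm h"
          using norm_triangle_ineq[of "A1 + A2" A3] norm_triangle_ineq[of A1 A2] A1 A2 A3 by linarith
        ultimately show ?thesis by (simp only:)
      qed
      show "\<exists>d>0. \<forall>t\<in>{0..T}. \<forall>h. norm h < d \<longrightarrow>
        norm ((\<Sum>j\<in>UNIV. Y t (x + h) $ j *\<^sub>R b j t (x + h)) + F t (x + h) -
          ((\<Sum>j\<in>UNIV. Y t x $ j *\<^sub>R b j t x) + F t x) - (\<Sum>j\<in>UNIV. (Y t (x + h) - Y t x) $ j *\<^sub>R b j t x)
          - (\<Sum>i\<in>UNIV. h $ i *\<^sub>R G i t x)) \<le> e * norm h"
        by (intro exI[of _ "min d1 (min d2 d3)"] conjI ballI allI impI main)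
          (use d1(1) d2(1) d3(1) in auto)
    qed
  qed
qed

section \<open>Existence and spatial regularity of the flow\<close>

lemma continuous_on_ap_base_compose:
  fixes f :: "real \<Rightarrow> real^'n::finite \<Rightarrow> 'b::real_normed_vector"
  assumes f: "ap_base \<gamma> T f" and \<gamma>: "\<gamma> \<ge> 0" and y: "continuous_on {0..T} y"
  shows "continuous_on {0..T} (\<lambda>t. f t (y t))"
  unfolding continuous_on_iff
proof (intro ballI allI impI)
  fix t e :: real assume t: "t \<in> {0..T}" and e: "0 < e"
  then have e3: "e / 3 > 0" by simp
  obtain d1 where d1: "d1 > 0" "\<And>s t x. s \<in> {0..T} \<Longrightarrow> t \<in> {0..T} \<Longrightarrow> \<bar>s - t\<bar> < d1 \<Longrightarrow> norm (f s x - f t x) \<le> e / 3"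
    using ap_base_time[OF f e3] by blast
  obtain d2 where d2: "d2 > 0" "\<And>t x y. t \<in> {0..T} \<Longrightarrow> norm (x - y) < d2 \<Longrightarrow> norm (f t x - f t y) \<le> e / 3"
    using ap_base_uniform[OF f e3 \<gamma>] by blast
  obtain d3 where d3: "d3 > 0" "\<forall>s\<in>{0..T}. dist s t < d3 \<longrightarrow> dist (y s) (y t) < d2"
    using y[unfolded continuous_on_iff, rule_format, OF t d2(1)] by blast
  have "dist (f s (y s)) (f t (y t)) < e" if s: "s \<in> {0..T}" and d: "dist s t < min d1 d3" for s
  proof -
    have "norm (f s (y s) - f t (y s)) \<le> e / 3" using d1(2)[OF s t, of "y s"] d by (simp add: dist_norm)
    moreover have "norm (f t (y s) - f t (y t)) \<le> e / 3"
      using d2(2)[OF t, of "y s" "y t"] d3(2) s d by (simp add: dist_norm)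
    ultimately have "norm (f s (y s) - f t (y t)) \<le> e / 3 + e / 3" by (rule norm_diff_triangle_le)
    then show ?thesis using e by (simp add: dist_norm)
  qed
  then show "\<exists>d>0. \<forall>s\<in>{0..T}. dist s t < d \<longrightarrow> dist (f s (y s)) (f t (y t)) < e"
    using d1(1) d3(1) by (intro exI[of _ "min d1 d3"]) auto
qed

lemma ap_flow_exists:
  fixes u :: "real \<Rightarrow> real^'n::finite \<Rightarrow> real^'n"
  assumes \<gamma>: "0 \<le> \<gamma>" "\<gamma> < 1" and T: "T \<ge> 0" and u: "ap_class \<gamma> T (Suc k) u"
  obtains \<psi> L where "\<And>x. \<psi> 0 x = 0"
    "\<And>t x. t \<in> {0..T} \<Longrightarrow> ((\<lambda>t. \<psi> t x) has_vector_derivative u t (x + \<psi> t x)) (at t within {0..T})"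
    "ap_class \<gamma> T (Suc k) \<psi>" "L \<ge> 0"
    "\<And>t x y. t \<in> {0..T} \<Longrightarrow> norm (\<psi> t x - \<psi> t y) \<le> L * norm (x - y)"
proof -
  have ub: "ap_base \<gamma> T u" by (rule ap_class_base[OF u])
  obtain u' where u'd: "\<And>t x. t \<in> {0..T} \<Longrightarrow> (u t has_derivative (\<lambda>h. \<Sum>i\<in>UNIV. h $ i *\<^sub>R u' i t x)) (at x)"
    and u'k: "\<And>i. ap_class \<gamma> T k (u' i)" by (rule ap_class_SucE[OF u]) (rule that)
  have u'b: "\<And>i. ap_base \<gamma> T (u' i)" by (rule ap_class_base[OF u'k])
  obtain L where L: "L \<ge> 0" "\<And>t x y. t \<in> {0..T} \<Longrightarrow> norm (u t x - u t y) \<le> L * norm (x - y)"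
    using ap_lipschitz[where f = u, OF u'd u'b] by blast
  have "\<forall>x. \<exists>y. y 0 = 0 \<and> (\<forall>t\<in>{0..T}. (y has_vector_derivative u t (x + y t)) (at t within {0..T}))"
  proof
    fix x
    show "\<exists>y. y 0 = 0 \<and> (\<forall>t\<in>{0..T}. (y has_vector_derivative u t (x + y t)) (at t within {0..T}))"
    proof (rule picard_lindeloef[where f = "\<lambda>t y. u t (x + y)", OF T L(1)])
      show "continuous_on {0..T} (\<lambda>t. u t (x + y t))" if "continuous_on {0..T} y" for y
        by (rule continuous_on_ap_base_compose[OF ub \<gamma>(1)]) (intro continuous_intros that)
      show "norm (u t (x + y) - u t (x + z)) \<le> L * norm (y - z)" if "t \<in> {0..T}" for t y z
        using L(2)[OF that, of "x + y" "x + z"] by simp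
    qed
  qed
  from choice[OF this] obtain \<psi>' where
    "\<forall>x. \<psi>' x 0 = 0 \<and> (\<forall>t\<in>{0..T}. (\<psi>' x has_vector_derivative u t (x + \<psi>' x t)) (at t within {0..T}))"
    by (elim exE)
  moreover define \<psi> where "\<psi> t x = \<psi>' x t" for t x
  ultimately have p0: "\<psi> 0 x = 0" and
    pd: "\<And>t. t \<in> {0..T} \<Longrightarrow> ((\<lambda>t. \<psi> t x) has_vector_derivative u t (x + \<psi> t x)) (at t within {0..T})" for x
    by simp_all
  define C where "C = gronwall_const L T"
  have C: "C > 0" unfolding C_def by (rule gronwall_const_pos)
  note gron = gronwall[where T = T, OF L(1), folded C_def]
  obtain M where M: "M \<ge> 0" "\<And>t x. t \<in> {0..T} \<Longrightarrow> norm (u t x) \<le> M" using ap_base_bounded[OF ub] by blast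
  have pb: "norm (\<psi> t x) \<le> C * M" if t: "t \<in> {0..T}" for t x
  proof -
    have "\<forall>t\<in>{0..T}. norm (\<psi> t x) \<le> C * (norm (\<psi> 0 x) + M)"
    proof (rule gron[OF pd _ M(1)])
      fix t assume "t \<in> {0..T}"
      then have "norm (u t (x + \<psi> t x)) \<le> M" by (rule M)
      then show "norm (u t (x + \<psi> t x)) \<le> L * norm (\<psi> t x) + M" using L(1) by (simp add: add_increasing)
    qed
    then show ?thesis using t by (simp add: p0)
  qed
  \<comment> \<open>Two trajectories are compared by Gronwall with the constant error
    \<open>L * norm (x - y)\<close>, as their displacements both start at zero.\<close>
  have pL: "norm (\<psi> t x - \<psi> t y) \<le> C * L * norm (x - y)" if t: "t \<in> {0..T}" for t x y
  proof -
    have "\<forall>t\<in>{0..T}. norm (\<psi> t x - \<psi> t y) \<le> C * (norm (\<psi> 0 x - \<psi> 0 y) + L * norm (x - y))"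
    proof (rule gron[OF has_vector_derivative_diff[OF pd pd]])
      fix t assume t: "t \<in> {0..T}"
      have "norm (u t (x + \<psi> t x) - u t (y + \<psi> t y)) \<le> L * norm ((x - y) + (\<psi> t x - \<psi> t y))"
        using L(2)[OF t, of "x + \<psi> t x" "y + \<psi> t y"] by (simp add: algebra_simps)
      also have "\<dots> \<le> L * (norm (x - y) + norm (\<psi> t x - \<psi> t y))"
        by (intro mult_left_mono norm_triangle_ineq L)
      finally show "norm (u t (x + \<psi> t x) - u t (y + \<psi> t y)) \<le> L * norm (\<psi> t x - \<psi> t y) + L * norm (x - y)"
        by (simp add: algebra_simps)
    qed (use L in auto)
    then show ?thesis using t by (simp add: p0 mult.assoc)
  qed
  have CL: "C * L \<ge> 0" using C L by simp
  have base: "ap_base \<gamma> T \<psi>"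
  proof (rule ap_base_of_lipschitz[OF \<gamma>(2) pb _ pL])
    show "\<exists>d>0. \<forall>s\<in>{0..T}. \<forall>t\<in>{0..T}. \<forall>x. \<bar>s - t\<bar> < d \<longrightarrow> norm (\<psi> s x - \<psi> t x) \<le> e" if "e > 0" for e
    proof (rule ap_time_of_derivative[where Y = \<psi>, OF pd _ that])
      show "norm (u t (x + \<psi> t x)) \<le> M" if "t \<in> {0..T}" for t x by (rule M(2)[OF that])
    qed
    fix e :: real and c :: "nat \<Rightarrow> real^'n" assume e: "e > 0"
    then have e': "e / C > 0" using C by simp
    obtain r :: "nat \<Rightarrow> nat" where r: "strict_mono r"
      "\<And>i j t x. t \<in> {0..T} \<Longrightarrow> norm (u t (x + c (r i)) - u t (x + c (r j))) \<le> e / C"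
      using ap_base_translates[OF ub e'] by blast
    have "norm (\<psi> t (x + c (r i)) - \<psi> t (x + c (r j))) \<le> e" if t: "t \<in> {0..T}" for i j t x
    proof -
      \<comment> \<open>The velocities along the two trajectories differ by a pure translation of
        \<open>u\<close>, at most \<open>e / C\<close>, and by the distance of the displacements
        times \<open>L\<close>, which Gronwall absorbs.\<close>
      let ?a = "x + c (r i)" and ?b = "x + c (r j)"
      have "\<forall>t\<in>{0..T}. norm (\<psi> t ?a - \<psi> t ?b) \<le> C * (norm (\<psi> 0 ?a - \<psi> 0 ?b) + e / C)"
      proof (rule gron[OF has_vector_derivative_diff[OF pd pd]])
        fix t assume t: "t \<in> {0..T}"
        have "norm (u t ((x + \<psi> t ?a) + c (r i)) - u t ((x + \<psi> t ?a) + c (r j))) \<le> e / C" by (rule r(2)[OF t])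
        moreover have "norm (u t ((x + \<psi> t ?a) + c (r j)) - u t (?b + \<psi> t ?b)) \<le> L * norm (\<psi> t ?a - \<psi> t ?b)"
          using L(2)[OF t, of "(x + \<psi> t ?a) + c (r j)" "?b + \<psi> t ?b"] by (simp add: algebra_simps)
        ultimately have "norm (u t ((x + \<psi> t ?a) + c (r i)) - u t (?b + \<psi> t ?b)) \<le> e / C + L * norm (\<psi> t ?a - \<psi> t ?b)"
          by (rule norm_diff_triangle_le)
        then show "norm (u t (?a + \<psi> t ?a) - u t (?b + \<psi> t ?b)) \<le> L * norm (\<psi> t ?a - \<psi> t ?b) + e / C"
          by (simp add: ac_simps)
      qed (use e' in auto)
      then show ?thesis using t C by (simp add: p0)
    qed
    then show "\<exists>r. strict_mono (r :: nat \<Rightarrow> nat) \<and> (\<forall>i j. \<forall>t\<in>{0..T}. \<forall>x.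
        norm (\<psi> t (x + c (r i)) - \<psi> t (x + c (r j))) \<le> e)"
      using r(1) by (intro exI[of _ r]) simp
  qed
  \<comment> \<open>Differentiating the equation in direction i gives the sum over j of
    \<open>(axis i 1 + Z i t x) $ j *\<^sub>R b j t x\<close>. The identity part of the flow thus
    contributes the source \<open>b i\<close>, so the same fields serve as coefficients and as
    sources.\<close>
  define b where "b j t x = u' j t (x + \<psi> t x)" for j t x
  have bb: "ap_base \<gamma> T (b j)" for j
    unfolding b_def by (rule ap_base_compose[OF \<gamma>(1) u'b base CL pL])
  have "\<exists>Z. (\<forall>x. Z 0 x = 0) \<and> (\<forall>t\<in>{0..T}. \<forall>x.
    ((\<lambda>t. Z t x) has_vector_derivative ((\<Sum>j\<in>UNIV. Z t x $ j *\<^sub>R b j t x) + b i t x)) (at t within {0..T}))" for i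
    by (rule ap_linear_ode_exists[where b = b, OF T bb bb])
  then have "\<forall>i. \<exists>Z. (\<forall>x. Z 0 x = 0) \<and> (\<forall>t\<in>{0..T}. \<forall>x.
    ((\<lambda>t. Z t x) has_vector_derivative ((\<Sum>j\<in>UNIV. Z t x $ j *\<^sub>R b j t x) + b i t x)) (at t within {0..T}))" ..
  from choice[OF this] obtain Z where Z: "\<forall>i. (\<forall>x. Z i 0 x = 0) \<and> (\<forall>t\<in>{0..T}. \<forall>x.
    ((\<lambda>t. Z i t x) has_vector_derivative ((\<Sum>j\<in>UNIV. Z i t x $ j *\<^sub>R b j t x) + b i t x)) (at t within {0..T}))"
    by (elim exE)
  then have Z0: "\<And>i x. Z i 0 x = 0"
    and Zd: "\<And>i t x. t \<in> {0..T} \<Longrightarrow>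
    ((\<lambda>t. Z i t x) has_vector_derivative ((\<Sum>j\<in>UNIV. Z i t x $ j *\<^sub>R b j t x) + b i t x)) (at t within {0..T})"
    by simp_all
  have der: "(\<psi> t has_derivative (\<lambda>h. \<Sum>i\<in>UNIV. h $ i *\<^sub>R Z i t x)) (at x)" if t: "t \<in> {0..T}" for t x
  proof (rule ap_ode_has_derivative[where b = b and Z = Z, OF bb pd p0 Zd Z0 _ t])
    fix e :: real assume e: "e > 0"
    \<comment> \<open>\<open>id + \<psi>\<close> stretches increments by at most
      \<open>1 + C * L\<close>; both the tolerance and the radius are reduced by this
      factor.\<close>
    define e' where "e' = e / (1 + C * L)"
    have e': "e' > 0" using e CL unfolding e'_def by simp
    obtain d where d: "d > 0" "\<And>t x h. t \<in> {0..T} \<Longrightarrow> norm h < d \<Longrightarrow>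
        norm (u t (x + h) - u t x - (\<Sum>i\<in>UNIV. h $ i *\<^sub>R u' i t x)) \<le> e' * norm h"
      using ap_taylor[where f = u, OF u'd u'b \<gamma>(1) e'] by blast
    have "norm (u t (x + h + \<psi> t (x + h)) - u t (x + \<psi> t x) - (\<Sum>j\<in>UNIV. (\<psi> t (x + h) - \<psi> t x) $ j *\<^sub>R b j t x)
        - (\<Sum>i\<in>UNIV. h $ i *\<^sub>R b i t x)) \<le> e * norm h"
      if t: "t \<in> {0..T}" and h: "norm h < d / (1 + C * L)" for t h
    proof -
      define k where "k = h + (\<psi> t (x + h) - \<psi> t x)"
      have "norm k \<le> norm h + norm (\<psi> t (x + h) - \<psi> t x)" unfolding k_def by (rule norm_triangle_ineq)
      also have "\<dots> \<le> (1 + C * L) * norm h" using pL[OF t, of "x + h" x] by (simp add: algebra_simps)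
      finally have k: "norm k \<le> (1 + C * L) * norm h" .
      also have "\<dots> < d" using h CL by (simp add: field_simps)
      finally have "norm (u t (x + \<psi> t x + k) - u t (x + \<psi> t x) - (\<Sum>i\<in>UNIV. k $ i *\<^sub>R u' i t (x + \<psi> t x))) \<le> e' * norm k"
        by (rule d(2)[OF t])
      also have "\<dots> \<le> e' * ((1 + C * L) * norm h)" using e' k by (intro mult_left_mono) auto
      also have "\<dots> = e * norm h" unfolding e'_def using CL by simp
      finally have 1: "norm (u t (x + \<psi> t x + k) - u t (x + \<psi> t x) - (\<Sum>i\<in>UNIV. k $ i *\<^sub>R u' i t (x + \<psi> t x))) \<le> e * norm h" .
      have 2: "x + \<psi> t x + k = x + h + \<psi> t (x + h)" unfolding k_def by simp
      have 3: "(\<Sum>i\<in>UNIV. k $ i *\<^sub>R u' i t (x + \<psi> t x)) =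
        (\<Sum>i\<in>UNIV. h $ i *\<^sub>R b i t x) + (\<Sum>j\<in>UNIV. (\<psi> t (x + h) - \<psi> t x) $ j *\<^sub>R b j t x)"
        unfolding k_def b_def by (simp only: vector_add_component scaleR_add_left sum.distrib)
      have 4: "p - q - r - s = p - q - (s + r)" for p q r s :: "real^'n" by simp
      show ?thesis unfolding 4 using 1 unfolding 2 3 .
    qed
    then show "\<exists>d>0. \<forall>t\<in>{0..T}. \<forall>h. norm h < d \<longrightarrow>
      norm (u t (x + h + \<psi> t (x + h)) - u t (x + \<psi> t x) - (\<Sum>j\<in>UNIV. (\<psi> t (x + h) - \<psi> t x) $ j *\<^sub>R b j t x)
        - (\<Sum>i\<in>UNIV. h $ i *\<^sub>R b i t x)) \<le> e * norm h"
      using d(1) CL by (intro exI[of _ "d / (1 + C * L)"]) simp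
  qed
  \<comment> \<open>For \<open>r \<le> k\<close>, a flow of class \<open>r\<close> makes the
    composed coefficients of class \<open>r\<close>, hence also the solutions \<open>Z i\<close>. As
    these are the derivatives of the flow, it gains one order. The same \<open>Z\<close> serves at
    every stage.\<close>
  have "ap_class \<gamma> T r \<psi>" if "r \<le> Suc k" for r
    using that
  proof (induction r)
    case 0
    then show ?case using base by simp
  next
    case (Suc r)
    then have pr: "ap_class \<gamma> T r \<psi>" and "r \<le> k" by simp_all
    have br: "ap_class \<gamma> T r (b j)" for j
      unfolding b_def by (rule ap_class_compose[OF \<gamma>(1) ap_class_mono[OF u'k \<open>r \<le> k\<close>] pr CL pL])
    show ?case
      by (rule ap_class_SucI[OF base der ap_class_linear_ode[where b = b, OF \<gamma>(1) T br br Zd Z0]])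
  qed
  then have "ap_class \<gamma> T (Suc k) \<psi>" by simp
  from that[OF p0 pd this CL pL] show ?thesis .
qed

section \<open>Interchange of time and space derivatives\<close>

lemma has_vector_derivative_uniform_limit:
  fixes f :: "nat \<Rightarrow> real \<Rightarrow> 'b::banach"
  assumes S: "convex S"
    and f: "\<And>n x. x \<in> S \<Longrightarrow> (f n has_vector_derivative f' n x) (at x within S)"
    and unif: "\<And>e. e > 0 \<Longrightarrow> \<exists>N. \<forall>n\<ge>N. \<forall>x\<in>S. norm (f' n x - g' x) \<le> e"
    and lim: "\<And>x. x \<in> S \<Longrightarrow> (\<lambda>n. f n x) \<longlonglongrightarrow> g x"
    and x: "x \<in> S"
  shows "(g has_vector_derivative g' x) (at x within S)"
proof -
  have "\<exists>h. \<forall>x\<in>S. (\<lambda>n. f n x) \<longlonglongrightarrow> h x \<and> (h has_derivative (\<lambda>r. r *\<^sub>R g' x)) (at x within S)"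
  proof (rule has_derivative_sequence[where f = f and ?x0.0 = x, OF S _ _ x lim[OF x]])
    show "(f n has_derivative (\<lambda>r. r *\<^sub>R f' n x)) (at x within S)" if "x \<in> S" for n x
      using f[OF that] by (simp add: has_vector_derivative_def)
    fix e :: real assume "e > 0"
    from unif[OF this] obtain N where N: "\<forall>n\<ge>N. \<forall>x\<in>S. norm (f' n x - g' x) \<le> e" by (elim exE)
    have "norm (r *\<^sub>R f' n x - r *\<^sub>R g' x) \<le> e * norm r" if "n \<ge> N" "x \<in> S" for n x r
    proof -
      have "norm (r *\<^sub>R f' n x - r *\<^sub>R g' x) = norm (f' n x - g' x) * \<bar>r\<bar>"
        by (simp flip: scaleR_diff_right)
      also have "\<dots> \<le> e * \<bar>r\<bar>" using N that by (intro mult_right_mono) auto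
      finally show ?thesis by simp
    qed
    then show "\<forall>\<^sub>F n in sequentially. \<forall>x\<in>S. \<forall>h. norm (h *\<^sub>R f' n x - h *\<^sub>R g' x) \<le> e * norm h"
      unfolding eventually_sequentially by (intro exI[of _ N]) simp
  qed
  then obtain h where h: "\<forall>x\<in>S. (\<lambda>n. f n x) \<longlonglongrightarrow> h x \<and> (h has_derivative (\<lambda>r. r *\<^sub>R g' x)) (at x within S)"
    by (elim exE)
  have "h y = g y" if "y \<in> S" for y using h lim that LIMSEQ_unique by blast
  moreover have "(h has_vector_derivative g' x) (at x within S)"
    using h x by (simp add: has_vector_derivative_def)
  ultimately show ?thesis using has_vector_derivative_transform[OF x, of g h] by simp
qed

text \<open>The spatial difference quotients of \<open>Y\<close> have those of \<open>v\<close> as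
  time derivatives. By the uniform first-order expansion the latter converge uniformly in time, so
  the limit may be differentiated termwise.\<close>

lemma has_vector_derivative_partial_swap:
  fixes Y v :: "real \<Rightarrow> real^'n::finite \<Rightarrow> 'b::banach"
  assumes Y: "\<And>t x. t \<in> {0..T} \<Longrightarrow> ((\<lambda>t. Y t x) has_vector_derivative v t x) (at t within {0..T})"
    and A: "\<And>t x. t \<in> {0..T} \<Longrightarrow> (Y t has_derivative (\<lambda>h. \<Sum>i\<in>UNIV. h $ i *\<^sub>R A i t x)) (at x)"
      "\<And>i. ap_base \<gamma> T (A i)"
    and B: "\<And>t x. t \<in> {0..T} \<Longrightarrow> (v t has_derivative (\<lambda>h. \<Sum>i\<in>UNIV. h $ i *\<^sub>R B i t x)) (at x)"
      "\<And>i. ap_base \<gamma> T (B i)"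
    and \<gamma>: "\<gamma> \<ge> 0" and t: "t \<in> {0..T}"
  shows "((\<lambda>t. A i t x) has_vector_derivative B i t x) (at t within {0..T})"
proof -
  define h where "h n = inverse (real (Suc n))" for n
  have h: "h n > 0" for n unfolding h_def by simp
  have hlim: "\<exists>N. \<forall>n\<ge>N. h n < d" if "d > 0" for d
    using LIMSEQ_inverse_real_of_nat[THEN LIMSEQ_D, OF that] h unfolding h_def by auto
  have ax: "(\<Sum>j\<in>UNIV. (r *\<^sub>R axis i 1 :: real^'n) $ j *\<^sub>R a j) = r *\<^sub>R a i" for r and a :: "'n \<Rightarrow> 'b"
    by (simp add: axis_def if_distrib if_distribR cong: if_cong)
  have quot: "\<exists>N. \<forall>n\<ge>N. \<forall>t\<in>{0..T}. norm ((f t (x + h n *\<^sub>R axis i 1) - f t x) /\<^sub>R h n - g i t x) \<le> e"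
    if f: "\<And>t x. t \<in> {0..T} \<Longrightarrow> (f t has_derivative (\<lambda>h. \<Sum>i\<in>UNIV. h $ i *\<^sub>R g i t x)) (at x)"
      and g: "\<And>i. ap_base \<gamma> T (g i)" and e: "e > 0"
    for f :: "real \<Rightarrow> real^'n \<Rightarrow> 'b" and g and e :: real
  proof -
    obtain d where d: "d > 0" "\<And>t x h. t \<in> {0..T} \<Longrightarrow> norm h < d \<Longrightarrow>
        norm (f t (x + h) - f t x - (\<Sum>i\<in>UNIV. h $ i *\<^sub>R g i t x)) \<le> e * norm h"
      using ap_taylor[where f = f, OF f g \<gamma> e] by blast
    from hlim[OF d(1)] obtain N where N: "\<forall>n\<ge>N. h n < d" by (elim exE)
    have "norm ((f t (x + h n *\<^sub>R axis i 1) - f t x) /\<^sub>R h n - g i t x) \<le> e" if "n \<ge> N" "t \<in> {0..T}" for n t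
    proof -
      have nh: "norm (h n *\<^sub>R axis i 1 :: real^'n) = h n" using h[of n] by (simp add: norm_axis_1)
      have "norm (f t (x + h n *\<^sub>R axis i 1) - f t x - h n *\<^sub>R g i t x) \<le> e * h n"
        using d(2)[OF that(2), of "h n *\<^sub>R axis i 1" x] N that(1) unfolding nh ax by simp
      moreover have "(f t (x + h n *\<^sub>R axis i 1) - f t x) /\<^sub>R h n - g i t x =
        (f t (x + h n *\<^sub>R axis i 1) - f t x - h n *\<^sub>R g i t x) /\<^sub>R h n"
        using h[of n] by (simp add: scaleR_diff_right)
      moreover have "norm (z /\<^sub>R h n) \<le> e" if "norm z \<le> e * h n" for z :: 'b
      proof -
        have "norm (z /\<^sub>R h n) = norm z / h n" using h[of n] by (simp add: divide_inverse mult.commute)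
        then show ?thesis using that h[of n] by (simp add: pos_divide_le_eq)
      qed
      ultimately show ?thesis by simp
    qed
    then show ?thesis by (intro exI[of _ N]) simp
  qed
  show ?thesis
  proof (rule has_vector_derivative_uniform_limit[where S = "{0..T}" and
      f = "\<lambda>n t. (Y t (x + h n *\<^sub>R axis i 1) - Y t x) /\<^sub>R h n" and
      f' = "\<lambda>n t. (v t (x + h n *\<^sub>R axis i 1) - v t x) /\<^sub>R h n"])
    show "((\<lambda>t. (Y t (x + h n *\<^sub>R axis i 1) - Y t x) /\<^sub>R h n) has_vector_derivative
      (v t (x + h n *\<^sub>R axis i 1) - v t x) /\<^sub>R h n) (at t within {0..T})" if "t \<in> {0..T}" for n t
      by (rule bounded_linear.has_vector_derivative[OF bounded_linear_scaleR_right
            has_vector_derivative_diff[OF Y[OF that] Y[OF that]]])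
    show "\<exists>N. \<forall>n\<ge>N. \<forall>t\<in>{0..T}. norm ((v t (x + h n *\<^sub>R axis i 1) - v t x) /\<^sub>R h n - B i t x) \<le> e"
      if "e > 0" for e by (rule quot[where f = v and g = B, OF B that])
    show "(\<lambda>n. (Y s (x + h n *\<^sub>R axis i 1) - Y s x) /\<^sub>R h n) \<longlonglongrightarrow> A i s x" if s: "s \<in> {0..T}" for s
    proof (rule LIMSEQ_I)
      fix e :: real assume "e > 0"
      then have "e / 2 > 0" by simp
      have "\<exists>N. \<forall>n\<ge>N. \<forall>t\<in>{0..T}. norm ((Y t (x + h n *\<^sub>R axis i 1) - Y t x) /\<^sub>R h n - A i t x) \<le> e / 2"
        by (rule quot[where f = Y and g = A, OF A \<open>e / 2 > 0\<close>])
      then obtain N where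
        N: "\<forall>n\<ge>N. \<forall>t\<in>{0..T}. norm ((Y t (x + h n *\<^sub>R axis i 1) - Y t x) /\<^sub>R h n - A i t x) \<le> e / 2"
        by (elim exE)
      have "norm ((Y s (x + h n *\<^sub>R axis i 1) - Y s x) /\<^sub>R h n - A i s x) < e" if "n \<ge> N" for n
        using N[rule_format, OF that s] \<open>e > 0\<close> by simp
      then show "\<exists>N. \<forall>n\<ge>N. norm ((Y s (x + h n *\<^sub>R axis i 1) - Y s x) /\<^sub>R h n - A i s x) < e"
        by (intro exI[of _ N]) simp
    qed
  qed (use t in simp_all)
qed

section \<open>The spaces C^m_b and their norm\<close>

lemma finite_common_bound:
  fixes P :: "'i \<Rightarrow> real \<Rightarrow> bool"
  assumes "finite I" "\<And>i. i \<in> I \<Longrightarrow> \<exists>M. P i M" and mono: "\<forall>i M M'. P i M \<longrightarrow> M \<le> M' \<longrightarrow> P i M'"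
  shows "\<exists>M\<ge>0. \<forall>i\<in>I. P i M"
  using assms(1,2)
proof (induction I rule: finite_induct)
  case (insert i I)
  obtain d where d: "d \<ge> 0" "\<forall>i\<in>I. P i d" using insert.IH insert.prems by auto
  obtain d' where d': "P i d'" using insert.prems by auto
  have "\<forall>j\<in>insert i I. P j (max d d')"
    using d d' mono by (metis insert_iff max.cobounded1 max.cobounded2)
  then show ?case using d by (intro exI[of _ "max d d'"]) simp
qed auto

lemma finite_multi_indices: "finite {is :: 'n::finite list. length is \<le> k}"
  using finite_lists_length_le[of "UNIV :: 'n set" k] by simp

lemma holder_frac_bounds: "0 \<le> holder_frac m" "holder_frac m < 1"
  unfolding holder_frac_def by linarith+

lemma has_vector_derivative_along_axis:
  fixes f :: "real^'n::finite \<Rightarrow> 'b::real_normed_vector"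
  assumes "(f has_derivative f') (at x)"
  shows "((\<lambda>t. f (x + t *\<^sub>R axis i 1)) has_vector_derivative f' (axis i 1)) (at 0)"
proof -
  have "((\<lambda>t. x + t *\<^sub>R axis i 1 :: real^'n) has_derivative (\<lambda>t. t *\<^sub>R axis i 1)) (at 0)"
    by (auto intro!: derivative_eq_intros)
  from has_derivative_compose[OF this, of f f'] assms
  have "((\<lambda>t. f (x + t *\<^sub>R axis i 1)) has_derivative (\<lambda>t. f' (t *\<^sub>R axis i 1))) (at 0)" by simp
  moreover have "f' (t *\<^sub>R axis i 1) = t *\<^sub>R f' (axis i 1)" for t
    using has_derivative_linear[OF assms] by (rule linear_scale)
  ultimately show ?thesis by (simp add: has_vector_derivative_def)
qed

lemma sum_axis_scaleR:
  fixes a :: "'n::finite \<Rightarrow> 'b::real_vector"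
  shows "(\<Sum>j\<in>UNIV. (axis i 1 :: real^'n) $ j *\<^sub>R a j) = a i"
proof -
  have "(axis i 1 :: real^'n) $ j *\<^sub>R a j = (if j = i then a j else 0)" for j by (simp add: axis_def)
  then show ?thesis by simp
qed

lemma partial_dir_has_derivative:
  fixes f :: "real^'n::finite \<Rightarrow> real^'m::finite"
  assumes "(f has_derivative (\<lambda>h. \<Sum>j\<in>UNIV. h $ j *\<^sub>R g j)) (at x)"
  shows "((\<lambda>t. f (x + t *\<^sub>R axis i 1)) has_vector_derivative g i) (at 0)"
    and "partial_dir i f x = g i"
proof -
  show "((\<lambda>t. f (x + t *\<^sub>R axis i 1)) has_vector_derivative g i) (at 0)"
    using has_vector_derivative_along_axis[OF assms, of i] by (simp only: sum_axis_scaleR)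
  then show "partial_dir i f x = g i" unfolding partial_dir_def by (rule vector_derivative_at)
qed

text \<open>\<open>Cmb\<close> speaks of partial derivatives only, so the total derivative is
  recovered classically: the increment is built up one coordinate at a time, and each move is
  compared with the partial derivative at \<open>x\<close> by the mean value inequality.\<close>

lemma has_derivative_continuous_partials:
  fixes f :: "real^'n::finite \<Rightarrow> 'b::real_normed_vector"
  assumes f: "\<And>i x. ((\<lambda>t. f (x + t *\<^sub>R axis i 1)) has_vector_derivative g i x) (at 0)"
    and g: "\<And>i. continuous_on UNIV (g i)"
  shows "(f has_derivative (\<lambda>h. \<Sum>i\<in>UNIV. h $ i *\<^sub>R g i x)) (at x)"
  unfolding has_derivative_at_alt
proof (intro conjI allI impI)
  show "bounded_linear (\<lambda>h. \<Sum>i\<in>UNIV. h $ i *\<^sub>R g i x)"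
    by (intro bounded_linear_sum bounded_linear_compose[OF bounded_linear_scaleR_left bounded_linear_vec_nth])
  fix e :: real assume e: "e > 0"
  define n where "n = real CARD('n)"
  have n: "n > 0" unfolding n_def by simp
  have en: "e / n > 0" using e n by simp
  define P where "P i d \<longleftrightarrow> (\<forall>y. norm (y - x) < d \<longrightarrow> norm (g i y - g i x) \<le> e / n)" for i d
  have "\<exists>d>0. \<forall>i\<in>UNIV. P i d"
  proof (rule finite_common_radius)
    fix i
    from g[of i, unfolded continuous_on_iff, rule_format, OF UNIV_I en, of x]
    obtain d where d: "d > 0" "\<forall>y\<in>UNIV. dist y x < d \<longrightarrow> dist (g i y) (g i x) < e / n" by (elim exE conjE)
    then show "\<exists>d>0. P i d" unfolding P_def by (intro exI[of _ d]) (simp add: dist_norm less_imp_le)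
  qed (auto simp: P_def)
  then obtain d where d: "d > 0" "\<And>i y. norm (y - x) < d \<Longrightarrow> norm (g i y - g i x) \<le> e / n"
    unfolding P_def by blast
  have seg: "norm (f (y + s *\<^sub>R axis i 1) - f y - s *\<^sub>R g i x) \<le> e / n * \<bar>s\<bar>"
    if near: "\<And>r. \<bar>r\<bar> \<le> \<bar>s\<bar> \<Longrightarrow> norm (y + r *\<^sub>R axis i 1 - x) < d" for y i and s :: real
  proof -
    define q where "q r = f (y + r *\<^sub>R axis i 1) - r *\<^sub>R g i x" for r :: real
    have "norm (q s - q 0) \<le> e / n * norm (s - 0)"
    proof (rule differentiable_bound[where S = "closed_segment 0 s" and
          f' = "\<lambda>r h. h *\<^sub>R (g i (y + r *\<^sub>R axis i 1) - g i x)"])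
      fix r assume "r \<in> closed_segment 0 s"
      then have r: "\<bar>r\<bar> \<le> \<bar>s\<bar>" by (auto simp: closed_segment_eq_real_ivl split: if_splits)
      have "((\<lambda>t. f ((y + r *\<^sub>R axis i 1) + t *\<^sub>R axis i 1)) has_vector_derivative g i (y + r *\<^sub>R axis i 1)) (at (r - r))"
        using f by simp
      moreover have "((\<lambda>t. t - r) has_vector_derivative 1) (at r)" by (auto intro!: derivative_eq_intros)
      ultimately have "((\<lambda>t. f ((y + r *\<^sub>R axis i 1) + (t - r) *\<^sub>R axis i 1)) has_vector_derivative g i (y + r *\<^sub>R axis i 1)) (at r)"
        using vector_diff_chain_at[of "\<lambda>t. t - r" 1 r] by (simp add: o_def)
      then have "((\<lambda>t. f (y + t *\<^sub>R axis i 1)) has_vector_derivative g i (y + r *\<^sub>R axis i 1)) (at r)"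
        by (simp add: algebra_simps)
      then have "(q has_vector_derivative g i (y + r *\<^sub>R axis i 1) - g i x) (at r)"
        unfolding q_def by (auto intro!: derivative_eq_intros)
      then show "(q has_derivative (\<lambda>h. h *\<^sub>R (g i (y + r *\<^sub>R axis i 1) - g i x))) (at r within closed_segment 0 s)"
        unfolding has_vector_derivative_def by (rule has_derivative_at_withinI)
      have le: "norm (g i (y + r *\<^sub>R axis i 1) - g i x) \<le> e / n" by (rule d(2)[OF near[OF r]])
      show "onorm (\<lambda>h. h *\<^sub>R (g i (y + r *\<^sub>R axis i 1) - g i x)) \<le> e / n"
      proof (intro onorm_le)
        fix h :: real
        from mult_left_mono[OF le abs_ge_zero[of h]]
        show "norm (h *\<^sub>R (g i (y + r *\<^sub>R axis i 1) - g i x)) \<le> e / n * norm h"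
          by (simp add: mult.commute)
      qed
    qed auto
    then show ?thesis by (simp add: q_def algebra_simps)
  qed
  \<comment> \<open>Induction over the set of coordinates that have already moved. Each adds one
    share \<open>e / n * norm h\<close>, so the full set gives \<open>e * norm h\<close>.\<close>
  have main: "norm (f (x + h) - f x - (\<Sum>i\<in>S. h $ i *\<^sub>R g i x)) \<le> real (card S) * (e / n * norm h)"
    if "finite S" "\<forall>i. i \<notin> S \<longrightarrow> h $ i = 0" "norm h < d" for S h
    using that
  proof (induction S arbitrary: h rule: finite_induct)
    case empty
    then have "h = 0" by (simp add: vec_eq_iff)
    then show ?case by simp
  next
    case (insert j S)
    define h' where "h' = h - h $ j *\<^sub>R axis j 1"
    have h'i: "h' $ i = (if i = j then 0 else h $ i)" for i unfolding h'_def by (auto simp: axis_def)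
    \<comment> \<open>All intermediate points stay in the ball of radius \<open>d\<close>, since the
      partial increments are componentwise no larger than \<open>h\<close>.\<close>
    have le: "norm (h' + r *\<^sub>R axis j 1) \<le> norm h" if "\<bar>r\<bar> \<le> \<bar>h $ j\<bar>" for r
      by (rule norm_le_componentwise_cart) (use that in \<open>auto simp: h'i axis_def\<close>)
    have h': "norm h' \<le> norm h" using le[of 0] by simp
    have IH: "norm (f (x + h') - f x - (\<Sum>i\<in>S. h' $ i *\<^sub>R g i x)) \<le> real (card S) * (e / n * norm h')"
      by (rule insert.IH) (use insert.prems insert.hyps h' in \<open>auto simp: h'i\<close>)
    also have "\<dots> \<le> real (card S) * (e / n * norm h)" using h' en by (intro mult_left_mono) auto
    finally have 1: "norm (f (x + h') - f x - (\<Sum>i\<in>S. h' $ i *\<^sub>R g i x)) \<le> real (card S) * (e / n * norm h)" .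
    have "norm (f (x + h' + h $ j *\<^sub>R axis j 1) - f (x + h') - h $ j *\<^sub>R g j x) \<le> e / n * \<bar>h $ j\<bar>"
    proof (rule seg)
      fix r :: real assume "\<bar>r\<bar> \<le> \<bar>h $ j\<bar>"
      then show "norm (x + h' + r *\<^sub>R axis j 1 - x) < d" using le[of r] insert.prems(2) by (simp add: algebra_simps)
    qed
    also have "\<dots> \<le> e / n * norm h" using en by (intro mult_left_mono component_le_norm_cart) auto
    finally have 2: "norm (f (x + h) - f (x + h') - h $ j *\<^sub>R g j x) \<le> e / n * norm h"
      by (simp add: h'_def)
    have S: "(\<Sum>i\<in>insert j S. h $ i *\<^sub>R g i x) = h $ j *\<^sub>R g j x + (\<Sum>i\<in>S. h' $ i *\<^sub>R g i x)"
    proof -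
      have "(\<Sum>i\<in>S. h $ i *\<^sub>R g i x) = (\<Sum>i\<in>S. h' $ i *\<^sub>R g i x)"
        using insert.hyps by (intro sum.cong) (auto simp: h'i)
      then show ?thesis using insert.hyps by simp
    qed
    have "f (x + h) - f x - (\<Sum>i\<in>insert j S. h $ i *\<^sub>R g i x) =
      (f (x + h') - f x - (\<Sum>i\<in>S. h' $ i *\<^sub>R g i x)) + (f (x + h) - f (x + h') - h $ j *\<^sub>R g j x)"
      unfolding S by simp
    also have "norm \<dots> \<le> real (card S) * (e / n * norm h) + e / n * norm h"
      by (intro norm_triangle_le add_mono 1 2)
    also have "\<dots> = real (card (insert j S)) * (e / n * norm h)"
      using insert.hyps by (simp add: distrib_right add_divide_distrib)
    finally show ?case .
  qed
  have "norm (f y - f x - (\<Sum>i\<in>UNIV. (y - x) $ i *\<^sub>R g i x)) \<le> e * norm (y - x)" if "norm (y - x) < d" for y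
    using main[OF finite, of UNIV "y - x"] that n by (simp add: n_def)
  then show "\<exists>d>0. \<forall>y. norm (y - x) < d \<longrightarrow>
    norm (f y - f x - (\<Sum>i\<in>UNIV. (y - x) $ i *\<^sub>R g i x)) \<le> e * norm (y - x)"
    using d(1) by (intro exI[of _ d]) simp
qed

section \<open>Calculus of C^m_b and estimates for its norm\<close>

lemma Cmb_differentiable:
  fixes f :: "real^'n::finite \<Rightarrow> real^'m::finite"
  assumes "Cmb m f" "length is < holder_int m"
  shows "((\<lambda>t. dpart is f (x + t *\<^sub>R axis i 1)) has_vector_derivative dpart (i # is) f x) (at 0)"
  using assms unfolding Cmb_def by (simp add: partial_dir_def vector_derivative_works)

lemma Cmb_continuous: "Cmb m f \<Longrightarrow> length is \<le> holder_int m \<Longrightarrow> continuous_on UNIV (dpart is f)"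
  and Cmb_bounded: "Cmb m f \<Longrightarrow> length is \<le> holder_int m \<Longrightarrow> bounded (range (dpart is f))"
  unfolding Cmb_def by simp_all

lemma Cmb_has_derivative:
  fixes f :: "real^'n::finite \<Rightarrow> real^'m::finite"
  assumes "Cmb m f" "length is < holder_int m"
  shows "(dpart is f has_derivative (\<lambda>h. \<Sum>i\<in>UNIV. h $ i *\<^sub>R dpart (i # is) f x)) (at x)"
  by (rule has_derivative_continuous_partials[OF Cmb_differentiable[OF assms] Cmb_continuous[OF assms(1)]])
    (use assms(2) in simp)

lemma Cmb_bound:
  fixes f :: "real^'n::finite \<Rightarrow> real^'m::finite"
  assumes "Cmb m f"
  shows "\<exists>M\<ge>0. \<forall>is. length is \<le> holder_int m \<longrightarrow> (\<forall>x. norm (dpart is f x) \<le> M)"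
proof -
  have "\<exists>M\<ge>0. \<forall>is\<in>{is. length is \<le> holder_int m}. \<forall>x. norm (dpart is f x) \<le> M"
  proof (rule finite_common_bound[OF finite_multi_indices])
    fix "is" :: "'n list" assume "is \<in> {is. length is \<le> holder_int m}"
    then show "\<exists>M. \<forall>x. norm (dpart is f x) \<le> M"
      using Cmb_bounded[OF assms, of "is"] by (simp add: bounded_iff)
  qed (meson order_trans)
  then show ?thesis by simp
qed

text \<open>For exponent 0 the power equals 1 at distinct points and twice the sup bound serves as
  constant, so later arguments need no distinction between integer and fractional
  \<open>m\<close>.\<close>

lemma Cmb_holder:
  fixes f :: "real^'n::finite \<Rightarrow> real^'m::finite"
  assumes "Cmb m f"
  shows "\<exists>C\<ge>0. \<forall>is x y. length is = holder_int m \<longrightarrow> x \<noteq> y \<longrightarrow>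
    norm (dpart is f x - dpart is f y) \<le> C * norm (x - y) powr holder_frac m"
proof (cases "holder_frac m > 0")
  case True
  then have "bdd_above {norm (dpart is f x - dpart is f y) / norm (x - y) powr holder_frac m
                   | is x y. length is = holder_int m \<and> x \<noteq> y}"
    using assms unfolding Cmb_def by simp
  then obtain C where C: "\<And>is x y. length is = holder_int m \<Longrightarrow> x \<noteq> y \<Longrightarrow>
      norm (dpart is f x - dpart is f y) / norm (x - y) powr holder_frac m \<le> C"
    unfolding bdd_above_def by blast
  have "norm (dpart is f x - dpart is f y) \<le> max C 0 * norm (x - y) powr holder_frac m"
    if "length is = holder_int m" "x \<noteq> y" for "is" x y
  proof -
    have "norm (x - y) powr holder_frac m > 0" using that by simp
    then have "norm (dpart is f x - dpart is f y) \<le> C * norm (x - y) powr holder_frac m"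
      using C[OF that] by (simp add: pos_divide_le_eq)
    also have "\<dots> \<le> max C 0 * norm (x - y) powr holder_frac m" by (intro mult_right_mono) auto
    finally show ?thesis .
  qed
  then show ?thesis by (intro exI[of _ "max C 0"]) simp
next
  case False
  then have 0: "holder_frac m = 0" using holder_frac_bounds(1)[of m] by simp
  obtain M where M: "M \<ge> 0" "\<And>is x. length is \<le> holder_int m \<Longrightarrow> norm (dpart is f x) \<le> M"
    using Cmb_bound[OF assms] by auto
  have "norm (dpart is f x - dpart is f y) \<le> 2 * M" if "length is = holder_int m" for "is" x y
    using norm_triangle_ineq4[of "dpart is f x" "dpart is f y"] M(2)[of "is" x] M(2)[of "is" y] that by simp
  then show ?thesis using M(1) 0 by (intro exI[of _ "2 * M"]) simp
qed

lemma CmbI: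
  fixes f :: "real^'n::finite \<Rightarrow> real^'m::finite"
  assumes "\<And>is i x. length is < holder_int m \<Longrightarrow> (\<lambda>t. dpart is f (x + t *\<^sub>R axis i 1)) differentiable (at 0)"
    and "\<And>is. length is \<le> holder_int m \<Longrightarrow> continuous_on UNIV (dpart is f)"
    and "\<And>is x. length is \<le> holder_int m \<Longrightarrow> norm (dpart is f x) \<le> M"
    and C: "\<And>is x y. length is = holder_int m \<Longrightarrow> x \<noteq> y \<Longrightarrow>
      norm (dpart is f x - dpart is f y) \<le> C * norm (x - y) powr holder_frac m"
  shows "Cmb m f"
  unfolding Cmb_def
proof (intro conjI allI impI)
  show "bounded (range (dpart is f))" if "length is \<le> holder_int m" for "is"
    using assms(3)[OF that] by (auto simp: bounded_iff)
  show "bdd_above {norm (dpart is f x - dpart is f y) / norm (x - y) powr holder_frac m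
                   | is x y. length is = holder_int m \<and> x \<noteq> y}"
  proof (rule bdd_aboveI[of _ C])
    fix z assume "z \<in> {norm (dpart is f x - dpart is f y) / norm (x - y) powr holder_frac m
                   | is x y. length is = holder_int m \<and> x \<noteq> y}"
    then obtain "is" x y where z: "z = norm (dpart is f x - dpart is f y) / norm (x - y) powr holder_frac m"
      "length is = holder_int m" "x \<noteq> y" by blast
    have "norm (x - y) powr holder_frac m > 0" using z by simp
    then show "z \<le> C" using C[OF z(2,3)] by (simp add: z(1) pos_divide_le_eq)
  qed
qed (use assms in simp_all)

text \<open>\<open>vector_derivative\<close> has an arbitrary value where no derivative exists, so
  linearity of \<open>dpart\<close> is claimed only up to the order that \<open>Cmb\<close>
  guarantees, and is proved along with differentiability.\<close>

lemma Cmb_lincomb: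
  fixes f g :: "real^'n::finite \<Rightarrow> real^'m::finite"
  assumes f: "Cmb m f" and g: "Cmb m g"
  shows dpart_lincomb: "length is \<le> holder_int m \<Longrightarrow>
      dpart is (\<lambda>x. a *\<^sub>R f x + b *\<^sub>R g x) = (\<lambda>x. a *\<^sub>R dpart is f x + b *\<^sub>R dpart is g x)"
    and "Cmb m (\<lambda>x. a *\<^sub>R f x + b *\<^sub>R g x)"
proof -
  have der: "((\<lambda>t. a *\<^sub>R dpart is f (x + t *\<^sub>R axis i 1) + b *\<^sub>R dpart is g (x + t *\<^sub>R axis i 1))
      has_vector_derivative (a *\<^sub>R dpart (i # is) f x + b *\<^sub>R dpart (i # is) g x)) (at 0)"
    if "length is < holder_int m" for "is" i x
    by (intro has_vector_derivative_add bounded_linear.has_vector_derivative[OF bounded_linear_scaleR_right]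
        Cmb_differentiable[OF f that] Cmb_differentiable[OF g that])
  have eq: "dpart is (\<lambda>x. a *\<^sub>R f x + b *\<^sub>R g x) = (\<lambda>x. a *\<^sub>R dpart is f x + b *\<^sub>R dpart is g x)"
    if "length is \<le> holder_int m" for "is"
    using that
  proof (induction "is")
    case (Cons i "is")
    then have IH: "dpart is (\<lambda>x. a *\<^sub>R f x + b *\<^sub>R g x) = (\<lambda>x. a *\<^sub>R dpart is f x + b *\<^sub>R dpart is g x)"
      and l: "length is < holder_int m" by simp_all
    show ?case
    proof
      fix x
      have "dpart (i # is) (\<lambda>x. a *\<^sub>R f x + b *\<^sub>R g x) x = partial_dir i (\<lambda>x. a *\<^sub>R dpart is f x + b *\<^sub>R dpart is g x) x"
        by (simp only: dpart.simps IH)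
      also have "\<dots> = a *\<^sub>R dpart (i # is) f x + b *\<^sub>R dpart (i # is) g x"
        unfolding partial_dir_def by (rule vector_derivative_at[OF der[OF l]])
      finally show "dpart (i # is) (\<lambda>x. a *\<^sub>R f x + b *\<^sub>R g x) x = a *\<^sub>R dpart (i # is) f x + b *\<^sub>R dpart (i # is) g x" .
    qed
  qed simp
  show "length is \<le> holder_int m \<Longrightarrow>
      dpart is (\<lambda>x. a *\<^sub>R f x + b *\<^sub>R g x) = (\<lambda>x. a *\<^sub>R dpart is f x + b *\<^sub>R dpart is g x)"
    by (rule eq)
  obtain M where M: "M \<ge> 0" "\<And>is x. length is \<le> holder_int m \<Longrightarrow> norm (dpart is f x) \<le> M"
    using Cmb_bound[OF f] by auto
  obtain N where N: "N \<ge> 0" "\<And>is x. length is \<le> holder_int m \<Longrightarrow> norm (dpart is g x) \<le> N"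
    using Cmb_bound[OF g] by auto
  obtain C where C: "C \<ge> 0" "\<And>is x y. length is = holder_int m \<Longrightarrow> x \<noteq> y \<Longrightarrow>
    norm (dpart is f x - dpart is f y) \<le> C * norm (x - y) powr holder_frac m"
    using Cmb_holder[OF f] by auto
  obtain D where D: "D \<ge> 0" "\<And>is x y. length is = holder_int m \<Longrightarrow> x \<noteq> y \<Longrightarrow>
    norm (dpart is g x - dpart is g y) \<le> D * norm (x - y) powr holder_frac m"
    using Cmb_holder[OF g] by auto
  have lin: "norm (a *\<^sub>R p + b *\<^sub>R q) \<le> \<bar>a\<bar> * P + \<bar>b\<bar> * Q" if "norm p \<le> P" "norm q \<le> Q" for p q :: "real^'m" and P Q
    by (rule norm_triangle_le) (use that in \<open>simp add: add_mono mult_left_mono\<close>)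
  show "Cmb m (\<lambda>x. a *\<^sub>R f x + b *\<^sub>R g x)"
  proof (rule CmbI[where M = "\<bar>a\<bar> * M + \<bar>b\<bar> * N" and C = "\<bar>a\<bar> * C + \<bar>b\<bar> * D"])
    show "(\<lambda>t. dpart is (\<lambda>x. a *\<^sub>R f x + b *\<^sub>R g x) (x + t *\<^sub>R axis i 1)) differentiable at 0"
      if "length is < holder_int m" for "is" i x
      using differentiableI_vector[OF der[OF that, of x i]] eq[of "is"] that by simp
    show "continuous_on UNIV (dpart is (\<lambda>x. a *\<^sub>R f x + b *\<^sub>R g x))" if "length is \<le> holder_int m" for "is"
      unfolding eq[OF that] by (intro continuous_intros Cmb_continuous[OF f that] Cmb_continuous[OF g that])
    show "norm (dpart is (\<lambda>x. a *\<^sub>R f x + b *\<^sub>R g x) x) \<le> \<bar>a\<bar> * M + \<bar>b\<bar> * N" if "length is \<le> holder_int m" for "is" x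
      unfolding eq[OF that] by (intro lin M N that)
    fix "is" :: "'n list" and x y :: "real^'n" assume l: "length is = holder_int m" and xy: "x \<noteq> y"
    have "a *\<^sub>R dpart is f x + b *\<^sub>R dpart is g x - (a *\<^sub>R dpart is f y + b *\<^sub>R dpart is g y) =
      a *\<^sub>R (dpart is f x - dpart is f y) + b *\<^sub>R (dpart is g x - dpart is g y)"
      by (simp add: scaleR_diff_right)
    then show "norm (dpart is (\<lambda>x. a *\<^sub>R f x + b *\<^sub>R g x) x - dpart is (\<lambda>x. a *\<^sub>R f x + b *\<^sub>R g x) y)
      \<le> (\<bar>a\<bar> * C + \<bar>b\<bar> * D) * norm (x - y) powr holder_frac m"
      using lin[OF C(2)[OF l xy] D(2)[OF l xy]] eq[of "is"] l by (simp add: algebra_simps)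
  qed
qed

lemma Cmb_diff:
  fixes f g :: "real^'n::finite \<Rightarrow> real^'m::finite"
  assumes "Cmb m f" "Cmb m g"
  shows dpart_diff: "length is \<le> holder_int m \<Longrightarrow>
      dpart is (\<lambda>x. f x - g x) = (\<lambda>x. dpart is f x - dpart is g x)"
    and "Cmb m (\<lambda>x. f x - g x)"
  using dpart_lincomb[OF assms, of "is" 1 "-1"] Cmb_lincomb(2)[OF assms, of 1 "-1"] by simp_all

text \<open>Valid for arbitrary \<open>f\<close>: both sides take the derivative of literally the
  same curve, whether or not it exists.\<close>

lemma dpart_translate: "dpart is (\<lambda>x. f (x + c)) x = dpart is f (x + c)"
proof (induction "is" arbitrary: x)
  case (Cons i "is")
  then have "dpart is (\<lambda>x. f (x + c)) = (\<lambda>x. dpart is f (x + c))" by (intro ext)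
  then show ?case by (simp add: partial_dir_def add.assoc add.commute[of c])
qed simp

lemma Cmb_translate:
  fixes f :: "real^'n::finite \<Rightarrow> real^'m::finite"
  assumes "Cmb m f"
  shows "Cmb m (\<lambda>x. f (x + c))"
proof -
  have eq: "dpart is (\<lambda>x. f (x + c)) = (\<lambda>x. dpart is f (x + c))" for "is" by (intro ext dpart_translate)
  obtain M where M: "M \<ge> 0" "\<And>is x. length is \<le> holder_int m \<Longrightarrow> norm (dpart is f x) \<le> M"
    using Cmb_bound[OF assms] by auto
  obtain C where C: "C \<ge> 0" "\<And>is x y. length is = holder_int m \<Longrightarrow> x \<noteq> y \<Longrightarrow>
    norm (dpart is f x - dpart is f y) \<le> C * norm (x - y) powr holder_frac m"
    using Cmb_holder[OF assms] by auto
  show ?thesis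
  proof (rule CmbI[where M = M and C = C])
    show "(\<lambda>t. dpart is (\<lambda>x. f (x + c)) (x + t *\<^sub>R axis i 1)) differentiable at 0"
      if "length is < holder_int m" for "is" i x
      using differentiableI_vector[OF Cmb_differentiable[OF assms that, where x = "x + c" and i = i]]
      unfolding eq by (simp add: add.assoc add.commute[of c])
    show "continuous_on UNIV (dpart is (\<lambda>x. f (x + c)))" if "length is \<le> holder_int m" for "is"
      unfolding eq
      by (rule continuous_on_compose2[OF Cmb_continuous[OF assms that]]) (auto intro!: continuous_intros)
    show "norm (dpart is (\<lambda>x. f (x + c)) x) \<le> M" if "length is \<le> holder_int m" for "is" x
      unfolding eq by (rule M(2)[OF that])
    show "norm (dpart is (\<lambda>x. f (x + c)) x - dpart is (\<lambda>x. f (x + c)) y) \<le> C * norm (x - y) powr holder_frac m"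
      if "length is = holder_int m" "x \<noteq> y" for "is" x y
      unfolding eq using C(2)[OF that(1), of "x + c" "y + c"] that(2) by simp
  qed
qed

text \<open>Ensures that the set of Hoelder quotients is nonempty, so that its \<open>Sup\<close> is
  meaningful.\<close>

lemma ex_distinct_points: "\<exists>x y :: real^'n::finite. x \<noteq> y"
  using zero_neq_one by blast

text \<open>The factor 2 covers exponent 0: there \<open>cm_norm\<close> has no seminorm part, and a
  difference of two values is at most twice the sup norm.\<close>

lemma cm_norm_bounds:
  fixes f :: "real^'n::finite \<Rightarrow> real^'m::finite"
  assumes f: "Cmb m f"
  shows norm_dpart_le_cm_norm: "length is \<le> holder_int m \<Longrightarrow> norm (dpart is f x) \<le> cm_norm m f"
    and holder_le_cm_norm: "length is = holder_int m \<Longrightarrow> x \<noteq> y \<Longrightarrow>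
      norm (dpart is f x - dpart is f y) \<le> 2 * cm_norm m f * norm (x - y) powr holder_frac m"
proof -
  let ?A = "{norm (dpart is f x) | is x. length is \<le> holder_int m}"
  let ?H = "{norm (dpart is f x - dpart is f y) / norm (x - y) powr holder_frac m
                   | is x y. length is = holder_int m \<and> x \<noteq> y}"
  obtain M where M: "\<And>is x. length is \<le> holder_int m \<Longrightarrow> norm (dpart is f x) \<le> M"
    using Cmb_bound[OF f] by auto
  have bA: "bdd_above ?A" by (rule bdd_aboveI[of _ M]) (use M in auto)
  have A: "norm (dpart is f x) \<le> Sup ?A" if "length is \<le> holder_int m" for "is" x
    by (rule cSup_upper[OF _ bA]) (use that in blast)
  have A0: "0 \<le> Sup ?A" using A[of "[]" 0] norm_ge_zero[of "dpart [] f 0"] by (simp del: norm_ge_zero)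
  have H: "norm (dpart is f x - dpart is f y) / norm (x - y) powr holder_frac m \<le> Sup ?H"
    if "length is = holder_int m" "x \<noteq> y" "holder_frac m > 0" for "is" x y
  proof (rule cSup_upper)
    show "bdd_above ?H" using f that(3) unfolding Cmb_def by simp
  qed (use that in blast)
  have H0: "0 \<le> Sup ?H" if "holder_frac m > 0"
  proof -
    obtain x y :: "real^'n" where "x \<noteq> y" using ex_distinct_points by blast
    \<comment> \<open>Any multi-index of the top order will do; an arbitrary direction is
      repeated.\<close>
    from H[of "replicate (holder_int m) undefined", OF _ this that]
    have "norm (dpart (replicate (holder_int m) undefined) f x - dpart (replicate (holder_int m) undefined) f y)
        / norm (x - y) powr holder_frac m \<le> Sup ?H" by simp
    then show ?thesis by (rule order_trans[rotated]) simp
  qed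
  have AN: "Sup ?A \<le> cm_norm m f" unfolding cm_norm_def using H0 by simp
  show 1: "norm (dpart is f x) \<le> cm_norm m f" if "length is \<le> holder_int m" for "is" x
    using A[OF that, of x] AN by linarith
  show "norm (dpart is f x - dpart is f y) \<le> 2 * cm_norm m f * norm (x - y) powr holder_frac m"
    if l: "length is = holder_int m" and xy: "x \<noteq> y"
  proof (cases "holder_frac m > 0")
    case True
    have p: "norm (x - y) powr holder_frac m > 0" using xy by simp
    have "Sup ?H \<le> 2 * cm_norm m f" unfolding cm_norm_def using True A0 H0 by simp
    with H[OF l xy True] have "norm (dpart is f x - dpart is f y) / norm (x - y) powr holder_frac m \<le> 2 * cm_norm m f"
      by (rule order_trans)
    then show ?thesis using p by (simp add: pos_divide_le_eq)
  next
    case False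
    then have 0: "holder_frac m = 0" using holder_frac_bounds(1)[of m] by simp
    show ?thesis
      using norm_triangle_ineq4[of "dpart is f x" "dpart is f y"] 1[of "is" x] 1[of "is" y] l xy 0 by simp
  qed
qed

text \<open>Each of the two suprema is at most \<open>e\<close>, hence the factor 2. Nonemptiness of
  both sets is what \<open>cSup_least\<close> asks for.\<close>

lemma cm_norm_le:
  fixes f :: "real^'n::finite \<Rightarrow> real^'m::finite"
  assumes 1: "\<And>is x. length is \<le> holder_int m \<Longrightarrow> norm (dpart is f x) \<le> e"
    and 2: "\<And>is x y. length is = holder_int m \<Longrightarrow> x \<noteq> y \<Longrightarrow>
      norm (dpart is f x - dpart is f y) \<le> e * norm (x - y) powr holder_frac m"
  shows "cm_norm m f \<le> 2 * e"
proof -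
  let ?A = "{norm (dpart is f x) | is x. length is \<le> holder_int m}"
  let ?H = "{norm (dpart is f x - dpart is f y) / norm (x - y) powr holder_frac m
                   | is x y. length is = holder_int m \<and> x \<noteq> y}"
  have A: "Sup ?A \<le> e"
  proof (rule cSup_least)
    have "norm (dpart [] f 0) \<in> ?A" by (rule CollectI, rule exI[of _ "[]"]) auto
    then show "?A \<noteq> {}" by blast
  qed (use 1 in auto)
  have e: "e \<ge> 0" using 1[of "[]" 0] norm_ge_zero[of "dpart [] f 0"] by (simp del: norm_ge_zero)
  have H: "Sup ?H \<le> e"
  proof (rule cSup_least)
    obtain x y :: "real^'n" where "x \<noteq> y" using ex_distinct_points by blast
    then have "norm (dpart (replicate (holder_int m) undefined) f x - dpart (replicate (holder_int m) undefined) f y)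
        / norm (x - y) powr holder_frac m \<in> ?H"
      by (intro CollectI exI conjI) (auto simp del: dpart.simps)
    then show "?H \<noteq> {}" by blast
    fix z assume "z \<in> ?H"
    then obtain "is" x y where z: "z = norm (dpart is f x - dpart is f y) / norm (x - y) powr holder_frac m"
      "length is = holder_int m" "x \<noteq> y" by blast
    have "norm (x - y) powr holder_frac m > 0" using z by simp
    then show "z \<le> e" using 2[OF z(2,3)] by (simp add: z(1) pos_divide_le_eq)
  qed
  show ?thesis unfolding cm_norm_def using A H e by simp
qed

section \<open>From C^m_ap to the little Hoelder condition\<close>

lemma Cap_limit:
  fixes f :: "real^'n::finite \<Rightarrow> real^'m::finite" and c :: "nat \<Rightarrow> real^'n"
  assumes "Cap m f"
  obtains r g where "strict_mono (r :: nat \<Rightarrow> nat)" "Cmb m g" "(\<lambda>j. cm_norm m (\<lambda>x. f (x + c (r j)) - g x)) \<longlonglongrightarrow> 0"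
  using assms unfolding Cap_def by blast

lemma Cap_Cmb: "Cap m f \<Longrightarrow> Cmb m f"
  unfolding Cap_def by simp

lemma Cap_limit_dpart:
  fixes f :: "real^'n::finite \<Rightarrow> real^'m::finite" and c :: "real^'n"
  assumes f: "Cmb m f" and g: "Cmb m g" and l: "length is \<le> holder_int m"
  shows "norm (dpart is f (x + c) - dpart is g x) \<le> cm_norm m (\<lambda>x. f (x + c) - g x)"
proof -
  have "norm (dpart is (\<lambda>x. f (x + c) - g x) x) \<le> cm_norm m (\<lambda>x. f (x + c) - g x)"
    by (rule norm_dpart_le_cm_norm[OF Cmb_diff(2)[OF Cmb_translate[OF f] g] l])
  then show ?thesis by (simp add: dpart_diff[OF Cmb_translate[OF f] g l] dpart_translate)
qed

text \<open>Two late translates are both within \<open>e / 2\<close> of the limit, so the limit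
  drops out of the statement; an index shift removes the early ones.\<close>

lemma Cap_translates:
  fixes f :: "real^'n::finite \<Rightarrow> real^'m::finite" and c :: "nat \<Rightarrow> real^'n"
  assumes f: "Cap m f" and l: "length is \<le> holder_int m" and e: "e > 0"
  shows "\<exists>r. strict_mono (r :: nat \<Rightarrow> nat) \<and>
    (\<forall>i j x. norm (dpart is f (x + c (r i)) - dpart is f (x + c (r j))) \<le> e)"
proof -
  obtain r g where r: "strict_mono (r :: nat \<Rightarrow> nat)" and g: "Cmb m g"
    and lim: "(\<lambda>j. cm_norm m (\<lambda>x. f (x + c (r j)) - g x)) \<longlonglongrightarrow> 0"
    using Cap_limit[OF f] by blast
  have "e / 2 > 0" using e by simp
  from LIMSEQ_D[OF lim this] obtain N where
    N: "\<forall>j\<ge>N. norm (cm_norm m (\<lambda>x. f (x + c (r j)) - g x) - 0) < e / 2" by (elim exE)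
  have 1: "norm (dpart is f (x + c (r (i + N))) - dpart is g x) \<le> e / 2" for i x
    using Cap_limit_dpart[OF Cap_Cmb[OF f] g l, of x "c (r (i + N))"] N[rule_format, of "i + N"] by simp
  have "norm (dpart is f (x + c (r (i + N))) - dpart is f (x + c (r (j + N)))) \<le> e" for i j x
    using norm_triangle_ineq4[of "dpart is f (x + c (r (i + N))) - dpart is g x"
        "dpart is f (x + c (r (j + N))) - dpart is g x"] 1[of x i] 1[of x j] by simp
  moreover have "strict_mono (\<lambda>i. r (i + N))"
    using r by (simp add: strict_mono_def)
  ultimately show ?thesis by (intro exI[of _ "\<lambda>i. r (i + N)"]) simp
qed

text \<open>Otherwise there are bad shifts tending to zero. Precompactness makes a subsequence of
  the translates converge in C^m, and continuity of \<open>f\<close> forces the limit to be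
  \<open>f\<close>; the Hoelder seminorm of translate minus \<open>f\<close> then tends to zero,
  against the choice of the shifts.\<close>

lemma Cap_translation_continuous:
  fixes f :: "real^'n::finite \<Rightarrow> real^'m::finite"
  assumes f: "Cap m f" and l: "length is = holder_int m" and e: "e > 0"
  shows "\<exists>\<eta>>0. \<forall>c x y. norm c < \<eta> \<longrightarrow> x \<noteq> y \<longrightarrow>
    norm ((dpart is f (x + c) - dpart is f x) - (dpart is f (y + c) - dpart is f y))
      \<le> e * norm (x - y) powr holder_frac m"
proof (rule ccontr)
  note fb = Cap_Cmb[OF f]
  define Q where "Q c \<longleftrightarrow> (\<forall>x y. x \<noteq> y \<longrightarrow>
    norm ((dpart is f (x + c) - dpart is f x) - (dpart is f (y + c) - dpart is f y))
      \<le> e * norm (x - y) powr holder_frac m)" for c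
  assume "\<not> ?thesis"
  then have neg: "\<And>\<eta>. \<eta> > 0 \<Longrightarrow> \<exists>c. norm c < \<eta> \<and> \<not> Q c" unfolding Q_def by metis
  have "\<forall>j. \<exists>c. norm c < inverse (real (Suc j)) \<and> \<not> Q c"
    by (intro allI neg) simp
  from choice[OF this] obtain c where c: "\<forall>j. norm (c j) < inverse (real (Suc j)) \<and> \<not> Q (c j)" by (elim exE)
  obtain r g where r: "strict_mono (r :: nat \<Rightarrow> nat)" and g: "Cmb m g"
    and lim: "(\<lambda>j. cm_norm m (\<lambda>x. f (x + c (r j)) - g x)) \<longlonglongrightarrow> 0"
    using Cap_limit[OF f] by blast
  have "c \<longlonglongrightarrow> 0"
    by (rule Lim_null_comparison[OF _ LIMSEQ_inverse_real_of_nat])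
      (use c in \<open>simp add: eventually_sequentially less_imp_le\<close>)
  then have cr: "(\<lambda>j. c (r j)) \<longlonglongrightarrow> 0" using LIMSEQ_subseq_LIMSEQ[OF _ r] by (simp add: o_def)
  have "g x = f x" for x
  proof -
    have "(\<lambda>j. x + c (r j)) \<longlonglongrightarrow> x" using tendsto_add[OF tendsto_const cr, of x] by simp
    moreover have "isCont f x"
      using Cmb_continuous[OF fb, of "[]"] by (simp add: continuous_on_eq_continuous_at)
    ultimately have "(\<lambda>j. f (x + c (r j))) \<longlonglongrightarrow> f x"
      by (rule isCont_tendsto_compose[rotated])
    moreover have "(\<lambda>j. f (x + c (r j)) - g x) \<longlonglongrightarrow> 0"
      by (rule Lim_null_comparison[OF _ lim])
        (use Cap_limit_dpart[OF fb g, of "[]" x] in \<open>simp add: eventually_sequentially\<close>)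
    then have "(\<lambda>j. f (x + c (r j))) \<longlonglongrightarrow> g x" by (rule LIM_zero_cancel)
    ultimately show "g x = f x" by (rule LIMSEQ_unique[symmetric])
  qed
  then have gf: "g = f" by (intro ext)
  have "e / 2 > 0" using e by simp
  from LIMSEQ_D[OF lim[unfolded gf] this] obtain N where
    N: "\<forall>j\<ge>N. norm (cm_norm m (\<lambda>x. f (x + c (r j)) - f x) - 0) < e / 2" by (elim exE)
  have "Q (c (r N))" unfolding Q_def
  proof (intro allI impI)
    fix x y :: "real^'n" assume xy: "x \<noteq> y"
    let ?c = "c (r N)"
    have l': "length is \<le> holder_int m" using l by simp
    have "norm (dpart is (\<lambda>x. f (x + ?c) - f x) x - dpart is (\<lambda>x. f (x + ?c) - f x) y)
      \<le> 2 * cm_norm m (\<lambda>x. f (x + ?c) - f x) * norm (x - y) powr holder_frac m"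
      by (rule holder_le_cm_norm[OF Cmb_diff(2)[OF Cmb_translate[OF fb] fb] l xy])
    also have "\<dots> \<le> e * norm (x - y) powr holder_frac m"
      using N[rule_format, of N] by (intro mult_right_mono) auto
    finally show "norm ((dpart is f (x + ?c) - dpart is f x) - (dpart is f (y + ?c) - dpart is f y))
      \<le> e * norm (x - y) powr holder_frac m"
      by (simp add: dpart_diff[OF Cmb_translate[OF fb] fb l'] dpart_translate)
  qed
  then show False using c by simp
qed

text \<open>By continuity of translations, the increments of \<open>dpart is f\<close> over N consecutive steps h agree up to
\<open>e / 2 * norm h powr \<gamma>\<close>; their sum is at most \<open>C * (N * norm h) powr \<gamma>\<close>, so each is small once
\<open>N powr (\<gamma> - 1)\<close> is small.\<close>

lemma Cap_little_holder:
  fixes f :: "real^'n::finite \<Rightarrow> real^'m::finite"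
  assumes f: "Cap m f" and l: "length is = holder_int m" and e: "e > 0"
  shows "\<exists>d>0. \<forall>x y. x \<noteq> y \<longrightarrow> norm (x - y) < d \<longrightarrow>
    norm (dpart is f x - dpart is f y) \<le> e * norm (x - y) powr holder_frac m"
proof -
  let ?g = "holder_frac m" and ?D = "dpart is f"
  have e2: "e / 2 > 0" using e by simp
  from Cap_translation_continuous[OF f l e2] obtain \<eta> where eta: "\<eta> > 0"
    "\<forall>c x y. norm c < \<eta> \<longrightarrow> x \<noteq> y \<longrightarrow>
      norm ((?D (x + c) - ?D x) - (?D (y + c) - ?D y)) \<le> e / 2 * norm (x - y) powr ?g" by (elim exE conjE)
  obtain C where C: "C \<ge> 0" "\<And>x y. x \<noteq> y \<Longrightarrow> norm (?D x - ?D y) \<le> C * norm (x - y) powr ?g"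
    using Cmb_holder[OF Cap_Cmb[OF f]] l by auto
  \<comment> \<open>The exponent is negative because the fractional part is below 1.\<close>
  have "((\<lambda>x. x powr (?g - 1)) \<longlongrightarrow> 0) at_top"
    using holder_frac_bounds[of m] by (intro tendsto_neg_powr filterlim_ident) simp
  then have "(\<lambda>n. C * real n powr (?g - 1)) \<longlonglongrightarrow> C * 0"
    by (intro tendsto_mult tendsto_const filterlim_compose[OF _ filterlim_real_sequentially])
  then have "\<forall>\<^sub>F n in sequentially. C * real n powr (?g - 1) < e / 2"
    using order_tendstoD(2)[of _ "0::real" sequentially "e / 2"] e2 by simp
  then obtain N0 where N0: "\<forall>n\<ge>N0. C * real n powr (?g - 1) < e / 2" unfolding eventually_sequentially by (elim exE)
  define N where "N = max N0 1"
  have N: "N \<ge> 1" "C * real N powr (?g - 1) \<le> e / 2" using N0 unfolding N_def by (auto intro!: less_imp_le)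
  \<comment> \<open>All shifts by fewer than \<open>N\<close> steps of length below \<open>d\<close>
    stay below \<open>\<eta>\<close>.\<close>
  define d where "d = \<eta> / real N"
  have d: "d > 0" unfolding d_def using eta N by simp
  have "norm (?D x - ?D y) \<le> e * norm (x - y) powr ?g" if xy: "x \<noteq> y" "norm (x - y) < d" for x y
  proof -
    define h where "h = x - y"
    have h: "h \<noteq> 0" "norm h < d" "x = y + h" unfolding h_def using xy by auto
    define p where "p = norm h powr ?g"
    have p: "p \<ge> 0" unfolding p_def by simp
    define F where "F j = ?D (y + real j *\<^sub>R h)" for j :: nat
    \<comment> \<open>As \<open>x = y + h\<close>, the j-th increment is the first one translated by
      \<open>real j *\<^sub>R h\<close>.\<close>
    have step: "norm (F (Suc j) - F j - (?D x - ?D y)) \<le> e / 2 * p" if "j < N" for j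
    proof -
      have "norm (real j *\<^sub>R h) \<le> real N * norm h" using that by (simp add: mult_right_mono)
      also have "\<dots> < \<eta>" using h(2) N unfolding d_def by (simp add: field_simps)
      finally have "norm ((?D (x + real j *\<^sub>R h) - ?D x) - (?D (y + real j *\<^sub>R h) - ?D y)) \<le> e / 2 * norm (x - y) powr ?g"
        using eta(2) xy(1) by blast
      moreover have "x + real j *\<^sub>R h = y + real (Suc j) *\<^sub>R h" by (simp add: h(3) algebra_simps)
      ultimately show ?thesis unfolding F_def p_def h_def
        by (simp add: algebra_simps)
    qed
    have tel: "(\<Sum>j<N. F (Suc j) - F j) = F N - F 0" by (rule sum_lessThan_telescope)
    have "(\<Sum>j<N. F (Suc j) - F j - (?D x - ?D y)) = (F N - F 0) - real N *\<^sub>R (?D x - ?D y)"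
      unfolding sum_subtractf[of "\<lambda>j. F (Suc j) - F j" "\<lambda>j. ?D x - ?D y"] tel
      by (simp only: sum_constant_scaleR card_lessThan)
    moreover have "norm (\<Sum>j<N. F (Suc j) - F j - (?D x - ?D y)) \<le> (\<Sum>j<N. e / 2 * p)"
      by (rule sum_norm_le) (use step in simp)
    ultimately have 1: "norm ((F N - F 0) - real N *\<^sub>R (?D x - ?D y)) \<le> real N * (e / 2 * p)" by simp
    have "norm (F N - F 0) \<le> C * norm ((y + real N *\<^sub>R h) - y) powr ?g"
      unfolding F_def using C(2)[of "y + real N *\<^sub>R h" y] h(1) N by simp
    also have "\<dots> = C * (real N powr ?g * p)" unfolding p_def using N by (simp add: powr_mult)
    also have "\<dots> = real N * (C * real N powr (?g - 1) * p)"
      using N by (simp add: powr_diff)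
    also have "\<dots> \<le> real N * (e / 2 * p)" using N p by (intro mult_left_mono mult_right_mono) auto
    finally have 2: "norm (F N - F 0) \<le> real N * (e / 2 * p)" .
    have "real N * norm (?D x - ?D y) = norm (real N *\<^sub>R (?D x - ?D y))" by simp
    also have "\<dots> \<le> norm (F N - F 0) + norm ((F N - F 0) - real N *\<^sub>R (?D x - ?D y))"
      using norm_triangle_ineq4[of "F N - F 0" "(F N - F 0) - real N *\<^sub>R (?D x - ?D y)"] by simp
    also have "\<dots> \<le> real N * (e * p)" using 1 2 by (simp add: algebra_simps)
    finally have "norm (?D x - ?D y) \<le> e * p" using N by simp
    then show ?thesis by (simp add: p_def h_def)
  qed
  then show ?thesis using d by (intro exI[of _ d]) simp
qed

section \<open>Continuous curves in C^m_ap: uniformity over the time interval\<close>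

context
  fixes m T :: real and u :: "real \<Rightarrow> real^'n::finite \<Rightarrow> real^'n"
  assumes T: "T > 0" and Cap_u: "\<forall>t\<in>{0..T}. Cap m (u t)" and cont_u: "cm_continuous_on m {0..T} u"
begin

lemma Cmb_time: "t \<in> {0..T} \<Longrightarrow> Cmb m (u t)"
  using Cap_u Cap_Cmb by blast

lemma time_dpart_le:
  assumes "s \<in> {0..T}" "t \<in> {0..T}" "length is \<le> holder_int m"
  shows "norm (dpart is (u s) x - dpart is (u t) x) \<le> cm_norm m (\<lambda>x. u s x - u t x)"
  using norm_dpart_le_cm_norm[OF Cmb_diff(2)[OF Cmb_time[OF assms(1)] Cmb_time[OF assms(2)]] assms(3), of x]
  by (simp add: dpart_diff[OF Cmb_time[OF assms(1)] Cmb_time[OF assms(2)] assms(3)])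

lemma time_dpart_holder_le:
  assumes "s \<in> {0..T}" "t \<in> {0..T}" "length is = holder_int m" "x \<noteq> y"
  shows "norm ((dpart is (u s) x - dpart is (u t) x) - (dpart is (u s) y - dpart is (u t) y))
    \<le> 2 * cm_norm m (\<lambda>x. u s x - u t x) * norm (x - y) powr holder_frac m"
proof -
  have l: "length is \<le> holder_int m" using assms(3) by simp
  show ?thesis
    using holder_le_cm_norm[OF Cmb_diff(2)[OF Cmb_time[OF assms(1)] Cmb_time[OF assms(2)]] assms(3,4)]
    by (simp add: dpart_diff[OF Cmb_time[OF assms(1)] Cmb_time[OF assms(2)] l])
qed

text \<open>Compactness of [0,T] replaces the curve by finitely many of its members up to
  \<open>e\<close>; properties of single functions in C^m_ap thereby become uniform in time.\<close>

lemma time_net: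
  assumes "e > 0"
  shows "\<exists>N. finite N \<and> N \<subseteq> {0..T} \<and> (\<forall>t\<in>{0..T}. \<exists>s\<in>N. cm_norm m (\<lambda>x. u t x - u s x) < e)"
proof -
  have "\<forall>t\<in>{0..T}. \<exists>d>0. \<forall>s\<in>{0..T}. \<bar>s - t\<bar> < d \<longrightarrow> cm_norm m (\<lambda>x. u s x - u t x) < e"
    by (intro ballI) (rule cont_u[unfolded cm_continuous_on_def, rule_format, OF _ assms])
  from bchoice[OF this] obtain d where
    d: "\<forall>t\<in>{0..T}. d t > 0 \<and> (\<forall>s\<in>{0..T}. \<bar>s - t\<bar> < d t \<longrightarrow> cm_norm m (\<lambda>x. u s x - u t x) < e)"
    by (elim exE)
  have "{0..T} \<subseteq> (\<Union>t\<in>{0..T}. ball t (d t))" using d by force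
  then obtain N where N: "N \<subseteq> {0..T}" "finite N" "{0..T} \<subseteq> (\<Union>t\<in>N. ball t (d t))"
    using compactE_image[OF compact_Icc, of "{0..T}" "\<lambda>t. ball t (d t)" 0 T] by auto
  have "\<exists>s\<in>N. cm_norm m (\<lambda>x. u t x - u s x) < e" if t: "t \<in> {0..T}" for t
  proof -
    obtain s where s: "s \<in> N" "t \<in> ball s (d s)" using N(3) t by blast
    have "cm_norm m (\<lambda>x. u t x - u s x) < e"
      using d s N(1) t by (auto simp: dist_real_def abs_minus_commute)
    then show ?thesis using s(1) by blast
  qed
  then show ?thesis using N by blast
qed

text \<open>Heine-Cantor: below the Lebesgue number of the cover both times lie in one ball around
  some \<open>p\<close>, and the derivatives are compared through those of
  \<open>u p\<close>.\<close>

lemma time_uniform: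
  assumes "e > 0"
  shows "\<exists>d>0. \<forall>s\<in>{0..T}. \<forall>t\<in>{0..T}. \<bar>s - t\<bar> < d \<longrightarrow>
    (\<forall>is x. length is \<le> holder_int m \<longrightarrow> norm (dpart is (u s) x - dpart is (u t) x) \<le> e)"
proof -
  have e2: "e / 2 > 0" using assms by simp
  have "\<forall>t\<in>{0..T}. \<exists>d>0. \<forall>s\<in>{0..T}. \<bar>s - t\<bar> < d \<longrightarrow> cm_norm m (\<lambda>x. u s x - u t x) < e / 2"
    by (intro ballI) (rule cont_u[unfolded cm_continuous_on_def, rule_format, OF _ e2])
  from bchoice[OF this] obtain d where
    d: "\<forall>t\<in>{0..T}. d t > 0 \<and> (\<forall>s\<in>{0..T}. \<bar>s - t\<bar> < d t \<longrightarrow> cm_norm m (\<lambda>x. u s x - u t x) < e / 2)"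
    by (elim exE)
  have cover: "{0..T} \<subseteq> \<Union> ((\<lambda>t. ball t (d t)) ` {0..T})" using d by force
  have op: "open G" if "G \<in> (\<lambda>t. ball t (d t)) ` {0..T}" for G using that by auto
  obtain \<delta> where \<delta>: "\<delta> > 0" "\<And>s. s \<in> {0..T} \<Longrightarrow> \<exists>G\<in>(\<lambda>t. ball t (d t)) ` {0..T}. ball s \<delta> \<subseteq> G"
    by (rule Heine_Borel_lemma[OF compact_Icc cover op]) (assumption, rule that)
  have "norm (dpart is (u s) x - dpart is (u t) x) \<le> e"
    if s: "s \<in> {0..T}" and t: "t \<in> {0..T}" and "\<bar>s - t\<bar> < \<delta>" and l: "length is \<le> holder_int m" for s t "is" x
  proof -
    obtain p where p: "p \<in> {0..T}" "ball s \<delta> \<subseteq> ball p (d p)" using \<delta>(2)[OF s] by (elim bexE imageE) simp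
    have "s \<in> ball p (d p)" "t \<in> ball p (d p)"
      using p(2) \<delta>(1) that(3) by (auto simp: subset_iff dist_real_def)
    then have "cm_norm m (\<lambda>x. u s x - u p x) < e / 2" "cm_norm m (\<lambda>x. u t x - u p x) < e / 2"
      using d p(1) s t by (auto simp: dist_real_def abs_minus_commute)
    then show ?thesis
      using time_dpart_le[OF s p(1) l, of x] time_dpart_le[OF t p(1) l, of x]
        norm_triangle_ineq4[of "dpart is (u s) x - dpart is (u p) x" "dpart is (u t) x - dpart is (u p) x"] by simp
  qed
  then show ?thesis using \<delta>(1) by (intro exI[of _ \<delta>]) simp
qed

lemma time_bounded:
  "\<exists>M. \<forall>t\<in>{0..T}. \<forall>is x. length is \<le> holder_int m \<longrightarrow> norm (dpart is (u t) x) \<le> M"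
proof -
  from time_net[OF zero_less_one] obtain N where N: "finite N" "N \<subseteq> {0..T}"
    "\<forall>t\<in>{0..T}. \<exists>s\<in>N. cm_norm m (\<lambda>x. u t x - u s x) < 1" by (elim exE conjE)
  have "\<exists>M\<ge>0. \<forall>s\<in>N. \<forall>is x. length is \<le> holder_int m \<longrightarrow> norm (dpart is (u s) x) \<le> M"
  proof (rule finite_common_bound[OF N(1)])
    show "\<exists>M. \<forall>is x. length is \<le> holder_int m \<longrightarrow> norm (dpart is (u s) x) \<le> M" if "s \<in> N" for s
      using Cmb_bound[OF Cmb_time, of s] that N(2) by blast
  qed (meson order_trans)
  then obtain M where M: "\<forall>s\<in>N. \<forall>is x. length is \<le> holder_int m \<longrightarrow> norm (dpart is (u s) x) \<le> M" by blast
  have "norm (dpart is (u t) x) \<le> M + 1" if t: "t \<in> {0..T}" and l: "length is \<le> holder_int m" for t "is" x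
  proof -
    obtain s where s: "s \<in> N" "cm_norm m (\<lambda>x. u t x - u s x) < 1" using N(3) t by blast
    have "s \<in> {0..T}" using s N(2) by blast
    then show ?thesis
      using time_dpart_le[OF t _ l, of s x] s(2) M[rule_format, OF s(1) l, of x]
        norm_triangle_sub[of "dpart is (u t) x" "dpart is (u s) x"] by simp
  qed
  then show ?thesis by (intro exI[of _ "M + 1"]) simp
qed

text \<open>Subsequences are extracted successively for the finitely many times of the net; any
  other time is reached with two further errors \<open>e / 3\<close>.\<close>

lemma time_translates:
  fixes c :: "nat \<Rightarrow> real^'n"
  assumes l: "length is \<le> holder_int m" and e: "e > 0"
  shows "\<exists>r. strict_mono (r :: nat \<Rightarrow> nat) \<and> (\<forall>i j. \<forall>t\<in>{0..T}. \<forall>x.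
        norm (dpart is (u t) (x + c (r i)) - dpart is (u t) (x + c (r j))) \<le> e)"
proof -
  have e3: "e / 3 > 0" using e by simp
  from time_net[OF this] obtain N where N: "finite N" "N \<subseteq> {0..T}"
    "\<forall>t\<in>{0..T}. \<exists>s\<in>N. cm_norm m (\<lambda>x. u t x - u s x) < e / 3" by (elim exE conjE)
  have "\<exists>r. strict_mono (r :: nat \<Rightarrow> nat) \<and> (\<forall>i j. \<forall>t\<in>K. \<forall>x.
        norm (dpart is (u t) (x + c (r i)) - dpart is (u t) (x + c (r j))) \<le> e / 3)"
    if "finite K" "K \<subseteq> {0..T}" for K
    using that
  proof (induction K rule: finite_induct)
    case empty
    show ?case by (intro exI[of _ id]) (simp add: strict_mono_def)
  next
    case (insert s K)
    have "K \<subseteq> {0..T}" using insert.prems by simp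
    from insert.IH[OF this] obtain r where r: "strict_mono (r :: nat \<Rightarrow> nat)"
      "\<forall>i j. \<forall>t\<in>K. \<forall>x. norm (dpart is (u t) (x + c (r i)) - dpart is (u t) (x + c (r j))) \<le> e / 3"
      by (elim exE conjE)
    have "Cap m (u s)" using insert.prems Cap_u by blast
    from Cap_translates[OF this l e3, of "\<lambda>i. c (r i)"] obtain r' where r': "strict_mono (r' :: nat \<Rightarrow> nat)"
      "\<forall>i j x. norm (dpart is (u s) (x + c (r (r' i))) - dpart is (u s) (x + c (r (r' j)))) \<le> e / 3" by (elim exE conjE)
    show ?case
      by (intro exI[of _ "r \<circ> r'"] conjI strict_mono_o r(1) r'(1)) (use r(2) r'(2) in simp)
  qed
  from this[OF N(1,2)] obtain r where r: "strict_mono (r :: nat \<Rightarrow> nat)"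
    "\<forall>i j. \<forall>t\<in>N. \<forall>x. norm (dpart is (u t) (x + c (r i)) - dpart is (u t) (x + c (r j))) \<le> e / 3" by (elim exE conjE)
  have "norm (dpart is (u t) (x + c (r i)) - dpart is (u t) (x + c (r j))) \<le> e" if t: "t \<in> {0..T}" for i j t x
  proof -
    obtain s where s: "s \<in> N" "cm_norm m (\<lambda>x. u t x - u s x) < e / 3" using N(3) t by blast
    have sT: "s \<in> {0..T}" using s N(2) by blast
    let ?a = "x + c (r i)" and ?b = "x + c (r j)"
    have 1: "norm (dpart is (u t) ?a - dpart is (u s) ?a) \<le> e / 3"
      using time_dpart_le[OF t sT l, of ?a] s(2) by simp
    have 2: "norm (dpart is (u s) ?a - dpart is (u s) ?b) \<le> e / 3" using r(2) s(1) by blast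
    have 3: "norm (dpart is (u s) ?b - dpart is (u t) ?b) \<le> e / 3"
      using time_dpart_le[OF t sT l, of ?b] s(2) by (simp add: norm_minus_commute)
    from norm_diff_triangle_le[OF norm_diff_triangle_le[OF 1 2] 3] show ?thesis by simp
  qed
  then show ?thesis using r(1) by (intro exI[of _ r]) simp
qed

lemma time_little_holder:
  assumes l: "length is = holder_int m" and e: "e > 0"
  shows "\<exists>d>0. \<forall>t\<in>{0..T}. \<forall>x y. x \<noteq> y \<and> norm (x - y) < d \<longrightarrow>
    norm (dpart is (u t) x - dpart is (u t) y) \<le> e * norm (x - y) powr holder_frac m"
proof -
  \<comment> \<open>The Hoelder bound by \<open>cm_norm\<close> carries a factor 2, so a net of mesh
    \<open>e / 4\<close> costs \<open>e / 2\<close>.\<close>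
  have e2: "e / 2 > 0" and e4: "e / 4 > 0" using e by simp_all
  from time_net[OF e4] obtain N where N: "finite N" "N \<subseteq> {0..T}"
    "\<forall>t\<in>{0..T}. \<exists>s\<in>N. cm_norm m (\<lambda>x. u t x - u s x) < e / 4" by (elim exE conjE)
  have "\<exists>d>0. \<forall>s\<in>N. \<forall>x y. x \<noteq> y \<longrightarrow> norm (x - y) < d \<longrightarrow>
    norm (dpart is (u s) x - dpart is (u s) y) \<le> e / 2 * norm (x - y) powr holder_frac m"
  proof (rule finite_common_radius[OF N(1)])
    fix s assume "s \<in> N"
    then have "Cap m (u s)" using N(2) Cap_u by blast
    then show "\<exists>d>0. \<forall>x y. x \<noteq> y \<longrightarrow> norm (x - y) < d \<longrightarrow>
      norm (dpart is (u s) x - dpart is (u s) y) \<le> e / 2 * norm (x - y) powr holder_frac m"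
      by (rule Cap_little_holder[OF _ l e2])
  qed (meson order_less_le_trans)
  then obtain d where d: "d > 0" "\<forall>s\<in>N. \<forall>x y. x \<noteq> y \<longrightarrow> norm (x - y) < d \<longrightarrow>
    norm (dpart is (u s) x - dpart is (u s) y) \<le> e / 2 * norm (x - y) powr holder_frac m" by (elim exE conjE)
  have "norm (dpart is (u t) x - dpart is (u t) y) \<le> e * norm (x - y) powr holder_frac m"
    if t: "t \<in> {0..T}" and xy: "x \<noteq> y" "norm (x - y) < d" for t x y
  proof -
    obtain s where s: "s \<in> N" "cm_norm m (\<lambda>x. u t x - u s x) < e / 4" using N(3) t by blast
    have sT: "s \<in> {0..T}" using s N(2) by blast
    let ?p = "norm (x - y) powr holder_frac m"
    have "norm ((dpart is (u t) x - dpart is (u s) x) - (dpart is (u t) y - dpart is (u s) y))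
      \<le> 2 * cm_norm m (\<lambda>x. u t x - u s x) * ?p" by (rule time_dpart_holder_le[OF t sT l xy(1)])
    also have "\<dots> \<le> e / 2 * ?p" using s(2) by (intro mult_right_mono) auto
    finally have 1: "norm ((dpart is (u t) x - dpart is (u s) x) - (dpart is (u t) y - dpart is (u s) y)) \<le> e / 2 * ?p" .
    have 2: "norm (dpart is (u s) x - dpart is (u s) y) \<le> e / 2 * ?p" using d(2) s(1) xy by blast
    have "dpart is (u t) x - dpart is (u t) y = ((dpart is (u t) x - dpart is (u s) x) - (dpart is (u t) y - dpart is (u s) y))
      + (dpart is (u s) x - dpart is (u s) y)" by simp
    also have "norm \<dots> \<le> e / 2 * ?p + e / 2 * ?p" by (intro norm_triangle_le add_mono 1 2)
    finally show ?thesis by simp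
  qed
  then show ?thesis using d(1) by (intro exI[of _ d]) simp
qed

text \<open>At the top order the little Hoelder condition comes from precompactness; below it the
  next derivatives are bounded, and the Lipschitz bound gives the condition.\<close>

lemma ap_base_dpart:
  assumes l: "length is \<le> holder_int m"
  shows "ap_base (holder_frac m) T (\<lambda>t. dpart is (u t))"
proof -
  obtain M where M: "\<And>t is x. t \<in> {0..T} \<Longrightarrow> length is \<le> holder_int m \<Longrightarrow> norm (dpart is (u t) x) \<le> M"
  proof -
    from time_bounded obtain M where "\<forall>t\<in>{0..T}. \<forall>is x. length is \<le> holder_int m \<longrightarrow> norm (dpart is (u t) x) \<le> M"
      by (elim exE)
    then show ?thesis by (intro that) blast
  qed
  have time: "\<exists>d>0. \<forall>s\<in>{0..T}. \<forall>t\<in>{0..T}. \<forall>x. \<bar>s - t\<bar> < d \<longrightarrow> norm (dpart is (u s) x - dpart is (u t) x) \<le> e"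
    if "e > 0" for e using time_uniform[OF that] l by blast
  show ?thesis
  proof (cases "length is = holder_int m")
    case True
    show ?thesis
      by (rule ap_baseI[OF M time time_little_holder[OF True] time_translates[OF l]]) (use l in simp_all)
  next
    case False
    then have l': "length is < holder_int m" using l by simp
    have L: "norm (dpart is (u t) x - dpart is (u t) y) \<le> (\<Sum>i\<in>(UNIV :: 'n set). M) * norm (x - y)"
      if t: "t \<in> {0..T}" for t x y
    proof (rule differentiable_bound[OF convex_UNIV])
      show "(dpart is (u t) has_derivative (\<lambda>h. \<Sum>i\<in>UNIV. h $ i *\<^sub>R dpart (i # is) (u t) z)) (at z within UNIV)" for z
        using Cmb_has_derivative[OF Cmb_time[OF t] l'] by simp
      show "onorm (\<lambda>h :: real^'n. \<Sum>i\<in>UNIV. h $ i *\<^sub>R dpart (i # is) (u t) z) \<le> (\<Sum>i\<in>(UNIV :: 'n set). M)" for z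
      proof (intro onorm_le norm_sum_scaleR_le)
        show "norm (dpart (i # is) (u t) z) \<le> M" for i by (rule M[OF t]) (use l' in simp)
      qed
    qed auto
    show ?thesis
      by (rule ap_base_of_lipschitz[OF holder_frac_bounds(2) M time L time_translates[OF l]]) (use l in simp_all)
  qed
qed

text \<open>The induction runs on the number \<open>r\<close> of orders still available beyond the
  multi-index.\<close>

lemma ap_class_of_Cap: "ap_class (holder_frac m) T (holder_int m) u"
proof -
  have "ap_class (holder_frac m) T r (\<lambda>t. dpart is (u t))" if "r + length is \<le> holder_int m" for r "is"
    using that
  proof (induction r arbitrary: "is")
    case 0
    then show ?case by (simp add: ap_base_dpart)
  next
    case (Suc r)
    show ?case
    proof (rule ap_class_SucI)
      show "ap_base (holder_frac m) T (\<lambda>t. dpart is (u t))" by (rule ap_base_dpart) (use Suc.prems in simp)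
      show "(dpart is (u t) has_derivative (\<lambda>h. \<Sum>i\<in>UNIV. h $ i *\<^sub>R dpart (i # is) (u t) x)) (at x)"
        if "t \<in> {0..T}" for t x
        by (rule Cmb_has_derivative[OF Cmb_time[OF that]]) (use Suc.prems in simp)
      show "ap_class (holder_frac m) T r (\<lambda>t. dpart (i # is) (u t))" for i
        by (rule Suc.IH) (use Suc.prems in simp)
    qed
  qed
  from this[of "holder_int m" "[]"] show ?thesis by simp
qed

end

section \<open>Back to C^m_ap\<close>

text \<open>Connects the existential partial derivatives of \<open>ap_class\<close> with the
  operator \<open>dpart\<close>: by uniqueness of derivatives they agree on [0,T].\<close>

lemma ap_class_dpart:
  fixes f :: "real \<Rightarrow> real^'n::finite \<Rightarrow> real^'m::finite"
  assumes "ap_class \<gamma> T (r + length is) f"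
  shows "\<exists>g. ap_class \<gamma> T r g \<and> (\<forall>t\<in>{0..T}. dpart is (f t) = g t)"
  using assms
proof (induction "is" arbitrary: r)
  case Nil
  then show ?case by (intro exI[of _ f]) simp
next
  case (Cons i "is")
  have "ap_class \<gamma> T (Suc r + length is) f" using Cons.prems by simp
  from Cons.IH[OF this] obtain g where g: "ap_class \<gamma> T (Suc r) g" "\<forall>t\<in>{0..T}. dpart is (f t) = g t"
    by (elim exE conjE)
  obtain g' where g': "\<And>t x. t \<in> {0..T} \<Longrightarrow> (g t has_derivative (\<lambda>h. \<Sum>i\<in>UNIV. h $ i *\<^sub>R g' i t x)) (at x)"
    "\<And>i. ap_class \<gamma> T r (g' i)" by (rule ap_class_SucE[OF g(1)]) (rule that)
  have "dpart (i # is) (f t) = g' i t" if t: "t \<in> {0..T}" for t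
  proof
    fix x
    show "dpart (i # is) (f t) x = g' i t x"
      using partial_dir_has_derivative(2)[OF g'(1)[OF t]] g(2) t by simp
  qed
  then show ?case using g'(2) by (intro exI[of _ "g' i"]) simp
qed

lemma finite_common_subseq:
  assumes "finite I"
    and ex: "\<And>i s. i \<in> I \<Longrightarrow> \<exists>r :: nat \<Rightarrow> nat. strict_mono r \<and> Q i (s \<circ> r)"
    and stable: "\<And>i s r. Q i s \<Longrightarrow> strict_mono r \<Longrightarrow> Q i (s \<circ> r)"
  shows "\<exists>r :: nat \<Rightarrow> nat. strict_mono r \<and> (\<forall>i\<in>I. Q i (s \<circ> r))"
  using assms(1,2)
proof (induction I rule: finite_induct)
  case empty
  show ?case by (intro exI[of _ id]) (simp add: strict_mono_def)
next
  case (insert i I)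
  have "\<exists>r :: nat \<Rightarrow> nat. strict_mono r \<and> (\<forall>i\<in>I. Q i (s \<circ> r))"
    by (rule insert.IH) (use insert.prems in simp)
  then obtain r :: "nat \<Rightarrow> nat" where r: "strict_mono r" "\<forall>i\<in>I. Q i (s \<circ> r)" by (elim exE conjE)
  from insert.prems[OF insertI1, of "s \<circ> r"] obtain r' :: "nat \<Rightarrow> nat" where
    r': "strict_mono r'" "Q i (s \<circ> r \<circ> r')" by (elim exE conjE)
  have Qj: "Q j (s \<circ> (r \<circ> r'))" if "j \<in> insert i I" for j
    using that r' r(2) stable[OF _ r'(1), of j "s \<circ> r"] by (auto simp: o_assoc)
  show ?case by (intro exI[of _ "r \<circ> r'"] conjI strict_mono_o r(1) r'(1) ballI Qj)
qed

text \<open>Points at least \<open>d\<close> apart are handled by the sup bound, since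
  \<open>d powr \<gamma>\<close> is then at most the power of their distance; only nearby points
  need a Hoelder estimate.\<close>

lemma holder_interpolate:
  fixes D :: "'a::real_normed_vector \<Rightarrow> 'b::real_normed_vector"
  assumes "\<And>x. norm (D x) \<le> \<eta>" and "2 * \<eta> \<le> e * d powr \<gamma>" and "d > 0" "e \<ge> 0" "\<gamma> \<ge> 0"
    and "x \<noteq> y" and near: "norm (x - y) < d \<Longrightarrow> norm (D x - D y) \<le> e * norm (x - y) powr \<gamma>"
  shows "norm (D x - D y) \<le> e * norm (x - y) powr \<gamma>"
proof (cases "norm (x - y) < d")
  case False
  have "norm (D x - D y) \<le> 2 * \<eta>"
    using norm_triangle_ineq4[of "D x" "D y"] assms(1)[of x] assms(1)[of y] by linarith
  also have "\<dots> \<le> e * d powr \<gamma>" by fact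
  also have "\<dots> \<le> e * norm (x - y) powr \<gamma>"
    using False assms by (intro mult_left_mono powr_mono2) auto
  finally show ?thesis .
qed (rule near)

text \<open>This is where limits are constructed: a diagonal subsequence makes all derivatives of
  the translates uniformly Cauchy, and their limits are the derivatives of one function. The modulus
  of \<open>F\<close> is inherited by translates and limit, so interpolation upgrades uniform
  convergence to the Hoelder seminorm.\<close>

lemma Cap_intro:
  fixes F :: "real^'n::finite \<Rightarrow> real^'m::finite"
  assumes F: "Cmb m F"
    and lh: "\<And>e. e > 0 \<Longrightarrow> \<exists>d>0. \<forall>is. length is = holder_int m \<longrightarrow> (\<forall>x y. x \<noteq> y \<longrightarrow> norm (x - y) < d \<longrightarrow>
      norm (dpart is F x - dpart is F y) \<le> e * norm (x - y) powr holder_frac m)"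
    and ap: "\<And>e is c. e > 0 \<Longrightarrow> length is \<le> holder_int m \<Longrightarrow> \<exists>r. strict_mono (r :: nat \<Rightarrow> nat) \<and>
      (\<forall>i j x. norm (dpart is F (x + c (r i)) - dpart is F (x + c (r j))) \<le> e)"
  shows "Cap m F"
  unfolding Cap_def
proof (intro conjI allI F)
  fix c :: "nat \<Rightarrow> real^'n"
  let ?g = "holder_frac m" and ?k = "holder_int m"
  define Q where "Q n is s \<longleftrightarrow> (\<forall>i j x. norm (dpart is F (x + c (s i)) - dpart is F (x + c (s j))) \<le> inverse (real (Suc n)))"
    for n "is" and s :: "nat \<Rightarrow> nat"
  define P where "P n s \<longleftrightarrow> (\<forall>is\<in>{is. length is \<le> ?k}. Q n is s)" for n s
  have Qst: "Q n is (s \<circ> r)" if "Q n is s" for n "is" s r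
    using that unfolding Q_def by simp
  interpret subseqs P
  proof
    fix n and s :: "nat \<Rightarrow> nat"
    show "\<exists>r'. strict_mono r' \<and> P n (s \<circ> r')"
      unfolding P_def
    proof (rule finite_common_subseq[OF finite_multi_indices])
      fix "is" :: "'n list" and s :: "nat \<Rightarrow> nat" assume "is \<in> {is. length is \<le> ?k}"
      then show "\<exists>r'. strict_mono r' \<and> Q n is (s \<circ> r')"
        using ap[of "inverse (real (Suc n))" "is" "\<lambda>i. c (s i)"] unfolding Q_def by simp
    qed (rule Qst)
  qed
  define r where "r = diagseq"
  have r: "strict_mono r" unfolding r_def by (rule subseq_diagseq)
  have cau: "norm (dpart is F (x + c (r i)) - dpart is F (x + c (r j))) \<le> inverse (real (Suc n))"
    if "i > n" "j > n" "length is \<le> ?k" for n i j x "is"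
  proof -
    \<comment> \<open>Beyond index \<open>n\<close> the diagonal sequence is a subsequence of the
      one chosen at level \<open>n\<close>, and \<open>P n\<close> is stable under
      refinement.\<close>
    have "P n (diagseq \<circ> ((+) (Suc n)))" by (rule diagseq_holds) (use Qst in \<open>simp add: P_def\<close>)
    then have "Q n is (r \<circ> ((+) (Suc n)))" using that(3) unfolding P_def r_def by simp
    from this[unfolded Q_def, rule_format, of x "i - Suc n" "j - Suc n"] show ?thesis using that by simp
  qed
  define H where "H is x = lim (\<lambda>j. dpart is F (x + c (r j)))" for "is" x
  have H: "(\<lambda>j. dpart is F (x + c (r j))) \<longlonglongrightarrow> H is x" if l: "length is \<le> ?k" for "is" x
  proof -
    have "Cauchy (\<lambda>j. dpart is F (x + c (r j)))"
    proof (rule CauchyI)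
      fix e :: real assume "e > 0"
      then obtain n where n: "inverse (real (Suc n)) < e" using reals_Archimedean by blast
      have "norm (dpart is F (x + c (r i)) - dpart is F (x + c (r j))) < e" if "i \<ge> Suc n" "j \<ge> Suc n" for i j
        using cau[of n i j "is" x] that l n by simp
      then show "\<exists>M. \<forall>i\<ge>M. \<forall>j\<ge>M. norm (dpart is F (x + c (r i)) - dpart is F (x + c (r j))) < e"
        by (intro exI[of _ "Suc n"]) simp
    qed
    then show ?thesis unfolding H_def by (simp add: Cauchy_convergent_iff convergent_LIMSEQ_iff)
  qed
  \<comment> \<open>The other index of the Cauchy estimate is sent to infinity, so convergence is
    uniform in \<open>x\<close>.\<close>
  have Hd: "norm (dpart is F (x + c (r j)) - H is x) \<le> inverse (real (Suc n))"
    if "j > n" and l: "length is \<le> ?k" for n j "is" x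
  proof (rule Lim_norm_ubound[OF _ tendsto_diff[OF tendsto_const H[OF l]]])
    show "\<forall>\<^sub>F i in sequentially. norm (dpart is F (x + c (r j)) - dpart is F (x + c (r i))) \<le> inverse (real (Suc n))"
      unfolding eventually_sequentially
      by (intro exI[of _ "Suc n"] allI impI cau that l) simp
  qed simp
  have Hdiff: "norm (H is x - H is y) \<le> B"
    if l: "length is \<le> ?k" and B: "\<And>j. norm (dpart is F (x + c (r j)) - dpart is F (y + c (r j))) \<le> B" for "is" x y B
    by (rule Lim_norm_ubound[OF _ tendsto_diff[OF H[OF l] H[OF l]]]) (use B in simp_all)
  have Hder: "((\<lambda>s. H is (x + s *\<^sub>R axis i 1)) has_vector_derivative H (i # is) x) (at 0)"
    if l: "length is < ?k" for "is" i x
  proof -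
    have "((\<lambda>s. H is (x + s *\<^sub>R axis i 1)) has_vector_derivative H (i # is) (x + 0 *\<^sub>R axis i 1)) (at 0 within UNIV)"
    proof (rule has_vector_derivative_uniform_limit[where
          f = "\<lambda>n s. dpart is F (x + s *\<^sub>R axis i 1 + c (r n))" and
          f' = "\<lambda>n s. dpart (i # is) F (x + s *\<^sub>R axis i 1 + c (r n))" and
          g' = "\<lambda>s. H (i # is) (x + s *\<^sub>R axis i 1)"])
      fix n and s :: real
      have "((\<lambda>t. x + t *\<^sub>R axis i 1 + c (r n)) has_derivative (\<lambda>h. h *\<^sub>R axis i 1)) (at s)"
        by (auto intro!: derivative_eq_intros)
      from has_derivative_compose[OF this Cmb_has_derivative[OF F l]]
      show "((\<lambda>s. dpart is F (x + s *\<^sub>R axis i 1 + c (r n))) has_vector_derivative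
        dpart (i # is) F (x + s *\<^sub>R axis i 1 + c (r n))) (at s within UNIV)"
        unfolding has_vector_derivative_def
        by (simp add: sum_axis_scaleR scaleR_sum_right[symmetric] flip: scaleR_scaleR del: dpart.simps scaleR_scaleR)
    next
      fix e :: real assume "e > 0"
      then obtain n where n: "inverse (real (Suc n)) < e" using reals_Archimedean by blast
      have "norm (dpart (i # is) F (y + c (r j)) - H (i # is) y) \<le> e" if "j \<ge> Suc n" for j y
        using Hd[of n j "i # is" y] that l n by (simp del: dpart.simps)
      then show "\<exists>N. \<forall>n\<ge>N. \<forall>s\<in>UNIV. norm (dpart (i # is) F (x + s *\<^sub>R axis i 1 + c (r n)) - H (i # is) (x + s *\<^sub>R axis i 1)) \<le> e"
        by (intro exI[of _ "Suc n"] allI impI ballI)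
    next
      show "(\<lambda>n. dpart is F (x + s *\<^sub>R axis i 1 + c (r n))) \<longlonglongrightarrow> H is (x + s *\<^sub>R axis i 1)" for s
        by (rule H) (use l in simp)
    qed simp_all
    then show ?thesis by simp
  qed
  define g where "g = H []"
  have dg: "dpart is g = H is" if "length is \<le> ?k" for "is"
    using that
  proof (induction "is")
    case (Cons i "is")
    then have IH: "dpart is g = H is" and l: "length is < ?k" by simp_all
    show ?case
      by (rule ext) (simp only: dpart.simps IH partial_dir_def vector_derivative_at[OF Hder[OF l]])
  qed (simp add: g_def)
  obtain M where M: "M \<ge> 0" "\<And>is x. length is \<le> ?k \<Longrightarrow> norm (dpart is F x) \<le> M"
    using Cmb_bound[OF F] by auto
  obtain C where C: "C \<ge> 0" "\<And>is x y. length is = ?k \<Longrightarrow> x \<noteq> y \<Longrightarrow>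
    norm (dpart is F x - dpart is F y) \<le> C * norm (x - y) powr ?g"
    using Cmb_holder[OF F] by auto
  have g: "Cmb m g"
  proof (rule CmbI[where M = M and C = C])
    show "(\<lambda>t. dpart is g (x + t *\<^sub>R axis i 1)) differentiable at 0" if "length is < ?k" for "is" i x
      using differentiableI_vector[OF Hder[OF that, of x i]] dg[of "is"] that by simp
    show "continuous_on UNIV (dpart is g)" if l: "length is \<le> ?k" for "is"
      unfolding dg[OF l]
    proof (rule uniform_limit_theorem[where F = sequentially and f = "\<lambda>j x. dpart is F (x + c (r j))"])
      show "\<forall>\<^sub>F j in sequentially. continuous_on UNIV (\<lambda>x. dpart is F (x + c (r j)))"
        by (intro always_eventually allI continuous_on_compose2[OF Cmb_continuous[OF F l]]) (auto intro!: continuous_intros)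
      show "uniform_limit UNIV (\<lambda>j x. dpart is F (x + c (r j))) (H is) sequentially"
      proof (rule uniform_limitI)
        fix e :: real assume "e > 0"
        then obtain n where n: "inverse (real (Suc n)) < e" using reals_Archimedean by blast
        have "dist (dpart is F (y + c (r j))) (H is y) < e" if "j \<ge> Suc n" for j y
          using Hd[of n j "is" y] that l n by (simp add: dist_norm)
        then show "\<forall>\<^sub>F j in sequentially. \<forall>x\<in>UNIV. dist (dpart is F (x + c (r j))) (H is x) < e"
          unfolding eventually_sequentially by (intro exI[of _ "Suc n"] allI impI ballI)
      qed
    qed simp
    show "norm (dpart is g x) \<le> M" if l: "length is \<le> ?k" for "is" x
      unfolding dg[OF l] by (rule Lim_norm_ubound[OF _ H[OF l]]) (simp_all add: M(2)[OF l])
    show "norm (dpart is g x - dpart is g y) \<le> C * norm (x - y) powr ?g"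
      if l: "length is = ?k" and xy: "x \<noteq> y" for "is" x y
    proof -
      have l': "length is \<le> ?k" using l by simp
      have "norm (dpart is F (x + z) - dpart is F (y + z)) \<le> C * norm (x - y) powr ?g" for z
        using C(2)[OF l, of "x + z" "y + z"] xy by simp
      then show ?thesis unfolding dg[OF l'] by (rule Hdiff[OF l'])
    qed
  qed
  have "(\<lambda>j. cm_norm m (\<lambda>x. F (x + c (r j)) - g x)) \<longlonglongrightarrow> 0"
  proof (rule LIMSEQ_I)
    fix e :: real assume e: "e > 0"
    then have e3: "e / 3 > 0" and e6: "e / 6 > 0" by simp_all
    from lh[OF e6] obtain d where d: "d > 0" "\<forall>is. length is = ?k \<longrightarrow> (\<forall>x y. x \<noteq> y \<longrightarrow> norm (x - y) < d \<longrightarrow>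
      norm (dpart is F x - dpart is F y) \<le> e / 6 * norm (x - y) powr ?g)" by (elim exE conjE)
    \<comment> \<open>The first bound serves the sup part of the norm, the second the interpolation
      at distance \<open>d\<close>, which needs
      \<open>2 * \<eta> \<le> e / 3 * d powr ?g\<close>.\<close>
    define \<eta> where "\<eta> = min (e / 3) (e / 6 * d powr ?g)"
    have "\<eta> > 0" unfolding \<eta>_def using e d by simp
    then obtain n where n: "inverse (real (Suc n)) < \<eta>" using reals_Archimedean by blast
    have "norm (cm_norm m (\<lambda>x. F (x + c (r j)) - g x) - 0) < e" if j: "j \<ge> Suc n" for j
    proof -
      note Fc = Cmb_translate[OF F, of "c (r j)"]
      have eq: "dpart is (\<lambda>x. F (x + c (r j)) - g x) = (\<lambda>x. dpart is F (x + c (r j)) - H is x)"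
        if "length is \<le> ?k" for "is"
        using dpart_diff[OF Fc g that] dg[OF that] by (simp add: dpart_translate)
      have small: "norm (dpart is F (x + c (r j)) - H is x) \<le> \<eta>" if "length is \<le> ?k" for "is" x
        using Hd[of n j "is" x] j that n by simp
      have "cm_norm m (\<lambda>x. F (x + c (r j)) - g x) \<le> 2 * (e / 3)"
      proof (rule cm_norm_le)
        show "norm (dpart is (\<lambda>x. F (x + c (r j)) - g x) x) \<le> e / 3" if "length is \<le> ?k" for "is" x
          unfolding eq[OF that] using small[OF that, of x] unfolding \<eta>_def by simp
        fix "is" :: "'n list" and x y :: "real^'n" assume l: "length is = ?k" and xy: "x \<noteq> y"
        then have l': "length is \<le> ?k" by simp
        show "norm (dpart is (\<lambda>x. F (x + c (r j)) - g x) x - dpart is (\<lambda>x. F (x + c (r j)) - g x) y)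
          \<le> e / 3 * norm (x - y) powr ?g"
          unfolding eq[OF l']
        proof (rule holder_interpolate[where D = "\<lambda>x. dpart is F (x + c (r j)) - H is x", OF small[OF l'] _ d(1) _ holder_frac_bounds(1) xy])
          show "2 * \<eta> \<le> e / 3 * d powr ?g" unfolding \<eta>_def by simp
          assume near: "norm (x - y) < d"
          let ?p = "norm (x - y) powr ?g"
          have 1: "norm (dpart is F (x + z) - dpart is F (y + z)) \<le> e / 6 * ?p" for z
            using d(2)[rule_format, OF l, of "x + z" "y + z"] xy near by simp
          have 2: "norm (H is x - H is y) \<le> e / 6 * ?p" by (rule Hdiff[OF l' 1])
          have "norm ((dpart is F (x + c (r j)) - dpart is F (y + c (r j))) - (H is x - H is y)) \<le> e / 6 * ?p + e / 6 * ?p"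
            using norm_triangle_ineq4[of "dpart is F (x + c (r j)) - dpart is F (y + c (r j))" "H is x - H is y"] 1[of "c (r j)"] 2
            by linarith
          then show "norm (dpart is F (x + c (r j)) - H is x - (dpart is F (y + c (r j)) - H is y)) \<le> e / 3 * ?p"
            by (simp add: algebra_simps)
        qed (use e in simp)
      qed
      moreover have "0 \<le> cm_norm m (\<lambda>x. F (x + c (r j)) - g x)"
        using order_trans[OF norm_ge_zero norm_dpart_le_cm_norm[OF Cmb_diff(2)[OF Fc g], of "[]" 0]] by simp
      ultimately show ?thesis using e by simp
    qed
    then show "\<exists>no. \<forall>j\<ge>no. norm (cm_norm m (\<lambda>x. F (x + c (r j)) - g x) - 0) < e" by (intro exI[of _ "Suc n"]) simp
  qed
  then show "\<exists>r g. strict_mono r \<and> Cmb m g \<and> (\<lambda>j. cm_norm m (\<lambda>x. F (x + c (r j)) - g x)) \<longlonglongrightarrow> 0"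
    by (intro exI[of _ r] exI[of _ g] conjI r g)
qed

section \<open>Curves of the class seen as curves in C^m_ap\<close>

context
  fixes m T :: real and f :: "real \<Rightarrow> real^'n::finite \<Rightarrow> real^'m::finite"
  assumes f_class: "ap_class (holder_frac m) T (holder_int m) f"
begin

lemma ap_class_dpart_base:
  assumes "length is \<le> holder_int m"
  shows "ap_base (holder_frac m) T (\<lambda>t. dpart is (f t))"
proof -
  have "ap_class (holder_frac m) T (0 + length is) f" using ap_class_mono[OF f_class assms] by simp
  from ap_class_dpart[OF this] obtain g where g: "ap_class (holder_frac m) T 0 g" "\<forall>t\<in>{0..T}. dpart is (f t) = g t"
    by (elim exE conjE)
  have "ap_base (holder_frac m) T (\<lambda>t. dpart is (f t)) = ap_base (holder_frac m) T g"
    by (rule ap_base_cong) (use g(2) in simp)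
  then show ?thesis using g(1) by simp
qed

lemma ap_class_dpart_derivative:
  assumes "length is < holder_int m" and t: "t \<in> {0..T}"
  shows "(dpart is (f t) has_derivative (\<lambda>h. \<Sum>i\<in>UNIV. h $ i *\<^sub>R dpart (i # is) (f t) x)) (at x)"
proof -
  have "Suc 0 + length is \<le> holder_int m" using assms(1) by simp
  from ap_class_dpart[OF ap_class_mono[OF f_class this]] obtain g where
    g: "ap_class (holder_frac m) T (Suc 0) g" "\<forall>t\<in>{0..T}. dpart is (f t) = g t" by (elim exE conjE)
  obtain g' where g': "\<And>t x. t \<in> {0..T} \<Longrightarrow> (g t has_derivative (\<lambda>h. \<Sum>i\<in>UNIV. h $ i *\<^sub>R g' i t x)) (at x)"
    by (rule ap_class_SucE[OF g(1)]) (rule that)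
  have eq: "dpart is (f t) = g t" using g(2) t by blast
  have "dpart (i # is) (f t) x = g' i t x" for i
    using partial_dir_has_derivative(2)[OF g'[OF t]] eq by simp
  then show ?thesis using g'[OF t, of x] by (simp only: eq)
qed

lemma ap_class_little_holder:
  assumes "e > 0"
  shows "\<exists>d>0. \<forall>is. length is = holder_int m \<longrightarrow> (\<forall>t\<in>{0..T}. \<forall>x y. x \<noteq> y \<longrightarrow> norm (x - y) < d \<longrightarrow>
    norm (dpart is (f t) x - dpart is (f t) y) \<le> e * norm (x - y) powr holder_frac m)"
proof -
  have "\<exists>d>0. \<forall>is\<in>{is. length is \<le> holder_int m}. \<forall>t\<in>{0..T}. \<forall>x y. x \<noteq> y \<longrightarrow> norm (x - y) < d \<longrightarrow>
    norm (dpart is (f t) x - dpart is (f t) y) \<le> e * norm (x - y) powr holder_frac m"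
  proof (rule finite_common_radius[OF finite_multi_indices])
    fix "is" :: "'n list" assume "is \<in> {is. length is \<le> holder_int m}"
    then have "ap_base (holder_frac m) T (\<lambda>t. dpart is (f t))" by (intro ap_class_dpart_base) simp
    from ap_base_holder[OF this assms] obtain d where "d > 0"
      "\<And>t x y. t \<in> {0..T} \<Longrightarrow> x \<noteq> y \<Longrightarrow> norm (x - y) < d \<Longrightarrow>
        norm (dpart is (f t) x - dpart is (f t) y) \<le> e * norm (x - y) powr holder_frac m" by blast
    then show "\<exists>d>0. \<forall>t\<in>{0..T}. \<forall>x y. x \<noteq> y \<longrightarrow> norm (x - y) < d \<longrightarrow>
      norm (dpart is (f t) x - dpart is (f t) y) \<le> e * norm (x - y) powr holder_frac m"
      by (intro exI[of _ d] conjI ballI allI impI)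
  qed (meson order_less_le_trans)
  then show ?thesis by auto
qed

lemma ap_class_time_uniform:
  assumes "e > 0"
  shows "\<exists>d>0. \<forall>is. length is \<le> holder_int m \<longrightarrow> (\<forall>s\<in>{0..T}. \<forall>t\<in>{0..T}. \<bar>s - t\<bar> < d \<longrightarrow>
    (\<forall>x. norm (dpart is (f s) x - dpart is (f t) x) \<le> e))"
proof -
  have "\<exists>d>0. \<forall>is\<in>{is. length is \<le> holder_int m}. \<forall>s\<in>{0..T}. \<forall>t\<in>{0..T}. \<bar>s - t\<bar> < d \<longrightarrow>
    (\<forall>x. norm (dpart is (f s) x - dpart is (f t) x) \<le> e)"
  proof (rule finite_common_radius[OF finite_multi_indices])
    fix "is" :: "'n list" assume "is \<in> {is. length is \<le> holder_int m}"
    then have "ap_base (holder_frac m) T (\<lambda>t. dpart is (f t))" by (intro ap_class_dpart_base) simp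
    from ap_base_time[OF this assms] obtain d where "d > 0"
      "\<And>s t x. s \<in> {0..T} \<Longrightarrow> t \<in> {0..T} \<Longrightarrow> \<bar>s - t\<bar> < d \<Longrightarrow> norm (dpart is (f s) x - dpart is (f t) x) \<le> e" by blast
    then show "\<exists>d>0. \<forall>s\<in>{0..T}. \<forall>t\<in>{0..T}. \<bar>s - t\<bar> < d \<longrightarrow>
      (\<forall>x. norm (dpart is (f s) x - dpart is (f t) x) \<le> e)"
      by (intro exI[of _ d] conjI ballI allI impI)
  qed (meson order_less_le_trans)
  then show ?thesis by auto
qed

lemma ap_class_Cmb:
  assumes t: "t \<in> {0..T}"
  shows "Cmb m (f t)"
proof -
  have "\<exists>M\<ge>0. \<forall>is\<in>{is. length is \<le> holder_int m}. \<forall>x. norm (dpart is (f t) x) \<le> M"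
  proof (rule finite_common_bound[OF finite_multi_indices])
    fix "is" :: "'n list" assume "is \<in> {is. length is \<le> holder_int m}"
    then have "ap_base (holder_frac m) T (\<lambda>t. dpart is (f t))" by (intro ap_class_dpart_base) simp
    from ap_base_bounded[OF this] obtain M where
      "M \<ge> 0" "\<And>t x. t \<in> {0..T} \<Longrightarrow> norm (dpart is (f t) x) \<le> M" by blast
    then show "\<exists>M. \<forall>x. norm (dpart is (f t) x) \<le> M" using t by (intro exI[of _ M]) simp
  qed (meson order_trans)
  then obtain M where M: "M \<ge> 0" "\<And>is x. length is \<le> holder_int m \<Longrightarrow> norm (dpart is (f t) x) \<le> M" by auto
  from ap_class_little_holder[OF zero_less_one] obtain d where d: "d > 0"
    "\<forall>is. length is = holder_int m \<longrightarrow> (\<forall>t\<in>{0..T}. \<forall>x y. x \<noteq> y \<longrightarrow> norm (x - y) < d \<longrightarrow>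
    norm (dpart is (f t) x - dpart is (f t) y) \<le> 1 * norm (x - y) powr holder_frac m)" by (elim exE conjE)
  \<comment> \<open>Constant 1 suffices below distance \<open>d\<close>; beyond it, the sup bound
    gives \<open>2 * M / d powr holder_frac m\<close>.\<close>
  define C where "C = max 1 (2 * M / d powr holder_frac m)"
  have dp: "d powr holder_frac m > 0" using d by simp
  have "2 * M / d powr holder_frac m \<le> C" "1 \<le> C" unfolding C_def by simp_all
  then have C: "2 * M \<le> C * d powr holder_frac m" "1 \<le> C" using dp by (simp_all add: pos_divide_le_eq)
  show ?thesis
  proof (rule CmbI[where M = M and C = C])
    show "(\<lambda>s. dpart is (f t) (x + s *\<^sub>R axis i 1)) differentiable at 0" if "length is < holder_int m" for "is" i x
      by (rule differentiableI_vector[OF partial_dir_has_derivative(1)[OF ap_class_dpart_derivative[OF that t]]])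
    show "continuous_on UNIV (dpart is (f t))" if l: "length is \<le> holder_int m" for "is"
      unfolding continuous_on_iff
    proof (intro ballI allI impI)
      fix x and e :: real assume "0 < e"
      then have "e / 2 > 0" by simp
      from ap_base_uniform[OF ap_class_dpart_base[OF l] this holder_frac_bounds(1)] obtain r where
        r: "r > 0" "\<And>t x y. t \<in> {0..T} \<Longrightarrow> norm (x - y) < r \<Longrightarrow> norm (dpart is (f t) x - dpart is (f t) y) \<le> e / 2" by blast
      have "dist (dpart is (f t) y) (dpart is (f t) x) < e" if "dist y x < r" for y
        using r(2)[OF t, of y x] that \<open>0 < e\<close> by (simp add: dist_norm)
      then show "\<exists>r>0. \<forall>y\<in>UNIV. dist y x < r \<longrightarrow> dist (dpart is (f t) y) (dpart is (f t) x) < e"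
        using r(1) by (intro exI[of _ r]) simp
    qed
    show "norm (dpart is (f t) x) \<le> M" if "length is \<le> holder_int m" for "is" x by (rule M(2)[OF that])
    fix "is" :: "'n list" and x y :: "real^'n" assume l: "length is = holder_int m" and xy: "x \<noteq> y"
    show "norm (dpart is (f t) x - dpart is (f t) y) \<le> C * norm (x - y) powr holder_frac m"
    proof (rule holder_interpolate[OF M(2) C(1) d(1) _ holder_frac_bounds(1) xy])
      assume "norm (x - y) < d"
      then have "norm (dpart is (f t) x - dpart is (f t) y) \<le> 1 * norm (x - y) powr holder_frac m"
        using d(2) l xy t by blast
      also have "\<dots> \<le> C * norm (x - y) powr holder_frac m" using C(2) by (intro mult_right_mono) auto
      finally show "norm (dpart is (f t) x - dpart is (f t) y) \<le> C * norm (x - y) powr holder_frac m" .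
    qed (use l C(2) in simp_all)
  qed
qed

lemma ap_class_Cap:
  assumes t: "t \<in> {0..T}"
  shows "Cap m (f t)"
proof (rule Cap_intro[OF ap_class_Cmb[OF t]])
  show "\<exists>d>0. \<forall>is. length is = holder_int m \<longrightarrow> (\<forall>x y. x \<noteq> y \<longrightarrow> norm (x - y) < d \<longrightarrow>
      norm (dpart is (f t) x - dpart is (f t) y) \<le> e * norm (x - y) powr holder_frac m)" if "e > 0" for e
    using ap_class_little_holder[OF that] t by blast
  show "\<exists>r. strict_mono (r :: nat \<Rightarrow> nat) \<and>
      (\<forall>i j x. norm (dpart is (f t) (x + c (r i)) - dpart is (f t) (x + c (r j))) \<le> e)"
    if e: "e > 0" and l: "length is \<le> holder_int m" for e "is" and c :: "nat \<Rightarrow> real^'n"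
  proof -
    obtain r :: "nat \<Rightarrow> nat" where r: "strict_mono r" "\<And>i j t x. t \<in> {0..T} \<Longrightarrow>
      norm (dpart is (f t) (x + c (r i)) - dpart is (f t) (x + c (r j))) \<le> e"
      using ap_base_translates[OF ap_class_dpart_base[OF l] e] by blast
    show ?thesis by (intro exI[of _ r] conjI allI r t)
  qed
qed

text \<open>The little Hoelder condition upgrades uniform convergence in time to convergence in the Hoelder seminorm.\<close>

lemma ap_class_time_holder:
  assumes e: "e > 0"
  shows "\<exists>d>0. \<forall>is. length is = holder_int m \<longrightarrow> (\<forall>s\<in>{0..T}. \<forall>t\<in>{0..T}. \<bar>s - t\<bar> < d \<longrightarrow> (\<forall>x y. x \<noteq> y \<longrightarrow>
    norm ((dpart is (f s) x - dpart is (f t) x) - (dpart is (f s) y - dpart is (f t) y))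
      \<le> e * norm (x - y) powr holder_frac m))"
proof -
  have e2: "e / 2 > 0" using e by simp
  from ap_class_little_holder[OF e2] obtain d where d: "d > 0"
    "\<forall>is. length is = holder_int m \<longrightarrow> (\<forall>t\<in>{0..T}. \<forall>x y. x \<noteq> y \<longrightarrow> norm (x - y) < d \<longrightarrow>
    norm (dpart is (f t) x - dpart is (f t) y) \<le> e / 2 * norm (x - y) powr holder_frac m)" by (elim exE conjE)
  \<comment> \<open>Twice this sup-norm tolerance is \<open>e * d powr holder_frac m\<close>, the
    threshold for interpolation at distance \<open>d\<close>.\<close>
  have "e / 2 * d powr holder_frac m > 0" using e d by simp
  from ap_class_time_uniform[OF this] obtain \<delta> where \<delta>: "\<delta> > 0"
    "\<forall>is. length is \<le> holder_int m \<longrightarrow> (\<forall>s\<in>{0..T}. \<forall>t\<in>{0..T}. \<bar>s - t\<bar> < \<delta> \<longrightarrow>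
    (\<forall>x. norm (dpart is (f s) x - dpart is (f t) x) \<le> e / 2 * d powr holder_frac m))" by (elim exE conjE)
  have "norm ((dpart is (f s) x - dpart is (f t) x) - (dpart is (f s) y - dpart is (f t) y))
      \<le> e * norm (x - y) powr holder_frac m"
    if l: "length is = holder_int m" and s: "s \<in> {0..T}" and t: "t \<in> {0..T}" and st: "\<bar>s - t\<bar> < \<delta>" and xy: "x \<noteq> y"
    for "is" s t x y
  proof (rule holder_interpolate[where D = "\<lambda>x. dpart is (f s) x - dpart is (f t) x"])
    show "norm (dpart is (f s) x - dpart is (f t) x) \<le> e / 2 * d powr holder_frac m" for x
      using \<delta>(2) l s t st by simp
    assume near: "norm (x - y) < d"
    let ?p = "norm (x - y) powr holder_frac m"
    have 1: "norm (dpart is (f s) x - dpart is (f s) y) \<le> e / 2 * ?p" using d(2) l s xy near by blast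
    have 2: "norm (dpart is (f t) x - dpart is (f t) y) \<le> e / 2 * ?p" using d(2) l t xy near by blast
    have "norm ((dpart is (f s) x - dpart is (f s) y) - (dpart is (f t) x - dpart is (f t) y)) \<le> e / 2 * ?p + e / 2 * ?p"
      using norm_triangle_ineq4[of "dpart is (f s) x - dpart is (f s) y" "dpart is (f t) x - dpart is (f t) y"] 1 2
      by linarith
    then show "norm ((dpart is (f s) x - dpart is (f t) x) - (dpart is (f s) y - dpart is (f t) y)) \<le> e * ?p"
      by (simp add: algebra_simps)
  qed (use d e xy holder_frac_bounds in simp_all)
  then show ?thesis using \<delta>(1) by (intro exI[of _ \<delta>] conjI allI impI ballI)
qed

lemma ap_class_cm_continuous: "cm_continuous_on m {0..T} f"
  unfolding cm_continuous_on_def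
proof (intro ballI allI impI)
  fix t e :: real assume t: "t \<in> {0..T}" and e: "e > 0"
  then have e3: "e / 3 > 0" by simp
  from ap_class_time_uniform[OF e3] obtain d1 where d1: "d1 > 0"
    "\<forall>is. length is \<le> holder_int m \<longrightarrow> (\<forall>s\<in>{0..T}. \<forall>t\<in>{0..T}. \<bar>s - t\<bar> < d1 \<longrightarrow>
    (\<forall>x. norm (dpart is (f s) x - dpart is (f t) x) \<le> e / 3))" by (elim exE conjE)
  from ap_class_time_holder[OF e3] obtain d2 where d2: "d2 > 0"
    "\<forall>is. length is = holder_int m \<longrightarrow> (\<forall>s\<in>{0..T}. \<forall>t\<in>{0..T}. \<bar>s - t\<bar> < d2 \<longrightarrow> (\<forall>x y. x \<noteq> y \<longrightarrow>
    norm ((dpart is (f s) x - dpart is (f t) x) - (dpart is (f s) y - dpart is (f t) y))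
      \<le> e / 3 * norm (x - y) powr holder_frac m))" by (elim exE conjE)
  have "cm_norm m (\<lambda>x. f s x - f t x) < e" if s: "s \<in> {0..T}" and st: "\<bar>s - t\<bar> < min d1 d2" for s
  proof -
    note eq = dpart_diff[OF ap_class_Cmb[OF s] ap_class_Cmb[OF t]]
    have "cm_norm m (\<lambda>x. f s x - f t x) \<le> 2 * (e / 3)"
    proof (rule cm_norm_le)
      show "norm (dpart is (\<lambda>x. f s x - f t x) x) \<le> e / 3" if l: "length is \<le> holder_int m" for "is" x
        unfolding eq[OF l] using d1(2) l s t st by simp
      show "norm (dpart is (\<lambda>x. f s x - f t x) x - dpart is (\<lambda>x. f s x - f t x) y)
        \<le> e / 3 * norm (x - y) powr holder_frac m" if l: "length is = holder_int m" and xy: "x \<noteq> y" for "is" x y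
      proof -
        have l': "length is \<le> holder_int m" using l by simp
        show ?thesis unfolding eq[OF l'] using d2(2) l s t st xy by simp
      qed
    qed
    then show ?thesis using e by simp
  qed
  then show "\<exists>d>0. \<forall>s\<in>{0..T}. \<bar>s - t\<bar> < d \<longrightarrow> cm_norm m (\<lambda>x. f s x - f t x) < e"
    using d1(1) d2(1) by (intro exI[of _ "min d1 d2"]) simp
qed

end

section \<open>Differentiability in time with respect to the C^m norm\<close>

lemma difference_quotient_bound:
  fixes y :: "real \<Rightarrow> 'b::real_normed_vector"
  assumes y: "\<And>r. r \<in> {0..T} \<Longrightarrow> (y has_vector_derivative y' r) (at r within {0..T})"
    and B: "\<And>r. r \<in> {0..T} \<Longrightarrow> \<bar>r - t\<bar> \<le> \<bar>s - t\<bar> \<Longrightarrow> norm (y' r - y' t) \<le> B"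
    and s: "s \<in> {0..T}" and t: "t \<in> {0..T}" and "s \<noteq> t"
  shows "norm ((y s - y t) /\<^sub>R (s - t) - y' t) \<le> B"
proof -
  let ?S = "closed_segment t s"
  have S: "?S \<subseteq> {0..T}" using s t by (intro closed_segment_subset) auto
  have "norm (y s - y t - (s - t) *\<^sub>R y' t) \<le> norm (s - t) * B"
  proof (rule vector_differentiable_bound_linearization[where S = ?S])
    show "(y has_vector_derivative y' r) (at r within ?S)" if "r \<in> ?S" for r
      using has_vector_derivative_within_subset[OF y S] that S by blast
    show "norm (y' r - y' t) \<le> B" if "r \<in> ?S" for r
      by (rule B) (use that S in \<open>auto simp: closed_segment_eq_real_ivl split: if_splits\<close>)
  qed auto
  moreover have "(y s - y t) /\<^sub>R (s - t) - y' t = (y s - y t - (s - t) *\<^sub>R y' t) /\<^sub>R (s - t)"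
    using \<open>s \<noteq> t\<close> by (simp add: scaleR_diff_right)
  moreover have "norm (z /\<^sub>R (s - t)) \<le> B" if "norm z \<le> norm (s - t) * B" for z :: 'b
  proof -
    have "norm (z /\<^sub>R (s - t)) = norm z / \<bar>s - t\<bar>" by (simp add: divide_inverse mult.commute)
    then show ?thesis using that \<open>s \<noteq> t\<close> by (simp add: pos_divide_le_eq mult.commute)
  qed
  ultimately show ?thesis by simp
qed

text \<open>Time derivatives commute with each \<open>dpart\<close>, so the mean value inequality
  reduces the error of the difference quotient to the oscillation in time of the derivatives of
  \<open>v\<close>, both in the sup norm and in the Hoelder seminorm.\<close>

lemma ap_class_cm_has_derivative:
  fixes Y v :: "real \<Rightarrow> real^'n::finite \<Rightarrow> real^'m::finite"
  assumes Yc: "ap_class (holder_frac m) T (holder_int m) Y" and vc: "ap_class (holder_frac m) T (holder_int m) v"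
    and Y: "\<And>t x. t \<in> {0..T} \<Longrightarrow> ((\<lambda>t. Y t x) has_vector_derivative v t x) (at t within {0..T})"
  shows "cm_has_derivative_on m {0..T} Y v"
proof -
  have der: "((\<lambda>t. dpart is (Y t) x) has_vector_derivative dpart is (v t) x) (at t within {0..T})"
    if "length is \<le> holder_int m" "t \<in> {0..T}" for "is" t x
    using that
  proof (induction "is" arbitrary: t x)
    case Nil
    then show ?case using Y by simp
  next
    case (Cons i "is")
    then have l: "length is < holder_int m" by simp
    have li: "length (j # is) \<le> holder_int m" for j using l by simp
    show ?case
      by (rule has_vector_derivative_partial_swap[where Y = "\<lambda>t. dpart is (Y t)" and v = "\<lambda>t. dpart is (v t)"
            and A = "\<lambda>j t. dpart (j # is) (Y t)" and B = "\<lambda>j t. dpart (j # is) (v t)",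
            OF Cons.IH ap_class_dpart_derivative[OF Yc l] ap_class_dpart_base[OF Yc li]
            ap_class_dpart_derivative[OF vc l] ap_class_dpart_base[OF vc li] holder_frac_bounds(1) Cons.prems(2)])
        (use l in simp_all)
  qed
  show ?thesis
    unfolding cm_has_derivative_on_def
  proof (intro ballI allI impI)
    fix t e :: real assume t: "t \<in> {0..T}" and e: "e > 0"
    then have e3: "e / 3 > 0" by simp
    from ap_class_time_uniform[OF vc e3] obtain d1 where d1: "d1 > 0"
      "\<forall>is. length is \<le> holder_int m \<longrightarrow> (\<forall>s\<in>{0..T}. \<forall>t\<in>{0..T}. \<bar>s - t\<bar> < d1 \<longrightarrow>
      (\<forall>x. norm (dpart is (v s) x - dpart is (v t) x) \<le> e / 3))" by (elim exE conjE)
    from ap_class_time_holder[OF vc e3] obtain d2 where d2: "d2 > 0"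
      "\<forall>is. length is = holder_int m \<longrightarrow> (\<forall>s\<in>{0..T}. \<forall>t\<in>{0..T}. \<bar>s - t\<bar> < d2 \<longrightarrow> (\<forall>x y. x \<noteq> y \<longrightarrow>
      norm ((dpart is (v s) x - dpart is (v t) x) - (dpart is (v s) y - dpart is (v t) y))
        \<le> e / 3 * norm (x - y) powr holder_frac m))" by (elim exE conjE)
    have "cm_norm m (\<lambda>x. (Y s x - Y t x) /\<^sub>R (s - t) - v t x) < e"
      if s: "s \<in> {0..T}" and st: "s \<noteq> t" "\<bar>s - t\<bar> < min d1 d2" for s
    proof -
      let ?h = "\<lambda>x. (Y s x - Y t x) /\<^sub>R (s - t) - v t x"
      have eq: "dpart is ?h = (\<lambda>x. (dpart is (Y s) x - dpart is (Y t) x) /\<^sub>R (s - t) - dpart is (v t) x)"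
        if l: "length is \<le> holder_int m" for "is"
        using dpart_lincomb[OF Cmb_diff(2)[OF ap_class_Cmb[OF Yc s] ap_class_Cmb[OF Yc t]] ap_class_Cmb[OF vc t] l,
            of "inverse (s - t)" "-1"]
        by (simp add: dpart_diff[OF ap_class_Cmb[OF Yc s] ap_class_Cmb[OF Yc t] l])
      have "cm_norm m ?h \<le> 2 * (e / 3)"
      proof (rule cm_norm_le)
        show "norm (dpart is ?h x) \<le> e / 3" if l: "length is \<le> holder_int m" for "is" x
          unfolding eq[OF l]
          by (rule difference_quotient_bound[OF der[OF l] _ s t st(1)]) (use d1(2) l t st(2) in auto)
        show "norm (dpart is ?h x - dpart is ?h y) \<le> e / 3 * norm (x - y) powr holder_frac m"
          if l: "length is = holder_int m" and xy: "x \<noteq> y" for "is" x y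
        proof -
          have l': "length is \<le> holder_int m" using l by simp
          \<comment> \<open>The mean value inequality is applied to the difference of the values at
            the two points, keeping the factor \<open>norm (x - y) powr holder_frac m\<close> that
            separate estimates would lose.\<close>
          have "norm (((dpart is (Y s) x - dpart is (Y s) y) - (dpart is (Y t) x - dpart is (Y t) y)) /\<^sub>R (s - t) -
            (dpart is (v t) x - dpart is (v t) y)) \<le> e / 3 * norm (x - y) powr holder_frac m"
          proof (rule difference_quotient_bound[where y = "\<lambda>t. dpart is (Y t) x - dpart is (Y t) y"
                and y' = "\<lambda>t. dpart is (v t) x - dpart is (v t) y", OF _ _ s t st(1)])
            show "((\<lambda>t. dpart is (Y t) x - dpart is (Y t) y) has_vector_derivative
              dpart is (v r) x - dpart is (v r) y) (at r within {0..T})" if "r \<in> {0..T}" for r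
              by (intro has_vector_derivative_diff der[OF l' that])
            fix r assume r: "r \<in> {0..T}" "\<bar>r - t\<bar> \<le> \<bar>s - t\<bar>"
            then have "\<bar>r - t\<bar> < d2" using st(2) by simp
            from d2(2)[rule_format, OF l r(1) t this xy]
            show "norm (dpart is (v r) x - dpart is (v r) y - (dpart is (v t) x - dpart is (v t) y))
              \<le> e / 3 * norm (x - y) powr holder_frac m" by (simp add: algebra_simps)
          qed
          then show ?thesis unfolding eq[OF l'] by (simp add: algebra_simps)
        qed
      qed
      then show ?thesis using e by simp
    qed
    then show "\<exists>d>0. \<forall>s\<in>{0..T}. s \<noteq> t \<and> \<bar>s - t\<bar> < d \<longrightarrow> cm_norm m (\<lambda>x. (Y s x - Y t x) /\<^sub>R (s - t) - v t x) < e"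
      using d1(1) d2(1) by (intro exI[of _ "min d1 d2"]) simp
  qed
qed

section \<open>The flow\<close>

text \<open>The function \<open>exp (2 * L * t) * (norm (w t))\<^sup>2\<close> is nondecreasing, so
  solutions shrink at most at rate \<open>L\<close>; the negated function \<open>g\<close> fits the
  monotonicity lemma.\<close>

lemma gronwall_lower:
  fixes w :: "real \<Rightarrow> 'a::real_inner"
  assumes L: "L \<ge> 0"
    and w: "\<And>t. t \<in> {0..T} \<Longrightarrow> (w has_vector_derivative w' t) (at t within {0..T})"
    and le: "\<And>t. t \<in> {0..T} \<Longrightarrow> norm (w' t) \<le> L * norm (w t)" and t: "t \<in> {0..T}"
  shows "norm (w 0) \<le> exp (L * T) * norm (w t)"
proof -
  define g where "g s = - (exp (2 * L * s) * (w s \<bullet> w s))" for s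
  define g' where "g' s = - (exp (2 * L * s) * (2 * (w s \<bullet> w' s)) + (2 * L * exp (2 * L * s)) * (w s \<bullet> w s))" for s
  have d: "(g has_vector_derivative g' s) (at s within {0..T})" if "s \<in> {0..T}" for s
  proof -
    have "(w has_derivative (\<lambda>x. x *\<^sub>R w' s)) (at s within {0..T})"
      using w[OF that] by (simp add: has_vector_derivative_def)
    from has_derivative_inner[OF this this]
    have "((\<lambda>s. w s \<bullet> w s) has_vector_derivative (2 * (w s \<bullet> w' s))) (at s within {0..T})"
      unfolding has_vector_derivative_def by (simp add: inner_commute algebra_simps)
    moreover have "((\<lambda>s. exp (2 * L * s)) has_vector_derivative (2 * L * exp (2 * L * s))) (at s within {0..T})"
      unfolding has_real_derivative_iff_has_vector_derivative[symmetric]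
      by (auto intro!: derivative_eq_intros)
    ultimately have "((\<lambda>s. exp (2 * L * s) * (w s \<bullet> w s)) has_vector_derivative
      (exp (2 * L * s) * (2 * (w s \<bullet> w' s)) + (2 * L * exp (2 * L * s)) * (w s \<bullet> w s))) (at s within {0..T})"
      using has_vector_derivative_mult by blast
    then show ?thesis unfolding g_def g'_def by (rule has_vector_derivative_minus)
  qed
  have "g' s \<le> 0" if "s \<in> {0..T}" for s
  proof -
    have "- (w s \<bullet> w' s) \<le> norm (w s) * norm (w' s)"
      using Cauchy_Schwarz_ineq2[of "w s" "w' s"] by linarith
    also have "\<dots> \<le> norm (w s) * (L * norm (w s))" using le[OF that] by (intro mult_left_mono) auto
    also have "\<dots> = L * (w s \<bullet> w s)" by (simp add: dot_square_norm power2_eq_square)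
    finally have "0 \<le> exp (2 * L * s) * (2 * (L * (w s \<bullet> w s) + w s \<bullet> w' s))" by simp
    then show ?thesis unfolding g'_def by (simp add: algebra_simps)
  qed
  with has_vector_derivative_nonpos_imp_le[OF d] t have "g t \<le> g 0" by blast
  then have "(norm (w 0))\<^sup>2 \<le> exp (2 * L * t) * (norm (w t))\<^sup>2"
    unfolding g_def by (simp add: dot_square_norm)
  also have "\<dots> \<le> exp (2 * L * T) * (norm (w t))\<^sup>2"
    using t L by (intro mult_right_mono) (auto intro: mult_left_mono)
  also have "\<dots> = (exp (L * T) * norm (w t))\<^sup>2"
    by (simp add: power_mult_distrib mult.assoc flip: exp_double)
  finally show ?thesis by (rule power2_le_imp_le) simp
qed

section \<open>A uniform lower bound for the Jacobian determinant\<close>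

lemma continuous_on_det:
  "continuous_on S (\<lambda>A :: real^'n::finite^'n. det A)"
  unfolding det_def by (intro continuous_intros)

text \<open>Matrices that are bounded by \<open>M\<close> and expand by \<open>c\<close> form a
  compact set on which the determinant has no zero, so its absolute value attains a positive
  minimum.\<close>

lemma abs_det_lower_bound:
  assumes c: "c > 0"
  obtains \<epsilon> where "\<epsilon> > 0"
    "\<And>A :: real^'n::finite^'n. norm A \<le> M \<Longrightarrow> (\<And>v. c * norm v \<le> norm (A *v v)) \<Longrightarrow> \<epsilon> \<le> \<bar>det A\<bar>"
proof -
  let ?K = "{A :: real^'n^'n. norm A \<le> M} \<inter> (\<Inter>v. {A. c * norm v \<le> norm (A *v v)})"
  have cont: "continuous_on UNIV (\<lambda>A :: real^'n^'n. A *v v)" for v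
    unfolding matrix_vector_mult_def by (intro continuous_intros)
  have "compact ?K"
    unfolding compact_eq_bounded_closed
  proof
    show "bounded ?K" by (rule boundedI[of _ M]) simp
    have "closed {A :: real^'n^'n. c * norm v \<le> norm (A *v v)}" for v
      by (intro closed_Collect_le continuous_intros cont)
    moreover have "closed {A :: real^'n^'n. norm A \<le> M}"
      by (intro closed_Collect_le continuous_intros)
    ultimately show "closed ?K" by (intro closed_Int closed_INT) auto
  qed
  have nz: "det A \<noteq> 0" if "A \<in> ?K" for A
  proof -
    have "inj ((*v) A)"
    proof (rule injI)
      fix v w assume "A *v v = A *v w"
      then have "A *v (v - w) = 0" by (simp add: matrix_vector_mult_diff_distrib)
      moreover have "c * norm (v - w) \<le> norm (A *v (v - w))" using that by blast
      ultimately have "c * norm (v - w) \<le> 0" by simp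
      then show "v = w" using c by (simp add: mult_le_0_iff)
    qed
    then show ?thesis using matrix_left_invertible_injective[of A] invertible_left_inverse[of A]
        invertible_det_nz[of A] by blast
  qed
  show ?thesis
  proof (cases "?K = {}")
    case True
    show ?thesis by (rule that[of 1]) (use True in auto)
  next
    case False
    have "continuous_on ?K (\<lambda>A. \<bar>det A\<bar>)" by (intro continuous_intros continuous_on_det)
    from continuous_attains_inf[OF \<open>compact ?K\<close> False this]
    obtain A0 where A0: "A0 \<in> ?K" "\<forall>A\<in>?K. \<bar>det A0\<bar> \<le> \<bar>det A\<bar>" by (elim bexE)
    show ?thesis
    proof (rule that)
      show "\<bar>det A0\<bar> > 0" using nz[OF A0(1)] by simp
      show "\<bar>det A0\<bar> \<le> \<bar>det A\<bar>" if "norm A \<le> M" "\<And>v. c * norm v \<le> norm (A *v v)" for A :: "real^'n^'n"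
      proof -
        have "A \<in> ?K" using that by simp
        then show ?thesis using A0(2) by blast
      qed
    qed
  qed
qed

lemma norm_matrix_le:
  fixes A :: "real^'n::finite^'n"
  assumes "\<And>i j. \<bar>A $ i $ j\<bar> \<le> B j"
  shows "norm A \<le> (\<Sum>i\<in>(UNIV :: 'n set). \<Sum>j\<in>UNIV. B j)"
proof -
  have "norm A \<le> (\<Sum>i\<in>UNIV. norm (A $ i))" unfolding norm_vec_def by (rule L2_set_le_sum) simp
  also have "\<dots> \<le> (\<Sum>i\<in>(UNIV :: 'n set). \<Sum>j\<in>UNIV. B j)"
  proof (rule sum_mono)
    fix i
    have "norm (A $ i) \<le> (\<Sum>j\<in>UNIV. \<bar>A $ i $ j\<bar>)" by (rule norm_le_l1_cart)
    also have "\<dots> \<le> (\<Sum>j\<in>UNIV. B j)" by (intro sum_mono assms)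
    finally show "norm (A $ i) \<le> (\<Sum>j\<in>UNIV. B j)" .
  qed
  finally show ?thesis .
qed

text \<open>The expansion bound is tested on a small multiple of \<open>v\<close>, where the
  linearisation error is negligible; by homogeneity the scale cancels.\<close>

lemma has_derivative_expansion:
  fixes \<phi> :: "'a::real_normed_vector \<Rightarrow> 'b::real_normed_vector"
  assumes d: "(\<phi> has_derivative \<phi>') (at x)" and c: "\<And>y. c * norm (y - x) \<le> norm (\<phi> y - \<phi> x)"
  shows "c * norm v \<le> norm (\<phi>' v)"
proof (rule field_le_epsilon)
  fix e :: real assume e: "e > 0"
  define n where "n = norm v + 1"
  have n: "n > 0" unfolding n_def by (simp add: add_nonneg_pos)
  define e' where "e' = e / n"
  have e': "e' > 0" unfolding e'_def using e n by simp
  from d[unfolded has_derivative_at_alt, THEN conjunct2, rule_format, OF e'] obtain r where r: "r > 0" "\<forall>y. norm (y - x) < r \<longrightarrow> norm (\<phi> y - \<phi> x - \<phi>' (y - x)) \<le> e' * norm (y - x)"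
    by (elim exE conjE)
  \<comment> \<open>Brings \<open>s *\<^sub>R v\<close> to norm at most \<open>r / 2\<close>, for
    \<open>v = 0\<close> as well because \<open>n\<close> exceeds the norm of \<open>v\<close> by
    1.\<close>
  define s where "s = r / (2 * n)"
  have s: "s > 0" unfolding s_def using r(1) n by simp
  have "s * norm v \<le> s * n" unfolding n_def using s by (intro mult_left_mono) auto
  also have "\<dots> = r / 2" unfolding s_def using n by simp
  finally have "norm (s *\<^sub>R v) < r" using s r(1) by simp
  then have "norm (\<phi> (x + s *\<^sub>R v) - \<phi> x - \<phi>' (s *\<^sub>R v)) \<le> e' * norm (s *\<^sub>R v)"
    using r(2)[rule_format, of "x + s *\<^sub>R v"] by simp
  moreover have "\<phi>' (s *\<^sub>R v) = s *\<^sub>R \<phi>' v" using has_derivative_linear[OF d] by (rule linear_scale)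
  moreover have "c * norm (s *\<^sub>R v) \<le> norm (\<phi> (x + s *\<^sub>R v) - \<phi> x)" using c[of "x + s *\<^sub>R v"] by simp
  ultimately have "c * (s * norm v) \<le> s * norm (\<phi>' v) + e' * (s * norm v)"
    using norm_triangle_sub[of "\<phi> (x + s *\<^sub>R v) - \<phi> x" "s *\<^sub>R \<phi>' v"] s by simp
  then have "s * (c * norm v) \<le> s * (norm (\<phi>' v) + e' * norm v)" by (simp add: algebra_simps)
  then have "c * norm v \<le> norm (\<phi>' v) + e' * norm v" using s by simp
  moreover have "e' * norm v \<le> e' * n" unfolding n_def using e' by (intro mult_left_mono) auto
  moreover have "e' * n = e" unfolding e'_def using n by simp
  ultimately show "c * norm v \<le> norm (\<phi>' v) + e" by linarith
qed

text \<open>Compactness only bounds the absolute value of the determinant away from zero. The sign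
  follows by continuity in time, starting from determinant 1.\<close>

lemma flow_jacobian_det_bound:
  fixes u \<psi> :: "real \<Rightarrow> real^'n::finite \<Rightarrow> real^'n"
  assumes T: "T > 0" and L: "L \<ge> 0" "\<And>t x y. t \<in> {0..T} \<Longrightarrow> norm (u t x - u t y) \<le> L * norm (x - y)"
    and p0: "\<And>x. \<psi> 0 x = 0"
    and pd: "\<And>t x. t \<in> {0..T} \<Longrightarrow> ((\<lambda>t. \<psi> t x) has_vector_derivative u t (x + \<psi> t x)) (at t within {0..T})"
    and p: "ap_class \<gamma> T (Suc k) \<psi>"
  shows "\<exists>\<epsilon>>0. \<forall>t\<in>{0..T}. \<forall>x. det (mat 1 + jacobian (\<psi> t) (at x)) > \<epsilon>"
proof -
  obtain Z where Zd: "\<And>t x. t \<in> {0..T} \<Longrightarrow> (\<psi> t has_derivative (\<lambda>h. \<Sum>i\<in>UNIV. h $ i *\<^sub>R Z i t x)) (at x)"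
    and Zk: "\<And>i. ap_class \<gamma> T k (Z i)" by (rule ap_class_SucE[OF p]) (rule that)
  have Zb: "ap_base \<gamma> T (Z i)" for i by (rule ap_class_base[OF Zk])
  obtain N where N: "\<And>i. N i \<ge> 0" "\<And>i t x. t \<in> {0..T} \<Longrightarrow> norm (Z i t x) \<le> N i"
    using ap_base_bounded_family[where f = Z, OF Zb] by blast
  define A where "A t x = mat 1 + jacobian (\<psi> t) (at x)" for t x
  have jac: "jacobian (\<psi> t) (at x) = (\<chi> a b. Z b t x $ a)" if t: "t \<in> {0..T}" for t x
    unfolding jacobian_def frechet_derivative_at[OF Zd[OF t], symmetric]
    by (simp add: matrix_def sum_axis_scaleR)
  have A: "A t x $ a $ b = (if a = b then 1 else 0) + Z b t x $ a" if t: "t \<in> {0..T}" for t x a b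
    unfolding A_def jac[OF t] by (simp add: mat_def)
  have Ab: "norm (A t x) \<le> (\<Sum>i\<in>(UNIV :: 'n set). \<Sum>j\<in>UNIV. 1 + N j)" if t: "t \<in> {0..T}" for t x
  proof (rule norm_matrix_le)
    fix a b
    have "\<bar>Z b t x $ a\<bar> \<le> N b" using component_le_norm_cart[of "Z b t x" a] N(2)[OF t, of b x] by linarith
    then show "\<bar>A t x $ a $ b\<bar> \<le> 1 + N b" unfolding A[OF t] using N(1)[of b] by auto
  qed
  have Av: "A t x *v h = h + (\<Sum>i\<in>UNIV. h $ i *\<^sub>R Z i t x)" if t: "t \<in> {0..T}" for t x h
  proof -
    have "(\<chi> a b. Z b t x $ a) *v h = (\<Sum>i\<in>UNIV. h $ i *\<^sub>R Z i t x)"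
      by (simp add: vec_eq_iff matrix_vector_mult_def mult.commute)
    then show ?thesis unfolding A_def jac[OF t] by (simp add: matrix_vector_mult_add_rdistrib)
  qed
  define c where "c = exp (- (L * T))"
  have c: "c > 0" unfolding c_def by simp
  have exp: "c * norm v \<le> norm (A t x *v v)" if t: "t \<in> {0..T}" for t x v
    unfolding Av[OF t]
  proof (rule has_derivative_expansion[where \<phi> = "\<lambda>x. x + \<psi> t x" and x = x])
    show "((\<lambda>x. x + \<psi> t x) has_derivative (\<lambda>h. h + (\<Sum>i\<in>UNIV. h $ i *\<^sub>R Z i t x))) (at x)"
      by (rule has_derivative_add[OF has_derivative_ident Zd[OF t]])
    fix y
    have "norm ((y + \<psi> 0 y) - (x + \<psi> 0 x)) \<le> exp (L * T) * norm ((y + \<psi> t y) - (x + \<psi> t x))"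
    proof (rule gronwall_lower[OF L(1) _ _ t, where w = "\<lambda>t. (y + \<psi> t y) - (x + \<psi> t x)"])
      fix s assume s: "s \<in> {0..T}"
      have "((\<lambda>t. z + \<psi> t z) has_vector_derivative u s (z + \<psi> s z)) (at s within {0..T})" for z
        using has_vector_derivative_add[OF has_vector_derivative_const[of z] pd[OF s, of z]] by simp
      then show "((\<lambda>t. (y + \<psi> t y) - (x + \<psi> t x)) has_vector_derivative
        (u s (y + \<psi> s y) - u s (x + \<psi> s x))) (at s within {0..T})" by (intro has_vector_derivative_diff)
      show "norm (u s (y + \<psi> s y) - u s (x + \<psi> s x)) \<le> L * norm ((y + \<psi> s y) - (x + \<psi> s x))" by (rule L(2)[OF s])
    qed
    then have "c * norm (y - x) \<le> c * (exp (L * T) * norm ((y + \<psi> t y) - (x + \<psi> t x)))"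
      using c by (intro mult_left_mono) (simp_all add: p0)
    also have "\<dots> = norm ((y + \<psi> t y) - (x + \<psi> t x))"
      unfolding c_def by (simp add: exp_minus)
    finally show "c * norm (y - x) \<le> norm ((y + \<psi> t y) - (x + \<psi> t x))" .
  qed
  obtain \<epsilon> where eps: "\<epsilon> > 0" "\<And>B :: real^'n^'n. norm B \<le> (\<Sum>i\<in>(UNIV :: 'n set). \<Sum>j\<in>UNIV. 1 + N j) \<Longrightarrow>
    (\<And>v. c * norm v \<le> norm (B *v v)) \<Longrightarrow> \<epsilon> \<le> \<bar>det B\<bar>"
    using abs_det_lower_bound[OF c] by blast
  have lower: "\<epsilon> \<le> \<bar>det (A t x)\<bar>" if t: "t \<in> {0..T}" for t x
    by (rule eps(2)[OF Ab[OF t] exp[OF t]])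
  have ge: "\<epsilon> \<le> det (A t x)" if t: "t \<in> {0..T}" for t x
  proof (rule ccontr)
    assume "\<not> \<epsilon> \<le> det (A t x)"
    then have neg: "det (A t x) \<le> 0" using lower[OF t, of x] by linarith
    have "continuous_on {0..T} (\<lambda>s. \<chi> a b. (if a = b then 1 else 0) + Z b s x $ a)"
      by (intro continuous_intros ap_base_continuous_time[OF Zb])
    then have contA: "continuous_on {0..T} (\<lambda>s. A s x)"
      by (rule continuous_on_eq) (simp add: vec_eq_iff A)
    have cont: "continuous_on {0..T} (\<lambda>s. det (A s x))"
      by (rule continuous_on_compose2[OF continuous_on_det[of UNIV] contA]) simp
    have 0: "0 \<in> {0..T}" using T by simp
    have "\<psi> 0 = (\<lambda>x. 0)" using p0 by (intro ext)
    then have "(\<psi> 0 has_derivative (\<lambda>h. 0)) (at x)" by simp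
    from fun_cong[OF has_derivative_unique[OF Zd[OF 0, of x] this]]
    have "Z i 0 x = 0" for i using sum_axis_scaleR[of i "\<lambda>i. Z i 0 x"] by metis
    then have "A 0 x = mat 1" by (simp add: vec_eq_iff A[OF 0] mat_def)
    then have 1: "det (A 0 x) = 1" by simp
    \<comment> \<open>Reaching a nonpositive value from 1 would force a zero in between, which the
      bound on the absolute value excludes.\<close>
    have "\<exists>s. 0 \<le> s \<and> s \<le> t \<and> det (A s x) = 0"
      using t 1 neg by (intro IVT2' continuous_on_subset[OF cont]) auto
    then obtain s where "0 \<le> s" "s \<le> t" "det (A s x) = 0" by (elim exE conjE)
    then show False using lower[of s x] t eps(1) by simp
  qed
  \<comment> \<open>Halving turns the weak bound into the strict one that \<open>Diff_ap\<close>
    asks for.\<close>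
  have "\<epsilon> / 2 < det (A t x)" if "t \<in> {0..T}" for t x using ge[OF that, of x] eps(1) by linarith
  then show ?thesis using eps(1) unfolding A_def by (intro exI[of _ "\<epsilon> / 2"]) simp
qed

text \<open>Used for uniqueness: a competing solution is differentiable in the C^m norm, whose
  order-zero part controls values at each point, so it satisfies the ordinary differential equation
  pointwise.\<close>

lemma cm_has_derivative_on_pointwise:
  fixes Y v :: "real \<Rightarrow> real^'n::finite \<Rightarrow> real^'m::finite"
  assumes Y: "\<And>t. t \<in> {0..T} \<Longrightarrow> Cmb m (Y t)" and v: "\<And>t. t \<in> {0..T} \<Longrightarrow> Cmb m (v t)"
    and d: "cm_has_derivative_on m {0..T} Y v" and t: "t \<in> {0..T}"
  shows "((\<lambda>t. Y t x) has_vector_derivative v t x) (at t within {0..T})"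
  unfolding has_vector_derivative_def has_derivative_within_alt
proof (intro conjI allI impI bounded_linear_scaleR_left)
  fix e :: real assume e: "e > 0"
  from d[unfolded cm_has_derivative_on_def, rule_format, OF t e] obtain r where r: "r > 0"
    "\<forall>s\<in>{0..T}. s \<noteq> t \<and> \<bar>s - t\<bar> < r \<longrightarrow> cm_norm m (\<lambda>x. (Y s x - Y t x) /\<^sub>R (s - t) - v t x) < e"
    by (elim exE conjE)
  have "norm (Y s x - Y t x - (s - t) *\<^sub>R v t x) \<le> e * norm (s - t)" if s: "s \<in> {0..T}" and st: "norm (s - t) < r" for s
  proof (cases "s = t")
    case False
    have "Cmb m (\<lambda>x. inverse (s - t) *\<^sub>R (Y s x - Y t x) + (-1) *\<^sub>R v t x)"
      by (rule Cmb_lincomb(2)[OF Cmb_diff(2)[OF Y[OF s] Y[OF t]] v[OF t]])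
    then have "Cmb m (\<lambda>x. (Y s x - Y t x) /\<^sub>R (s - t) - v t x)" by simp
    from norm_dpart_le_cm_norm[OF this, of "[]" x] r(2) s st False
    have b: "norm ((Y s x - Y t x) /\<^sub>R (s - t) - v t x) \<le> e" by fastforce
    have "Y s x - Y t x - (s - t) *\<^sub>R v t x = (s - t) *\<^sub>R ((Y s x - Y t x) /\<^sub>R (s - t) - v t x)"
      using False by (simp add: scaleR_diff_right)
    also have "norm \<dots> = norm ((Y s x - Y t x) /\<^sub>R (s - t) - v t x) * norm (s - t)" by simp
    also have "\<dots> \<le> e * norm (s - t)" using b by (intro mult_right_mono) auto
    finally show ?thesis .
  qed simp
  then show "\<exists>r>0. \<forall>s\<in>{0..T}. norm (s - t) < r \<longrightarrow> norm (Y s x - Y t x - (s - t) *\<^sub>R v t x) \<le> e * norm (s - t)"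
    using r(1) by (intro exI[of _ r]) simp
qed

theorem theorem5p6:
  fixes m T :: real and u :: "real \<Rightarrow> real^'n::finite \<Rightarrow> real^'n"
  assumes "m \<ge> 2" and "T > 0"
    and "\<forall>t\<in>{0..T}. Cap m (u t)"
    and "cm_continuous_on m {0..T} u"
  shows "\<exists>\<phi>. is_flow_solution m T u \<phi> \<and>
           (\<forall>\<psi>. is_flow_solution m T u \<psi> \<longrightarrow> (\<forall>t\<in>{0..T}. \<psi> t = \<phi> t))"
proof -
  let ?g = "holder_frac m"
  have T: "T \<ge> 0" using assms(2) by simp
  have "holder_int m \<ge> 2" using assms(1) unfolding holder_int_def by linarith
  \<comment> \<open>At least one spatial derivative is available, which supplies the Lipschitz bound
    behind existence and uniqueness.\<close>
  then obtain k where k: "holder_int m = Suc k" by (cases "holder_int m") auto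
  have u: "ap_class ?g T (Suc k) u" using ap_class_of_Cap[OF assms(2-4)] by (simp only: k)
  obtain \<psi> K where p0: "\<And>x. \<psi> 0 x = 0"
    and pd: "\<And>t x. t \<in> {0..T} \<Longrightarrow> ((\<lambda>t. \<psi> t x) has_vector_derivative u t (x + \<psi> t x)) (at t within {0..T})"
    and p: "ap_class ?g T (Suc k) \<psi>" and K: "K \<ge> 0"
      "\<And>t x y. t \<in> {0..T} \<Longrightarrow> norm (\<psi> t x - \<psi> t y) \<le> K * norm (x - y)"
    by (rule ap_flow_exists[OF holder_frac_bounds T u]) (rule that)
  obtain u' where u': "\<And>t x. t \<in> {0..T} \<Longrightarrow> (u t has_derivative (\<lambda>h. \<Sum>i\<in>UNIV. h $ i *\<^sub>R u' i t x)) (at x)"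
    "\<And>i. ap_class ?g T k (u' i)" by (rule ap_class_SucE[OF u]) (rule that)
  obtain L where L: "L \<ge> 0" "\<And>t x y. t \<in> {0..T} \<Longrightarrow> norm (u t x - u t y) \<le> L * norm (x - y)"
    using ap_lipschitz[where f = u, OF u'(1) ap_class_base[OF u'(2)]] by blast
  define \<phi> where "\<phi> t x = x + \<psi> t x" for t x
  define v where "v t x = u t (x + \<psi> t x)" for t x
  have v: "ap_class ?g T (holder_int m) v"
    unfolding v_def k by (rule ap_class_compose[OF holder_frac_bounds(1) u p K])
  have p': "ap_class ?g T (holder_int m) \<psi>" using p by (simp only: k)
  have phi: "(\<lambda>x. \<phi> t x - x) = \<psi> t" for t unfolding \<phi>_def by simp
  have "\<exists>\<epsilon>>0. \<forall>t\<in>{0..T}. \<forall>x. det (mat 1 + jacobian (\<psi> t) (at x)) > \<epsilon>"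
    by (rule flow_jacobian_det_bound[OF assms(2) L p0 pd p])
  then obtain \<epsilon> where eps: "\<epsilon> > 0" "\<forall>t\<in>{0..T}. \<forall>x. det (mat 1 + jacobian (\<psi> t) (at x)) > \<epsilon>"
    by (elim exE conjE)
  have sol: "is_flow_solution m T u \<phi>"
    unfolding is_flow_solution_def
  proof (intro conjI)
    show "\<forall>t\<in>{0..T}. Diff_ap m (\<phi> t)"
      unfolding Diff_ap_def phi by (intro ballI conjI ap_class_Cap[OF p'] exI[of _ \<epsilon>] eps(1) allI eps(2)[rule_format])
    have "\<forall>t\<in>{0..T}. Cap m (v t)" by (intro ballI ap_class_Cap[OF v])
    moreover have "cm_has_derivative_on m {0..T} (\<lambda>t x. \<phi> t x - x) v"
      unfolding phi by (rule ap_class_cm_has_derivative[OF p' v]) (simp add: v_def pd)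
    moreover have "cm_continuous_on m {0..T} v" by (rule ap_class_cm_continuous[OF v])
    moreover have "\<forall>t\<in>{0..T}. \<forall>x. v t x = u t (\<phi> t x)" by (simp add: v_def \<phi>_def)
    ultimately show "\<exists>v. (\<forall>t\<in>{0..T}. Cap m (v t)) \<and> cm_has_derivative_on m {0..T} (\<lambda>t x. \<phi> t x - x) v \<and>
      cm_continuous_on m {0..T} v \<and> (\<forall>t\<in>{0..T}. \<forall>x. v t x = u t (\<phi> t x))"
      by (intro exI[of _ v] conjI)
    show "\<phi> 0 = id" by (rule ext) (simp add: \<phi>_def p0)
  qed
  define C where "C = gronwall_const L T"
  have C: "C > 0" unfolding C_def by (rule gronwall_const_pos)
  note gron = gronwall[where T = T, OF L(1), folded C_def]
  have "\<eta> t = \<phi> t" if chi: "is_flow_solution m T u \<eta>" and t: "t \<in> {0..T}" for \<eta> t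
  proof
    fix x
    from chi obtain w where w: "\<forall>t\<in>{0..T}. Cap m (w t)" "cm_has_derivative_on m {0..T} (\<lambda>t x. \<eta> t x - x) w"
      "\<forall>t\<in>{0..T}. \<forall>x. w t x = u t (\<eta> t x)" and chi0: "\<eta> 0 = id"
      and Dap: "\<forall>t\<in>{0..T}. Diff_ap m (\<eta> t)"
      unfolding is_flow_solution_def by (elim conjE exE)
    have chid: "((\<lambda>t. \<eta> t x - x) has_vector_derivative u s (\<eta> s x)) (at s within {0..T})" if s: "s \<in> {0..T}" for s
    proof -
      have "((\<lambda>t. \<eta> t x - x) has_vector_derivative w s x) (at s within {0..T})"
        by (rule cm_has_derivative_on_pointwise[where Y = "\<lambda>t x. \<eta> t x - x", OF _ _ w(2) s])
          (use Dap w(1) in \<open>simp_all add: Diff_ap_def Cap_Cmb\<close>)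
      then show ?thesis using w(3) s by simp
    qed
    \<comment> \<open>Gronwall with zero initial difference and zero error forces the two
      trajectories to coincide.\<close>
    have "\<forall>t\<in>{0..T}. norm ((\<eta> t x - x) - \<psi> t x) \<le> C * (norm ((\<eta> 0 x - x) - \<psi> 0 x) + 0)"
    proof (rule gron[OF has_vector_derivative_diff[OF chid pd]])
      fix s assume s: "s \<in> {0..T}"
      show "norm (u s (\<eta> s x) - u s (x + \<psi> s x)) \<le> L * norm ((\<eta> s x - x) - \<psi> s x) + 0"
        using L(2)[OF s, of "\<eta> s x" "x + \<psi> s x"] by (simp add: algebra_simps)
    qed simp_all
    then have "norm ((\<eta> t x - x) - \<psi> t x) \<le> 0" using t chi0 p0 by simp
    then show "\<eta> t x = \<phi> t x" unfolding \<phi>_def by (simp add: algebra_simps)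
  qed
  then show ?thesis by (intro exI[of _ \<phi>] conjI sol allI impI ballI)
qed

end
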